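(* Let $\theta_1^*,\dots,\theta_n^*\in\mathbb{R}^d$ all lie in the Euclidean ball of radius $B$ centered at the origin, let $\nu_n^*=\frac1n\sum_{i=1}^n\delta_{\theta_i^*}$, and let $Y_1,\dots,Y_n$ be i.i.d. with density $\varphi_\sigma\star\nu_n^*$, where $\varphi_\sigma$ is the $N(0,\sigma^2I_d)$ density. Let $\widehat{\mathsf f}_n$ be the Kiefer–Wolfowitz NPMLE and $\widehat\nu$ its mixing measure, so that $\widehat\nu\star\varphi_\sigma=\widehat{\mathsf f}_n$. Let $s>k\ge1$. There are constants $C_0=C_0(d,B,\sigma)>0$ and $C=C(s,k,d,\sigma,B)>0$ such that if $n\ge C_0(\log n)^{d+1}$, then with probability at least $1-5/n$, $$\mathsf W_k^k(\nu_n^*,\widehat\nu)\le C\left(\frac{1}{\log n}\right)^{k/2}.$$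
   Context: The Kiefer–Wolfowitz NPMLE is a minimizer $\widehat{\mathsf f}_n$ of $-\sum_{i=1}^n\log\mathsf f(Y_i)$ over all densities of the form $\mathsf f(y)=\int\varphi_\sigma(y-\theta)\,d\nu(\theta)$ with $\nu$ a probability distribution on $\mathbb{R}^d$; the mixing measure $\widehat\nu$ is an atomic probability measure. For $k\ge1$ and probability measures $\mu,\nu$ with finite $k$-th moments, $\mathsf W_k(\mu,\nu)=\big(\inf_\gamma\int\int\|x-y\|_2^k\,d\gamma(x,y)\big)^{1/k}$, the infimum over couplings $\gamma$ of $\mu$ and $\nu$. *)

theory Defs
  imports "HOL-Probability.Probability"
begin

definition gauss_dens :: "real \<Rightarrow> 'a::euclidean_space \<Rightarrow> real" where
  "gauss_dens \<sigma> x = exp (- (norm x)\<^sup>2 / (2 * \<sigma>\<^sup>2)) / (sqrt (2 * pi * \<sigma>\<^sup>2)) ^ DIM('a)"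

definition borel_prob :: "'a::euclidean_space measure \<Rightarrow> bool" where
  "borel_prob \<nu> \<longleftrightarrow> prob_space \<nu> \<and> sets \<nu> = sets borel"

definition mix_dens :: "real \<Rightarrow> 'a::euclidean_space measure \<Rightarrow> 'a \<Rightarrow> real" where
  "mix_dens \<sigma> \<nu> y = (\<integral>\<theta>. gauss_dens \<sigma> (y - \<theta>) \<partial>\<nu>)"

definition emp_measure :: "nat \<Rightarrow> (nat \<Rightarrow> 'a::euclidean_space) \<Rightarrow> 'a measure" where
  "emp_measure n \<theta> = measure_of UNIV (sets borel)
      (\<lambda>A. ennreal ((\<Sum>i<n. indicator A (\<theta> i)) / real n))"

definition npmle :: "real \<Rightarrow> nat \<Rightarrow> (nat \<Rightarrow> 'a::euclidean_space) \<Rightarrow> 'a measure \<Rightarrow> bool" where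
  "npmle \<sigma> n y \<nu> \<longleftrightarrow> borel_prob \<nu> \<and>
     (\<forall>\<mu>. borel_prob \<mu> \<longrightarrow>
        - (\<Sum>i<n. ln (mix_dens \<sigma> \<nu> (y i))) \<le> - (\<Sum>i<n. ln (mix_dens \<sigma> \<mu> (y i))))"

definition couplings :: "'a::euclidean_space measure \<Rightarrow> 'a measure \<Rightarrow> ('a \<times> 'a) measure set" where
  "couplings \<mu> \<nu> = {\<gamma>. prob_space \<gamma> \<and> sets \<gamma> = sets (borel :: ('a \<times> 'a) measure) \<and>
      distr \<gamma> borel fst = \<mu> \<and> distr \<gamma> borel snd = \<nu>}"

definition wasserstein_pow :: "real \<Rightarrow> 'a::euclidean_space measure \<Rightarrow> 'a measure \<Rightarrow> ennreal" where
  "wasserstein_pow k \<mu> \<nu> =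
     (INF \<gamma>\<in>couplings \<mu> \<nu>. \<integral>\<^sup>+ p. ennreal (norm (fst p - snd p) powr k) \<partial>\<gamma>)"

text \<open>Law of the i.i.d. sample Y_0,...,Y_{n-1} with density phi_sigma * nu_n^*:
  the product measure; the sample is the coordinate vector omega.\<close>
definition sample_space :: "real \<Rightarrow> nat \<Rightarrow> (nat \<Rightarrow> 'a::euclidean_space) \<Rightarrow> (nat \<Rightarrow> 'a) measure" where
  "sample_space \<sigma> n \<theta> =
     PiM {..<n} (\<lambda>_. density lborel (\<lambda>y. ennreal (mix_dens \<sigma> (emp_measure n \<theta>) y)))"

end

theory Submission
  imports Defs
begin

text \<open>
  Any polynomial rate for the \<open>L\<^sup>1\<close> distance of the mixture densities suffices, because deconvolving at
  scale \<open>h\<close> costs a factor \<open>exp (c / h\<^sup>2)\<close>, which is a small power of \<open>n\<close> when \<open>h\<close> is of order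
  \<open>1 / sqrt (ln n)\<close>.

  Statistics. With high probability all observations lie in a ball of radius \<open>R\<close> of order
  \<open>sqrt (ln n)\<close>; projecting the mixing measure onto that ball increases the likelihood, so the NPMLE is
  supported there. Mixtures over the ball have finitely many upper brackets: round the atoms to a
  grid of mesh \<open>\<epsilon>\<close>, inflate the variance by \<open>1 + \<epsilon>\<close>, and round the weights up. Markov's inequality for
  the square root of the likelihood ratio and a union bound show that every bracket whose likelihood
  beats that of the truth is close to it in Hellinger distance.

  Deconvolution. The power \<open>sinc\<^sup>j\<close> is the cosine transform of a law on \<open>[-j, j]\<close>, hence a product of rescaled
  sinc powers is the convolution of the Gaussian with an explicitly bounded function. Smoothing both
  mixing measures by this kernel gives densities that are uniformly close, and a coupling through the
  smoothed point turns this into a bound on the transport cost.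
\<close>

section \<open>Coupling through a smoothing kernel\<close>

text \<open>The kernel has to meet two demands at once. The smoothed measures must be genuine
  densities with a k-th moment of order \<open>h powr k\<close>, since they serve to build a
  coupling; and the kernel must be band-limited, so that inverting the Gaussian costs a bounded
  factor. Even powers of sinc satisfy both. The coupling is explicit, so neither duality nor the
  existence of optimal plans enters. The support radius R grows with n but does no harm: the maximal
  cost \<open>(2 * R) powr k\<close> multiplies either a mass that is polynomially small in n, or a
  tail mass of order \<open>h powr k / R powr k\<close>, in which R cancels. What survives is
  \<open>h powr k\<close>, which is of order (1 / ln n)^(k/2). The good event is fixed through
  finitely many deterministic brackets; on it every NPMLE is treated at once, so no measurable
  choice of a minimizer is involved.\<close>

lemma borel_probD:
  assumes "borel_prob \<nu>"
  shows "prob_space \<nu>" "sets \<nu> = sets borel" "space \<nu> = UNIV"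
  using assms sets_eq_imp_space_eq[of \<nu> borel] by (auto simp: borel_prob_def)

text \<open>\<open>G\<close> is the density, with respect to the product measure, of a partial
  transport plan whose marginals lie below \<mu> and \<nu>. Both marginals miss the same mass
  \<delta>, so the plan can be completed by moving the leftovers independently of each other, that
  is by the product of the residuals divided by \<delta>. The added part has mass \<delta> and costs
  at most \<open>D\<close> per unit.\<close>

lemma subcoupling_extends:
  fixes \<mu> \<nu> :: "'a::euclidean_space measure" and G c :: "'a \<times> 'a \<Rightarrow> ennreal"
  assumes \<mu>: "borel_prob \<mu>" and \<nu>: "borel_prob \<nu>"
    and G[measurable]: "G \<in> borel_measurable borel"
    and c[measurable]: "c \<in> borel_measurable borel"
    and u: "\<And>x. (\<integral>\<^sup>+y. G (x, y) \<partial>\<nu>) \<le> 1"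
    and v: "\<And>y. (\<integral>\<^sup>+x. G (x, y) \<partial>\<mu>) \<le> 1"
    and cD: "AE x in \<mu>. AE y in \<nu>. c (x, y) \<le> D"
  shows "\<exists>\<gamma>\<in>couplings \<mu> \<nu>. (\<integral>\<^sup>+p. c p \<partial>\<gamma>)
    \<le> (\<integral>\<^sup>+x. \<integral>\<^sup>+y. c (x, y) * G (x, y) \<partial>\<nu> \<partial>\<mu>) + D * (1 - (\<integral>\<^sup>+x. \<integral>\<^sup>+y. G (x, y) \<partial>\<nu> \<partial>\<mu>))"
proof -
  interpret M: prob_space \<mu> using \<mu> by (rule borel_probD)
  interpret N: prob_space \<nu> using \<nu> by (rule borel_probD)
  interpret MN: pair_prob_space \<mu> \<nu> ..
  have [measurable_cong, simp]: "sets \<mu> = sets borel" "sets \<nu> = sets borel"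
    using \<mu> \<nu> by (auto simp: borel_prob_def)
  have [simp]: "space \<mu> = UNIV" "space \<nu> = UNIV" using \<mu> \<nu> by (auto dest: borel_probD)
  have G'[measurable]: "G \<in> borel_measurable (borel \<Otimes>\<^sub>M borel)"
    and c'[measurable]: "c \<in> borel_measurable (borel \<Otimes>\<^sub>M borel)"
    using G c by (simp_all add: borel_prod)
  define a where "a x = 1 - (\<integral>\<^sup>+y. G (x, y) \<partial>\<nu>)" for x
  define b where "b y = 1 - (\<integral>\<^sup>+x. G (x, y) \<partial>\<mu>)" for y
  define \<delta> where "\<delta> = 1 - (\<integral>\<^sup>+x. \<integral>\<^sup>+y. G (x, y) \<partial>\<nu> \<partial>\<mu>)"
  have [measurable]: "a \<in> borel_measurable borel" unfolding a_def by measurable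
  have [measurable]: "b \<in> borel_measurable borel" unfolding b_def by measurable
  have fin: "(\<integral>\<^sup>+x. \<integral>\<^sup>+y. G (x, y) \<partial>\<nu> \<partial>\<mu>) \<le> 1"
    using nn_integral_mono[of \<mu> "\<lambda>x. \<integral>\<^sup>+y. G (x, y) \<partial>\<nu>" "\<lambda>_. 1"] u
    by (simp add: M.emeasure_space_1[simplified])
  have swap: "(\<integral>\<^sup>+y. \<integral>\<^sup>+x. G (x, y) \<partial>\<mu> \<partial>\<nu>) = (\<integral>\<^sup>+x. \<integral>\<^sup>+y. G (x, y) \<partial>\<nu> \<partial>\<mu>)"
    by (rule MN.Fubini') simp
  have int_a: "(\<integral>\<^sup>+x. a x \<partial>\<mu>) = \<delta>"
    unfolding a_def \<delta>_def
    by (subst nn_integral_diff)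
      (use fin u in \<open>auto simp: M.emeasure_space_1[simplified] top_unique intro: le_less_trans\<close>)
  have int_b: "(\<integral>\<^sup>+y. b y \<partial>\<nu>) = \<delta>"
    unfolding b_def \<delta>_def
    by (subst nn_integral_diff)
      (use fin v swap in \<open>auto simp: N.emeasure_space_1[simplified] top_unique intro: le_less_trans\<close>)
  \<comment> \<open>In \<open>ennreal\<close> the inverse of 0 is infinite, so a full plan (\<delta>
    = 0) needs its own case: then the residuals \<open>a\<close> and \<open>b\<close> vanish almost
    everywhere and the infinite factor is multiplied by 0.\<close>
  have \<delta>_cancel: "\<delta> = 0 \<or> \<delta> * inverse \<delta> = 1"
    unfolding \<delta>_def
    by (metis diff_le_self_ennreal divide_ennreal_def ennreal_divide_self ennreal_one_less_top
        order_le_less_trans)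
  \<comment> \<open>The residual at y is \<open>b y\<close>, and \<open>b\<close> integrates to
    \<delta>; hence dividing by \<delta> makes the added term contribute exactly \<open>a x\<close>
    to the first marginal, and symmetrically \<open>b y\<close> to the second.\<close>
  define H where "H p = G p + a (fst p) * (b (snd p) * inverse \<delta>)" for p
  have [measurable]: "H \<in> borel_measurable (borel \<Otimes>\<^sub>M borel)" unfolding H_def by measurable
  have a1: "a x + (\<integral>\<^sup>+y. G (x, y) \<partial>\<nu>) = 1" for x
    unfolding a_def using u[of x] by (simp add: diff_add_cancel_ennreal)
  have b1: "b y + (\<integral>\<^sup>+x. G (x, y) \<partial>\<mu>) = 1" for y
    unfolding b_def using v[of y] by (simp add: diff_add_cancel_ennreal)
  have a\<delta>: "AE x in \<mu>. a x * (\<delta> * inverse \<delta>) = a x"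
  proof (cases "\<delta> = 0")
    case True
    then have "AE x in \<mu>. a x = 0" using int_a nn_integral_0_iff_AE[of a \<mu>] by simp
    then show ?thesis by eventually_elim simp
  qed (use \<delta>_cancel in auto)
  have b\<delta>: "AE x in \<nu>. b x * (\<delta> * inverse \<delta>) = b x"
  proof (cases "\<delta> = 0")
    case True
    then have "AE x in \<nu>. b x = 0" using int_b nn_integral_0_iff_AE[of b \<nu>] by simp
    then show ?thesis by eventually_elim simp
  qed (use \<delta>_cancel in auto)
  have H1: "AE x in \<mu>. (\<integral>\<^sup>+y. H (x, y) \<partial>\<nu>) = 1"
    using a\<delta>
  proof eventually_elim
    case (elim x)
    have "(\<integral>\<^sup>+y. H (x, y) \<partial>\<nu>) = (\<integral>\<^sup>+y. G (x, y) \<partial>\<nu>) + a x * ((\<integral>\<^sup>+y. b y \<partial>\<nu>) * inverse \<delta>)"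
      unfolding H_def by (simp add: nn_integral_add nn_integral_cmult nn_integral_multc)
    then show ?case using a1[of x] elim by (simp add: int_b add.commute)
  qed
  have H2: "AE y in \<nu>. (\<integral>\<^sup>+x. H (x, y) \<partial>\<mu>) = 1"
    using b\<delta>
  proof eventually_elim
    case (elim y)
    have "(\<integral>\<^sup>+x. H (x, y) \<partial>\<mu>) = (\<integral>\<^sup>+x. G (x, y) \<partial>\<mu>) + (\<integral>\<^sup>+x. a x \<partial>\<mu>) * (b y * inverse \<delta>)"
      unfolding H_def by (simp add: nn_integral_add nn_integral_multc)
    then show ?case using b1[of y] elim by (simp add: int_a add.commute mult.left_commute)
  qed
  define \<gamma> where "\<gamma> = density (\<mu> \<Otimes>\<^sub>M \<nu>) H"
  have sets\<gamma>: "sets \<gamma> = sets (borel :: ('a \<times> 'a) measure)"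
    unfolding \<gamma>_def borel_prod[symmetric] by (simp cong: sets_pair_measure_cong)
  have [measurable_cong]: "sets \<gamma> = sets (borel \<Otimes>\<^sub>M borel)"
    by (rule sets\<gamma>[unfolded borel_prod[symmetric]])
  have int\<gamma>: "(\<integral>\<^sup>+p. f p \<partial>\<gamma>) = (\<integral>\<^sup>+x. \<integral>\<^sup>+y. H (x, y) * f (x, y) \<partial>\<nu> \<partial>\<mu>)"
    if [measurable]: "f \<in> borel_measurable (borel \<Otimes>\<^sub>M borel)" for f
    unfolding \<gamma>_def by (simp add: nn_integral_density N.nn_integral_fst[symmetric])
  have d1: "distr \<gamma> borel fst = \<mu>"
  proof (rule measure_eqI)
    fix A assume "A \<in> sets (distr \<gamma> borel fst)"
    then have [measurable]: "A \<in> sets borel" by simp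
    have "emeasure (distr \<gamma> borel fst) A = (\<integral>\<^sup>+p. indicator A (fst p) \<partial>\<gamma>)"
      by (subst nn_integral_indicator[symmetric], simp)
        (subst nn_integral_distr, simp_all)
    also have "\<dots> = (\<integral>\<^sup>+x. (\<integral>\<^sup>+y. H (x, y) \<partial>\<nu>) * indicator A x \<partial>\<mu>)"
      by (subst int\<gamma>) (simp_all add: nn_integral_multc)
    also have "\<dots> = (\<integral>\<^sup>+x. indicator A x \<partial>\<mu>)"
      by (rule nn_integral_cong_AE) (use H1 in eventually_elim, simp)
    finally show "emeasure (distr \<gamma> borel fst) A = emeasure \<mu> A" by simp
  qed simp
  have d2: "distr \<gamma> borel snd = \<nu>"
  proof (rule measure_eqI)
    fix A assume "A \<in> sets (distr \<gamma> borel snd)"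
    then have [measurable]: "A \<in> sets borel" by simp
    have "emeasure (distr \<gamma> borel snd) A = (\<integral>\<^sup>+p. indicator A (snd p) \<partial>\<gamma>)"
      by (subst nn_integral_indicator[symmetric], simp)
        (subst nn_integral_distr, simp_all)
    also have "\<dots> = (\<integral>\<^sup>+x. \<integral>\<^sup>+y. H (x, y) * indicator A y \<partial>\<nu> \<partial>\<mu>)"
      by (subst int\<gamma>) simp_all
    also have "\<dots> = (\<integral>\<^sup>+y. \<integral>\<^sup>+x. H (x, y) * indicator A y \<partial>\<mu> \<partial>\<nu>)"
      by (rule MN.Fubini'[symmetric]) simp
    also have "\<dots> = (\<integral>\<^sup>+y. (\<integral>\<^sup>+x. H (x, y) \<partial>\<mu>) * indicator A y \<partial>\<nu>)"
      by (simp add: nn_integral_multc)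
    also have "\<dots> = (\<integral>\<^sup>+y. indicator A y \<partial>\<nu>)"
      by (rule nn_integral_cong_AE) (use H2 in eventually_elim, simp)
    finally show "emeasure (distr \<gamma> borel snd) A = emeasure \<nu> A" by simp
  qed simp
  have "prob_space \<gamma>"
    using prob_space_distrD[of fst \<gamma> borel] d1 M.prob_space_axioms by simp
  then have mem: "\<gamma> \<in> couplings \<mu> \<nu>"
    using sets\<gamma> d1 d2 by (simp add: couplings_def)
  have "(\<integral>\<^sup>+p. c p \<partial>\<gamma>) = (\<integral>\<^sup>+x. \<integral>\<^sup>+y. H (x, y) * c (x, y) \<partial>\<nu> \<partial>\<mu>)"
    by (simp add: int\<gamma>)
  also have "\<dots> \<le> (\<integral>\<^sup>+x. \<integral>\<^sup>+y. c (x, y) * G (x, y) + D * (a x * (b y * inverse \<delta>)) \<partial>\<nu> \<partial>\<mu>)"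
  proof (rule nn_integral_mono_AE, use cD in eventually_elim)
    case (elim x)
    show ?case
    proof (rule nn_integral_mono_AE, use elim in eventually_elim)
      case (elim y)
      then show ?case
        unfolding H_def fst_conv snd_conv mult.commute[of _ "c (x, y)"] distrib_left
        by (intro add_mono order_refl mult_right_mono) simp_all
    qed
  qed
  also have "\<dots> = (\<integral>\<^sup>+x. \<integral>\<^sup>+y. c (x, y) * G (x, y) \<partial>\<nu> \<partial>\<mu>) + D * (\<delta> * (\<delta> * inverse \<delta>))"
    by (simp add: nn_integral_add nn_integral_cmult nn_integral_multc int_a int_b)
  also have "D * (\<delta> * (\<delta> * inverse \<delta>)) = D * \<delta>" using \<delta>_cancel by auto
  finally show ?thesis using mem unfolding \<delta>_def by blast
qed

lemma nn_integral_lborel_diff: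
  fixes f :: "'a::euclidean_space \<Rightarrow> ennreal"
  assumes [measurable]: "f \<in> borel_measurable borel"
  shows "(\<integral>\<^sup>+x. f (x - t) \<partial>lborel) = (\<integral>\<^sup>+x. f x \<partial>lborel)"
proof -
  have "(\<integral>\<^sup>+x. f x \<partial>lborel) = (\<integral>\<^sup>+x. f x \<partial>distr lborel borel ((+) (- t)))"
    by (simp only: lborel_distr_plus)
  also have "\<dots> = (\<integral>\<^sup>+x. f (- t + x) \<partial>lborel)"
    by (subst nn_integral_distr) simp_all
  finally show ?thesis by simp
qed

lemma powr_add_le_2powr:
  fixes a b k :: real
  assumes "0 \<le> a" "0 \<le> b" "0 \<le> k"
  shows "(a + b) powr k \<le> 2 powr k * (a powr k + b powr k)"
proof -
  have "(a + b) powr k \<le> (2 * max a b) powr k"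
    using assms by (intro powr_mono2) auto
  also have "\<dots> = 2 powr k * max a b powr k" using assms by (simp add: powr_mult)
  also have "\<dots> \<le> 2 powr k * (a powr k + b powr k)"
    by (intro mult_left_mono) (auto simp: max_def)
  finally show ?thesis .
qed

text \<open>Let p and q be the densities of \<mu> and \<nu> smoothed by \<open>K\<close>. Draw a
  common point x with density min(p, q), then \<theta> and \<theta>' independently from the two
  conditional laws given x. Both lie near x in the sense of the k-th moment \<open>m\<close>, which
  bounds the cost of this partial plan; the completion pays at most \<open>(2 * R) powr k\<close>
  for the mass not covered. That mass is the integral of the positive part of p - q: inside radius
  2R it is at most \<open>D\<close> times a volume, outside it is a moment tail.\<close>

lemma wasserstein_pow_smoothing:
  fixes \<mu> \<nu> :: "'a::euclidean_space measure" and K :: "'a \<Rightarrow> real"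
  assumes \<mu>: "borel_prob \<mu>" and \<nu>: "borel_prob \<nu>" and R: "R > 0" and k: "k > 0"
    and supp\<mu>: "AE \<theta> in \<mu>. norm \<theta> \<le> R" and supp\<nu>: "AE \<theta> in \<nu>. norm \<theta> \<le> R"
    and K[measurable]: "K \<in> borel_measurable borel"
    and K0: "\<And>x. 0 \<le> K x" and Kb: "\<And>x. K x \<le> b"
    and K1: "(\<integral>\<^sup>+x. ennreal (K x) \<partial>lborel) = 1"
    and Km: "(\<integral>\<^sup>+x. ennreal (norm x powr k * K x) \<partial>lborel) \<le> ennreal m" and m: "m \<ge> 0"
    and D: "\<And>x. \<bar>(\<integral>\<theta>. K (x - \<theta>) \<partial>\<mu>) - (\<integral>\<theta>. K (x - \<theta>) \<partial>\<nu>)\<bar> \<le> D"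
  shows "wasserstein_pow k \<mu> \<nu> \<le>
    ennreal (2 * (2 powr k * m) + (2 * R) powr k * ((4 * R) ^ DIM('a) * D + m / R powr k))"
proof -
  interpret M: prob_space \<mu> using \<mu> by (rule borel_probD)
  interpret N: prob_space \<nu> using \<nu> by (rule borel_probD)
  interpret MN: pair_prob_space \<mu> \<nu> ..
  interpret MuL: pair_sigma_finite \<mu> lborel ..
  interpret NuL: pair_sigma_finite \<nu> lborel ..
  have [measurable_cong, simp]: "sets \<mu> = sets borel" "sets \<nu> = sets borel"
    using \<mu> \<nu> by (auto simp: borel_prob_def)
  have [simp]: "space \<mu> = UNIV" "space \<nu> = UNIV" using \<mu> \<nu> by (auto dest: borel_probD)
  have b0: "b \<ge> 0" using K0 Kb order_trans by blast
  have D0: "D \<ge> 0" using D[of 0] by linarith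
  define p where "p x = (\<integral>\<theta>. K (x - \<theta>) \<partial>\<mu>)" for x
  define q where "q x = (\<integral>\<theta>. K (x - \<theta>) \<partial>\<nu>)" for x
  have p0: "p x \<ge> 0" and q0: "q x \<ge> 0" for x
    unfolding p_def q_def by (simp_all add: K0)
  have p: "(\<integral>\<^sup>+\<theta>. ennreal (K (x - \<theta>)) \<partial>\<mu>) = ennreal (p x)" for x
    unfolding p_def by (rule nn_integral_eq_integral)
      (auto intro!: M.integrable_const_bound[where B=b] simp: K0 Kb)
  have q: "(\<integral>\<^sup>+\<theta>. ennreal (K (x - \<theta>)) \<partial>\<nu>) = ennreal (q x)" for x
    unfolding q_def by (rule nn_integral_eq_integral)
      (auto intro!: N.integrable_const_bound[where B=b] simp: K0 Kb)
  have [measurable]: "p \<in> borel_measurable borel" "q \<in> borel_measurable borel"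
    unfolding p_def[abs_def] q_def[abs_def] by measurable
  \<comment> \<open>The product of the conditional densities with min(p, q) is K K min(p, q) / (p
    q), which equals K K / max(p, q). The latter form bounds both marginals by 1 directly.\<close>
  define w where "w x = inverse (max (ennreal (p x)) (ennreal (q x)))" for x
  have [measurable]: "w \<in> borel_measurable borel" unfolding w_def by measurable
  have le_max: "s * inverse (max s t) \<le> 1" if "s < \<infinity>" "t < \<infinity>" for s t :: ennreal
  proof (cases "s = 0")
    case False
    have "s * inverse (max s t) \<le> max s t * inverse (max s t)" by (intro mult_right_mono) auto
    also have "\<dots> = 1" using False that
      by (metis divide_ennreal_def ennreal_divide_self infinity_ennreal_def
          max_def le_zero_eq)
    finally show ?thesis .
  qed simp
  have qw: "ennreal (q x) * w x \<le> 1" for x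
    unfolding w_def using le_max[of "ennreal (q x)" "ennreal (p x)"] by (simp add: max.commute)
  have pw: "ennreal (p x) * w x \<le> 1" for x
    unfolding w_def using le_max[of "ennreal (p x)" "ennreal (q x)"] by simp
  have pqw: "ennreal (p x) * (ennreal (q x) * w x) = min (ennreal (p x)) (ennreal (q x))" for x
  proof (cases "p x = 0 \<or> q x = 0")
    case True then show ?thesis using p0[of x] q0[of x] by (auto simp: min_def)
  next
    case False
    then have *: "ennreal (p x) * inverse (ennreal (p x)) = 1" "ennreal (q x) * inverse (ennreal (q x)) = 1"
      using p0[of x] q0[of x]
      by (metis divide_ennreal_def ennreal_divide_self ennreal_eq_0_iff ennreal_less_top order_antisym)+
    show ?thesis
    proof (cases "ennreal (p x) \<le> ennreal (q x)")
      case True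
      then show ?thesis using * by (simp add: w_def max_def min_def)
    next
      case False
      then have "ennreal (p x) * (ennreal (q x) * w x) = ennreal (q x) * (ennreal (p x) * inverse (ennreal (p x)))"
        by (simp only: w_def max_def if_False mult.left_commute)
      then show ?thesis using False * by (simp add: min_def)
    qed
  qed
  \<comment> \<open>Density of the part of the coupling in which both points generate the same smoothed point \<open>x\<close>;
    where \<open>p x = q x = 0\<close> the weight \<open>w x\<close> is infinite, but it only occurs multiplied by \<open>0\<close>.\<close>
  define G where "G z = (\<integral>\<^sup>+x. ennreal (K (x - fst z)) * (ennreal (K (x - snd z)) * w x) \<partial>lborel)" for z :: "'a \<times> 'a"
  have [measurable]: "G \<in> borel_measurable borel"
    unfolding G_def borel_prod[symmetric] by measurable
  \<comment> \<open>Given the common point x the two draws are independent, so the inner integrals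
    factor. The same identity with \<open>f = g = K\<close> gives the mass of the plan, and with
    \<open>L\<close> in one slot it gives the two halves of the cost.\<close>
  have triple: "(\<integral>\<^sup>+\<theta>. \<integral>\<^sup>+\<theta>'. \<integral>\<^sup>+x. f (x - \<theta>) * (g (x - \<theta>') * w x) \<partial>lborel \<partial>\<nu> \<partial>\<mu>)
      = (\<integral>\<^sup>+x. (\<integral>\<^sup>+\<theta>. f (x - \<theta>) \<partial>\<mu>) * ((\<integral>\<^sup>+\<theta>'. g (x - \<theta>') \<partial>\<nu>) * w x) \<partial>lborel)"
    if [measurable]: "f \<in> borel_measurable borel" "g \<in> borel_measurable borel" for f g :: "'a \<Rightarrow> ennreal"
  proof -
    have "(\<integral>\<^sup>+\<theta>. \<integral>\<^sup>+\<theta>'. \<integral>\<^sup>+x. f (x - \<theta>) * (g (x - \<theta>') * w x) \<partial>lborel \<partial>\<nu> \<partial>\<mu>)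
      = (\<integral>\<^sup>+\<theta>. \<integral>\<^sup>+x. \<integral>\<^sup>+\<theta>'. f (x - \<theta>) * (g (x - \<theta>') * w x) \<partial>\<nu> \<partial>lborel \<partial>\<mu>)"
      by (intro nn_integral_cong NuL.Fubini'[symmetric]) simp
    also have "\<dots> = (\<integral>\<^sup>+\<theta>. \<integral>\<^sup>+x. f (x - \<theta>) * ((\<integral>\<^sup>+\<theta>'. g (x - \<theta>') \<partial>\<nu>) * w x) \<partial>lborel \<partial>\<mu>)"
      by (simp add: nn_integral_cmult nn_integral_multc)
    also have "\<dots> = (\<integral>\<^sup>+x. \<integral>\<^sup>+\<theta>. f (x - \<theta>) * ((\<integral>\<^sup>+\<theta>'. g (x - \<theta>') \<partial>\<nu>) * w x) \<partial>\<mu> \<partial>lborel)"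
      by (rule MuL.Fubini'[symmetric]) simp
    also have "\<dots> = (\<integral>\<^sup>+x. (\<integral>\<^sup>+\<theta>. f (x - \<theta>) \<partial>\<mu>) * ((\<integral>\<^sup>+\<theta>'. g (x - \<theta>') \<partial>\<nu>) * w x) \<partial>lborel)"
      by (simp add: nn_integral_multc)
    finally show ?thesis .
  qed
  have conv\<mu>: "(\<integral>\<^sup>+x. \<integral>\<^sup>+\<theta>. f (x - \<theta>) \<partial>\<mu> \<partial>lborel) = (\<integral>\<^sup>+x. f x \<partial>lborel)"
    if [measurable]: "f \<in> borel_measurable borel" for f :: "'a \<Rightarrow> ennreal"
    by (subst MuL.Fubini') (simp_all add: nn_integral_lborel_diff M.emeasure_space_1[simplified])
  have conv\<nu>: "(\<integral>\<^sup>+x. \<integral>\<^sup>+\<theta>. f (x - \<theta>) \<partial>\<nu> \<partial>lborel) = (\<integral>\<^sup>+x. f x \<partial>lborel)"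
    if [measurable]: "f \<in> borel_measurable borel" for f :: "'a \<Rightarrow> ennreal"
    by (subst NuL.Fubini') (simp_all add: nn_integral_lborel_diff N.emeasure_space_1[simplified])
  have u: "(\<integral>\<^sup>+y. G (x, y) \<partial>\<nu>) \<le> 1" for x
  proof -
    have "(\<integral>\<^sup>+y. G (x, y) \<partial>\<nu>) = (\<integral>\<^sup>+z. \<integral>\<^sup>+y. ennreal (K (z - x)) * (ennreal (K (z - y)) * w z) \<partial>\<nu> \<partial>lborel)"
      unfolding G_def fst_conv snd_conv by (rule NuL.Fubini'[symmetric]) simp
    also have "\<dots> = (\<integral>\<^sup>+z. ennreal (K (z - x)) * (ennreal (q z) * w z) \<partial>lborel)"
      by (simp add: nn_integral_cmult nn_integral_multc q)
    also have "\<dots> \<le> (\<integral>\<^sup>+z. ennreal (K (z - x)) * 1 \<partial>lborel)"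
      by (intro nn_integral_mono mult_left_mono qw) simp
    also have "\<dots> = 1" by (simp add: nn_integral_lborel_diff[of "\<lambda>x. ennreal (K x)"] K1)
    finally show ?thesis .
  qed
  have v: "(\<integral>\<^sup>+x. G (x, y) \<partial>\<mu>) \<le> 1" for y
  proof -
    have "(\<integral>\<^sup>+x. G (x, y) \<partial>\<mu>) = (\<integral>\<^sup>+z. \<integral>\<^sup>+x. ennreal (K (z - x)) * (ennreal (K (z - y)) * w z) \<partial>\<mu> \<partial>lborel)"
      unfolding G_def fst_conv snd_conv by (rule MuL.Fubini'[symmetric]) simp
    also have "\<dots> = (\<integral>\<^sup>+z. ennreal (K (z - y)) * (ennreal (p z) * w z) \<partial>lborel)"
      by (simp add: nn_integral_multc p mult.left_commute)
    also have "\<dots> \<le> (\<integral>\<^sup>+z. ennreal (K (z - y)) * 1 \<partial>lborel)"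
      by (intro nn_integral_mono mult_left_mono pw) simp
    also have "\<dots> = 1" by (simp add: nn_integral_lborel_diff[of "\<lambda>x. ennreal (K x)"] K1)
    finally show ?thesis .
  qed
  define c where "c z = ennreal (norm (fst z - snd z) powr k)" for z :: "'a \<times> 'a"
  have [measurable]: "c \<in> borel_measurable borel"
    unfolding c_def borel_prod[symmetric] by measurable
  have cD: "AE x in \<mu>. AE y in \<nu>. c (x, y) \<le> ennreal ((2 * R) powr k)"
    using supp\<mu>
  proof eventually_elim
    case (elim x)
    show ?case using supp\<nu>
    proof eventually_elim
      case (elim y)
      have "norm (x - y) \<le> 2 * R"
        using norm_triangle_ineq4[of x y] elim \<open>norm x \<le> R\<close> by linarith
      then show ?case using k by (auto simp: c_def intro!: ennreal_leI powr_mono2)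
    qed
  qed
  \<comment> \<open>\<open>L\<close> is the kernel weighted by the k-th power of the displacement;
    the factor \<open>2 powr k\<close> comes from splitting the distance of the two points at the
    common smoothed point.\<close>
  define L where "L z = ennreal (2 powr k * (norm z powr k * K z))" for z
  have [measurable]: "L \<in> borel_measurable borel" unfolding L_def by measurable
  have L: "(\<integral>\<^sup>+z. L z \<partial>lborel) \<le> ennreal (2 powr k * m)"
    using mult_left_mono[OF Km, of "ennreal (2 powr k)"] m
    by (simp add: L_def ennreal_mult' K0 nn_integral_cmult)
  have cG: "c (x, y) * G (x, y) \<le>
      (\<integral>\<^sup>+z. L (z - x) * (ennreal (K (z - y)) * w z) \<partial>lborel)
    + (\<integral>\<^sup>+z. ennreal (K (z - x)) * (L (z - y) * w z) \<partial>lborel)" for x y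
  proof -
    have "c (x, y) * G (x, y) = (\<integral>\<^sup>+z. c (x, y) * (ennreal (K (z - x)) * (ennreal (K (z - y)) * w z)) \<partial>lborel)"
      unfolding G_def by (simp add: nn_integral_cmult)
    also have "\<dots> \<le> (\<integral>\<^sup>+z. L (z - x) * (ennreal (K (z - y)) * w z) + ennreal (K (z - x)) * (L (z - y) * w z) \<partial>lborel)"
    proof (rule nn_integral_mono)
      fix z
      have "norm (x - y) powr k \<le> (norm (z - x) + norm (z - y)) powr k"
        using norm_triangle_ineq4[of "z - y" "z - x"] k by (intro powr_mono2) auto
      also have "\<dots> \<le> 2 powr k * (norm (z - x) powr k + norm (z - y) powr k)"
        using k by (intro powr_add_le_2powr) auto
      finally have "norm (x - y) powr k * (K (z - x) * K (z - y)) \<le>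
          2 powr k * (norm (z - x) powr k + norm (z - y) powr k) * (K (z - x) * K (z - y))"
        by (rule mult_right_mono) (simp add: K0)
      then have "ennreal (norm (x - y) powr k * (K (z - x) * K (z - y))) * w z \<le>
          ennreal (2 powr k * (norm (z - x) powr k * K (z - x)) * K (z - y)
             + K (z - x) * (2 powr k * (norm (z - y) powr k * K (z - y)))) * w z"
        by (intro mult_right_mono ennreal_leI) (auto simp: algebra_simps)
      then show "c (x, y) * (ennreal (K (z - x)) * (ennreal (K (z - y)) * w z))
          \<le> L (z - x) * (ennreal (K (z - y)) * w z) + ennreal (K (z - x)) * (L (z - y) * w z)"
        by (simp add: c_def L_def ennreal_mult' ennreal_plus K0 algebra_simps)
    qed
    also have "\<dots> = (\<integral>\<^sup>+z. L (z - x) * (ennreal (K (z - y)) * w z) \<partial>lborel)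
      + (\<integral>\<^sup>+z. ennreal (K (z - x)) * (L (z - y) * w z) \<partial>lborel)"
      by (rule nn_integral_add) simp_all
    finally show ?thesis .
  qed
  have cost: "(\<integral>\<^sup>+x. \<integral>\<^sup>+y. c (x, y) * G (x, y) \<partial>\<nu> \<partial>\<mu>) \<le> ennreal (2 * (2 powr k * m))"
  proof -
    have "(\<integral>\<^sup>+x. \<integral>\<^sup>+y. c (x, y) * G (x, y) \<partial>\<nu> \<partial>\<mu>) \<le>
      (\<integral>\<^sup>+x. \<integral>\<^sup>+y. (\<integral>\<^sup>+z. L (z - x) * (ennreal (K (z - y)) * w z) \<partial>lborel)
    + (\<integral>\<^sup>+z. ennreal (K (z - x)) * (L (z - y) * w z) \<partial>lborel) \<partial>\<nu> \<partial>\<mu>)"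
      by (intro nn_integral_mono cG)
    also have "\<dots> = (\<integral>\<^sup>+x. \<integral>\<^sup>+y. (\<integral>\<^sup>+z. L (z - x) * (ennreal (K (z - y)) * w z) \<partial>lborel) \<partial>\<nu> \<partial>\<mu>)
      + (\<integral>\<^sup>+x. \<integral>\<^sup>+y. (\<integral>\<^sup>+z. ennreal (K (z - x)) * (L (z - y) * w z) \<partial>lborel) \<partial>\<nu> \<partial>\<mu>)"
      by (simp add: nn_integral_add)
    finally have 1: "(\<integral>\<^sup>+x. \<integral>\<^sup>+y. c (x, y) * G (x, y) \<partial>\<nu> \<partial>\<mu>) \<le>
      (\<integral>\<^sup>+x. \<integral>\<^sup>+y. (\<integral>\<^sup>+z. L (z - x) * (ennreal (K (z - y)) * w z) \<partial>lborel) \<partial>\<nu> \<partial>\<mu>)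
      + (\<integral>\<^sup>+x. \<integral>\<^sup>+y. (\<integral>\<^sup>+z. ennreal (K (z - x)) * (L (z - y) * w z) \<partial>lborel) \<partial>\<nu> \<partial>\<mu>)" .
    have "(\<integral>\<^sup>+x. \<integral>\<^sup>+y. (\<integral>\<^sup>+z. L (z - x) * (ennreal (K (z - y)) * w z) \<partial>lborel) \<partial>\<nu> \<partial>\<mu>)
      = (\<integral>\<^sup>+z. (\<integral>\<^sup>+x. L (z - x) \<partial>\<mu>) * (ennreal (q z) * w z) \<partial>lborel)"
      by (subst triple[of L "\<lambda>x. ennreal (K x)"]) (simp_all add: q)
    also have "\<dots> \<le> (\<integral>\<^sup>+z. (\<integral>\<^sup>+x. L (z - x) \<partial>\<mu>) * 1 \<partial>lborel)"
      by (intro nn_integral_mono mult_left_mono qw) simp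
    also have "\<dots> \<le> ennreal (2 powr k * m)" using L by (simp add: conv\<mu>)
    finally have 2: "(\<integral>\<^sup>+x. \<integral>\<^sup>+y. (\<integral>\<^sup>+z. L (z - x) * (ennreal (K (z - y)) * w z) \<partial>lborel) \<partial>\<nu> \<partial>\<mu>)
      \<le> ennreal (2 powr k * m)" .
    have "(\<integral>\<^sup>+x. \<integral>\<^sup>+y. (\<integral>\<^sup>+z. ennreal (K (z - x)) * (L (z - y) * w z) \<partial>lborel) \<partial>\<nu> \<partial>\<mu>)
      = (\<integral>\<^sup>+z. (\<integral>\<^sup>+x. L (z - x) \<partial>\<nu>) * (ennreal (p z) * w z) \<partial>lborel)"
      by (subst triple[of "\<lambda>x. ennreal (K x)" L]) (simp_all add: p mult.left_commute)
    also have "\<dots> \<le> (\<integral>\<^sup>+z. (\<integral>\<^sup>+x. L (z - x) \<partial>\<nu>) * 1 \<partial>lborel)"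
      by (intro nn_integral_mono mult_left_mono pw) simp
    also have "\<dots> \<le> ennreal (2 powr k * m)" using L by (simp add: conv\<nu>)
    finally have 3: "(\<integral>\<^sup>+x. \<integral>\<^sup>+y. (\<integral>\<^sup>+z. ennreal (K (z - x)) * (L (z - y) * w z) \<partial>lborel) \<partial>\<nu> \<partial>\<mu>)
      \<le> ennreal (2 powr k * m)" .
    have "ennreal (2 * (2 powr k * m)) = ennreal (2 powr k * m) + ennreal (2 powr k * m)"
      using m by (subst ennreal_plus[symmetric]) auto
    then show ?thesis using order_trans[OF 1 add_mono[OF 2 3]] by simp
  qed
  \<comment> \<open>A smoothed point outside radius 2R has moved by at least R from its source
    inside radius R, so Markov's inequality for the k-th moment applies.\<close>
  have tail: "(\<integral>\<^sup>+x. ennreal (p x) * indicator {x. norm x > 2 * R} x \<partial>lborel) \<le> ennreal (m / R powr k)"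
  proof -
    have "(\<integral>\<^sup>+x. ennreal (p x) * indicator {x. norm x > 2 * R} x \<partial>lborel) =
      (\<integral>\<^sup>+x. \<integral>\<^sup>+\<theta>. ennreal (K (x - \<theta>)) * indicator {x. norm x > 2 * R} x \<partial>\<mu> \<partial>lborel)"
      by (simp add: nn_integral_multc p)
    also have "\<dots> \<le> (\<integral>\<^sup>+x. \<integral>\<^sup>+\<theta>. ennreal (1 / R powr k) * ennreal (norm (x - \<theta>) powr k * K (x - \<theta>)) \<partial>\<mu> \<partial>lborel)"
    proof (rule nn_integral_mono, rule nn_integral_mono_AE)
      fix x
      show "AE \<theta> in \<mu>. ennreal (K (x - \<theta>)) * indicator {x. norm x > 2 * R} x \<le>
          ennreal (1 / R powr k) * ennreal (norm (x - \<theta>) powr k * K (x - \<theta>))"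
        using supp\<mu>
      proof eventually_elim
        case (elim \<theta>)
        show ?case
        proof (cases "norm x > 2 * R")
          case True
          then have "norm (x - \<theta>) \<ge> R" using elim norm_triangle_ineq2[of x \<theta>] by linarith
          then have "1 \<le> 1 / R powr k * norm (x - \<theta>) powr k"
            using R k by (simp add: powr_mono2)
          from mult_right_mono[OF this K0[of "x - \<theta>"]]
          show ?thesis using True K0[of "x - \<theta>"]
            by (simp add: ennreal_mult'[symmetric] mult.assoc ennreal_leI)
        qed simp
      qed
    qed
    also have "\<dots> = ennreal (1 / R powr k) * (\<integral>\<^sup>+x. ennreal (norm x powr k * K x) \<partial>lborel)"
      by (simp add: nn_integral_cmult conv\<mu>[of "\<lambda>x. ennreal (norm x powr k * K x)"])
    also have "\<dots> \<le> ennreal (1 / R powr k) * ennreal m" by (intro mult_left_mono Km) simp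
    also have "\<dots> = ennreal (m / R powr k)" by (subst ennreal_mult'[symmetric]) simp_all
    finally show ?thesis .
  qed
  \<comment> \<open>Starting from total mass 1 of p, each x is charged either to min(p, q) plus
    \<open>D\<close>, when it lies in the cube of side 4R that contains the ball of radius 2R, or to
    the tail of p.\<close>
  have def: "1 - (\<integral>\<^sup>+x. \<integral>\<^sup>+y. G (x, y) \<partial>\<nu> \<partial>\<mu>) \<le> ennreal ((4 * R) ^ DIM('a) * D + m / R powr k)"
  proof -
    let ?Q = "cbox (- (2 * R) *\<^sub>R One) ((2 * R) *\<^sub>R One) :: 'a set"
    have Q: "x \<in> ?Q" if "norm x \<le> 2 * R" for x
    proof -
      have "\<bar>x \<bullet> b\<bar> \<le> 2 * R" if "b \<in> Basis" for b
        using Basis_le_norm[OF that, of x] \<open>norm x \<le> 2 * R\<close> by linarith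
      then show ?thesis by (auto simp: mem_box abs_le_iff) (smt (verit, best))
    qed
    have GG: "(\<integral>\<^sup>+x. \<integral>\<^sup>+y. G (x, y) \<partial>\<nu> \<partial>\<mu>) = (\<integral>\<^sup>+x. min (ennreal (p x)) (ennreal (q x)) \<partial>lborel)"
      unfolding G_def fst_conv snd_conv
      by (subst triple[of "\<lambda>x. ennreal (K x)" "\<lambda>x. ennreal (K x)"]) (simp_all add: p q pqw)
    have "1 = (\<integral>\<^sup>+x. ennreal (p x) \<partial>lborel)"
      using conv\<mu>[of "\<lambda>x. ennreal (K x)"] by (simp add: p K1)
    also have "\<dots> \<le> (\<integral>\<^sup>+x. min (ennreal (p x)) (ennreal (q x)) + (ennreal D * indicator ?Q x
        + ennreal (p x) * indicator {x. norm x > 2 * R} x) \<partial>lborel)"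
    proof (rule nn_integral_mono)
      fix x
      show "ennreal (p x) \<le> min (ennreal (p x)) (ennreal (q x)) + (ennreal D * indicator ?Q x
        + ennreal (p x) * indicator {x. norm x > 2 * R} x)"
      proof (cases "norm x > 2 * R")
        case False
        then have "x \<in> ?Q" by (intro Q) simp
        moreover have "p x \<le> min (p x) (q x) + D"
          using D[of x] D0 unfolding p_def q_def by linarith
        then have "ennreal (p x) \<le> ennreal (min (p x) (q x)) + ennreal D"
          using p0[of x] q0[of x] D0 by (simp add: ennreal_plus[symmetric] ennreal_leI del: ennreal_plus)
        moreover have "ennreal (min (p x) (q x)) = min (ennreal (p x)) (ennreal (q x))"
          using p0[of x] q0[of x] by (simp add: min_def)
        ultimately show ?thesis using False by simp
      qed (simp add: add_increasing)
    qed
    also have "\<dots> = (\<integral>\<^sup>+x. \<integral>\<^sup>+y. G (x, y) \<partial>\<nu> \<partial>\<mu>) + (ennreal D * emeasure lborel ?Q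
       + (\<integral>\<^sup>+x. ennreal (p x) * indicator {x. norm x > 2 * R} x \<partial>lborel))"
      by (simp add: nn_integral_add nn_integral_cmult GG)
    finally have 1: "1 \<le> (\<integral>\<^sup>+x. \<integral>\<^sup>+y. G (x, y) \<partial>\<nu> \<partial>\<mu>) + (ennreal D * emeasure lborel ?Q
       + (\<integral>\<^sup>+x. ennreal (p x) * indicator {x. norm x > 2 * R} x \<partial>lborel))" .
    have Q4: "emeasure lborel ?Q = ennreal ((4 * R) ^ DIM('a))"
    proof -
      have "emeasure lborel ?Q = ennreal (\<Prod>b\<in>(Basis::'a set). ((2 * R) *\<^sub>R One - (- (2 * R) *\<^sub>R One)) \<bullet> b)"
        by (rule emeasure_lborel_cbox) (use R in simp)
      also have "(\<Prod>b\<in>(Basis::'a set). ((2 * R) *\<^sub>R One - (- (2 * R) *\<^sub>R One)) \<bullet> b) = (\<Prod>b\<in>(Basis::'a set). 4 * R)"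
        by (rule prod.cong) (simp_all add: inner_diff_left inner_add_left)
      finally show ?thesis by (simp only: prod_constant)
    qed
    have 2: "ennreal D * emeasure lborel ?Q + (\<integral>\<^sup>+x. ennreal (p x) * indicator {x. norm x > 2 * R} x \<partial>lborel)
       \<le> ennreal ((4 * R) ^ DIM('a) * D + m / R powr k)"
      unfolding Q4 using tail R D0 m by (simp add: ennreal_plus ennreal_mult' mult.commute)
    show ?thesis
      using order_trans[OF 1 add_left_mono[OF 2]] by (simp add: ennreal_minus_le_iff)
  qed
  from subcoupling_extends[OF \<mu> \<nu> _ _ u v cD] obtain \<gamma> where \<gamma>: "\<gamma> \<in> couplings \<mu> \<nu>"
    and le: "(\<integral>\<^sup>+z. c z \<partial>\<gamma>) \<le> (\<integral>\<^sup>+x. \<integral>\<^sup>+y. c (x, y) * G (x, y) \<partial>\<nu> \<partial>\<mu>)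
      + ennreal ((2 * R) powr k) * (1 - (\<integral>\<^sup>+x. \<integral>\<^sup>+y. G (x, y) \<partial>\<nu> \<partial>\<mu>))"
    by (metis (no_types, lifting) \<open>G \<in> borel_measurable borel\<close> \<open>c \<in> borel_measurable borel\<close>)
  have "wasserstein_pow k \<mu> \<nu> \<le> (\<integral>\<^sup>+z. c z \<partial>\<gamma>)"
    unfolding wasserstein_pow_def c_def using \<gamma> by (rule INF_lower)
  also note le
  also have "(\<integral>\<^sup>+x. \<integral>\<^sup>+y. c (x, y) * G (x, y) \<partial>\<nu> \<partial>\<mu>)
      + ennreal ((2 * R) powr k) * (1 - (\<integral>\<^sup>+x. \<integral>\<^sup>+y. G (x, y) \<partial>\<nu> \<partial>\<mu>)) \<le>
      ennreal (2 * (2 powr k * m)) + ennreal ((2 * R) powr k) * ennreal ((4 * R) ^ DIM('a) * D + m / R powr k)"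
    by (intro add_mono cost mult_left_mono def) simp
  also have "\<dots> = ennreal (2 * (2 powr k * m) + (2 * R) powr k * ((4 * R) ^ DIM('a) * D + m / R powr k))"
    using m R D0 by (simp add: ennreal_plus ennreal_mult')
  finally show ?thesis .
qed

section \<open>Deconvolution of sinc powers\<close>

text \<open>Its cosine transform is sinc, so its convolution powers transform to the powers of sinc
  and stay compactly supported.\<close>

definition unif11 :: "real measure" where
  "unif11 = density lborel (\<lambda>u. ennreal (indicator {-1..1} u / 2))"

lemma integral_unif11:
  fixes f F :: "real \<Rightarrow> real"
  assumes F: "\<And>u. (F has_real_derivative f u) (at u)" and f: "continuous_on UNIV f"
  shows "(\<integral>u. f u \<partial>unif11) = (F 1 - F (-1)) / 2"
proof -
  have [measurable]: "f \<in> borel_measurable borel" using f by (rule borel_measurable_continuous_onI)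
  have "(\<integral>u. f u \<partial>unif11) = (\<integral>u. (indicator {-1..1} u / 2) *\<^sub>R f u \<partial>lborel)"
    unfolding unif11_def by (subst integral_density) auto
  also have "\<dots> = (\<integral>u. f u * indicator {-1..1} u / 2 \<partial>lborel)"
    by (rule Bochner_Integration.integral_cong) auto
  also have "\<dots> = (\<integral>u. f u * indicator {-1..1} u \<partial>lborel) / 2"
    by simp
  also have "(\<integral>u. f u * indicator {-1..1} u \<partial>lborel) = F 1 - F (-1)"
    using F f by (intro integral_FTC_Icc_real) (auto simp: continuous_on_eq_continuous_at)
  finally show ?thesis .
qed

lemma real_distribution_unif11: "real_distribution unif11"
proof -
  have "emeasure unif11 (space unif11) = (\<integral>\<^sup>+u. ennreal (1 / 2) * indicator {-1..1::real} u \<partial>lborel)"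
    unfolding unif11_def
    by (auto simp: emeasure_density indicator_def intro!: nn_integral_cong)
  also have "\<dots> = ennreal (1 / 2) * 2" by (subst nn_integral_cmult_indicator) auto
  also have "\<dots> = 1"
    by (metis ennreal_1 ennreal_mult' ennreal_numeral mult.commute nonzero_mult_div_cancel_left times_divide_eq_right zero_le_numeral zero_neq_numeral)
  finally show ?thesis
    by (intro real_distribution.intro prob_spaceI real_distribution_axioms.intro) (auto simp: unif11_def)
qed

lemma AE_unif11: "AE u in unif11. \<bar>u\<bar> \<le> 1"
  unfolding unif11_def by (subst AE_density) (auto simp: indicator_def)

lemma integral_cos_sin_unif11:
  "(\<integral>u. cos (x * u) \<partial>unif11) = sinc x" "(\<integral>u. sin (x * u) \<partial>unif11) = 0"
proof -
  have "(\<integral>u. cos (x * u) \<partial>unif11) = (sin x / x - sin (- x) / x) / 2" if "x \<noteq> 0"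
    by (subst integral_unif11[where F="\<lambda>u. sin (x * u) / x"])
      (auto intro!: derivative_eq_intros continuous_intros simp: that)
  moreover have "(\<integral>u. cos (x * u) \<partial>unif11) = (1 - (-1)) / 2" if "x = 0"
    by (subst integral_unif11[where F="\<lambda>u. u"])
      (auto intro!: derivative_eq_intros continuous_intros simp: that)
  ultimately show "(\<integral>u. cos (x * u) \<partial>unif11) = sinc x" by auto
  have "(\<integral>u. sin (x * u) \<partial>unif11) = (- cos x / x - - cos (- x) / x) / 2" if "x \<noteq> 0"
    by (subst integral_unif11[where F="\<lambda>u. - cos (x * u) / x"])
      (auto intro!: derivative_eq_intros continuous_intros simp: that)
  then show "(\<integral>u. sin (x * u) \<partial>unif11) = 0" by (cases "x = 0") auto
qed

text \<open>The witness is the j-fold convolution of \<open>unif11\<close>, starting from the point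
  mass at 0. The vanishing sine transform is carried along because the addition formula for cosine
  mixes both transforms in the induction step.\<close>

lemma sinc_power_cosine_transform:
  "\<exists>M. real_distribution M \<and> (AE s in M. \<bar>s\<bar> \<le> real j) \<and>
     (\<forall>x. (\<integral>s. cos (x * s) \<partial>M) = sinc x ^ j \<and> (\<integral>s. sin (x * s) \<partial>M) = 0)"
proof (induction j)
  case 0
  interpret prob_space "return borel (0::real)" by (rule prob_space_return) simp
  have "real_distribution (return borel (0::real))" by unfold_locales simp
  moreover have "(\<integral>s. cos (x * s) \<partial>return borel 0) = 1" "(\<integral>s. sin (x * s) \<partial>return borel 0) = 0" for x :: real
    by (subst integral_return; simp)+
  moreover have "AE s in return borel (0::real). \<bar>s\<bar> \<le> real 0" by (subst AE_return) auto
  ultimately show ?case by (intro exI[of _ "return borel 0"]) (auto simp del: of_nat_0)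
next
  case (Suc j)
  then obtain M where M: "real_distribution M" "AE s in M. \<bar>s\<bar> \<le> real j"
    "\<And>x. (\<integral>s. cos (x * s) \<partial>M) = sinc x ^ j" "\<And>x. (\<integral>s. sin (x * s) \<partial>M) = 0" by metis
  interpret M: real_distribution M by fact
  interpret U: real_distribution unif11 by (rule real_distribution_unif11)
  interpret MU: pair_prob_space M unif11 ..
  define N where "N = distr (M \<Otimes>\<^sub>M unif11) borel (\<lambda>z. fst z + snd z)"
  have N: "real_distribution N" unfolding N_def by (rule MU.real_distribution_distr) measurable
  have int: "(\<integral>s. f s \<partial>N) = (\<integral>s. \<integral>u. f (s + u) \<partial>unif11 \<partial>M)"
    if [measurable]: "f \<in> borel_measurable borel" and b: "\<And>s. \<bar>f s\<bar> \<le> 1" for f :: "real \<Rightarrow> real"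
  proof -
    have "integrable (M \<Otimes>\<^sub>M unif11) (\<lambda>z. f (fst z + snd z))"
      by (rule MU.P.integrable_const_bound[where B=1]) (auto simp: b)
    from MU.integral_fst'[OF this] show ?thesis unfolding N_def
      by (subst integral_distr) auto
  qed
  have i: "integrable unif11 (\<lambda>u. cos (x * u))" "integrable unif11 (\<lambda>u. sin (x * u))"
     "integrable M (\<lambda>u. cos (x * u))" "integrable M (\<lambda>u. sin (x * u))" for x
    by (intro U.integrable_const_bound[where B=1] M.integrable_const_bound[where B=1]; simp)+
  have "(\<integral>s. cos (x * s) \<partial>N) = sinc x ^ Suc j" for x
  proof -
    have "(\<integral>s. cos (x * s) \<partial>N) = (\<integral>s. \<integral>u. cos (x * s) * cos (x * u) - sin (x * s) * sin (x * u) \<partial>unif11 \<partial>M)"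
      by (subst int) (simp_all add: distrib_left cos_add)
    also have "\<dots> = (\<integral>s. cos (x * s) * sinc x \<partial>M)"
      using i[of x] by (simp add: integral_cos_sin_unif11 del: mult_cancel_left mult_cancel_right)
    also have "\<dots> = sinc x ^ Suc j"
      by (simp only: Bochner_Integration.integral_mult_left_zero M(3) power_Suc2)
    finally show ?thesis .
  qed
  moreover have "(\<integral>s. sin (x * s) \<partial>N) = 0" for x
  proof -
    have "(\<integral>s. sin (x * s) \<partial>N) = (\<integral>s. \<integral>u. sin (x * s) * cos (x * u) + cos (x * s) * sin (x * u) \<partial>unif11 \<partial>M)"
      by (subst int) (simp_all add: distrib_left sin_add)
    also have "\<dots> = (\<integral>s. sin (x * s) * sinc x \<partial>M)"
      using i[of x] by (simp add: integral_cos_sin_unif11 del: mult_cancel_left mult_cancel_right)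
    also have "\<dots> = 0"
      by (simp only: Bochner_Integration.integral_mult_left_zero M(4) mult_zero_left)
    finally show ?thesis .
  qed
  moreover have "AE s in N. \<bar>s\<bar> \<le> real (Suc j)"
  proof -
    have AE: "AE s in M. AE u in unif11. \<bar>s + u\<bar> \<le> real (Suc j)"
      using M(2)
    proof eventually_elim
      case (elim s)
      show ?case using AE_unif11 by eventually_elim (use elim in auto)
    qed
    have "AE z in M \<Otimes>\<^sub>M unif11. \<bar>fst z + snd z\<bar> \<le> real (Suc j)"
    proof (rule MU.AE_pair_measure)
      show "{z \<in> space (M \<Otimes>\<^sub>M unif11). \<bar>fst z + snd z\<bar> \<le> real (Suc j)} \<in> sets (M \<Otimes>\<^sub>M unif11)"
        by measurable
    qed (use AE in simp)
    then show ?thesis unfolding N_def by (subst AE_distr_iff) auto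
  qed
  ultimately show ?case using N by blast
qed

text \<open>The real form of the Gaussian characteristic function after the substitution y =
  \<theta> + \<sigma> z. Convolution with the Gaussian damps the frequency a by a scalar, which is
  what the deconvolution inverts.\<close>

lemma integral_normal_density_cos:
  assumes \<sigma>: "\<sigma> > 0"
  shows "(\<integral>y. normal_density \<theta> \<sigma> y * cos (a * (x - y)) \<partial>lborel)
    = exp (- (\<sigma> * a)\<^sup>2 / 2) * cos (a * (x - \<theta>))"
proof -
  interpret real_distribution std_normal_distribution by (rule real_dist_normal_dist)
  have i: "integrable std_normal_distribution (\<lambda>z. iexp (t * z))" for t
    by (rule integrable_iexp) auto
  have c: "(\<integral>z. cos (t * z) \<partial>std_normal_distribution) = exp (- t\<^sup>2 / 2)" for t
    using integral_Re[OF i[of t]] char_std_normal_distribution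
    by (simp add: char_def fun_eq_iff Re_exp)
  have s: "(\<integral>z. sin (t * z) \<partial>std_normal_distribution) = 0" for t
    using integral_Im[OF i[of t]] char_std_normal_distribution
    by (simp add: char_def fun_eq_iff Im_exp)
  have ic: "integrable std_normal_distribution (\<lambda>z. cos (t * z))" "integrable std_normal_distribution (\<lambda>z. sin (t * z))" for t
    by (rule integrable_const_bound[where B=1]; simp)+
  have nd: "normal_density \<theta> \<sigma> (\<theta> + \<sigma> * z) = std_normal_density z / \<sigma>" for z
    using \<sigma> unfolding normal_density_def by (simp add: real_sqrt_mult power_mult_distrib field_simps)
  have "(\<integral>y. normal_density \<theta> \<sigma> y * cos (a * (x - y)) \<partial>lborel)
     = \<sigma> * (\<integral>z. normal_density \<theta> \<sigma> (\<theta> + \<sigma> * z) * cos (a * (x - (\<theta> + \<sigma> * z))) \<partial>lborel)"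
    using \<sigma> by (subst lborel_integral_real_affine[where c=\<sigma> and t=\<theta>]) auto
  also have "\<dots> = (\<integral>z. std_normal_density z *\<^sub>R cos (a * (x - \<theta>) - (\<sigma> * a) * z) \<partial>lborel)"
    unfolding nd using \<sigma> by (subst Bochner_Integration.integral_mult_right_zero[symmetric]) (simp add: algebra_simps)
  also have "\<dots> = (\<integral>z. cos (a * (x - \<theta>) - (\<sigma> * a) * z) \<partial>std_normal_distribution)"
    by (subst integral_density) auto
  also have "\<dots> = (\<integral>z. cos (a * (x - \<theta>)) * cos ((\<sigma> * a) * z) + sin (a * (x - \<theta>)) * sin ((\<sigma> * a) * z) \<partial>std_normal_distribution)"
    by (simp add: cos_diff)
  also have "\<dots> = cos (a * (x - \<theta>)) * exp (- (\<sigma> * a)\<^sup>2 / 2)"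
    by (subst Bochner_Integration.integral_add) (use ic in \<open>simp_all add: c s\<close>)
  finally show ?thesis by simp
qed

text \<open>Write the sinc power as an average of cosines of frequency s / h with s drawn from a law
  on [-j, j], and multiply each cosine by the reciprocal of its Gaussian damping. Frequencies are at
  most j / h, hence the weights are at most the stated exponential, and convolving with the Gaussian
  removes them again.\<close>

lemma sinc_power_gaussian_deconvolution:
  assumes \<sigma>: "\<sigma> > 0" and h: "h > 0"
  shows "\<exists>\<psi>::real \<Rightarrow> real. \<psi> \<in> borel_measurable borel \<and> (\<forall>t. \<bar>\<psi> t\<bar> \<le> exp ((\<sigma> * real j / h)\<^sup>2 / 2)) \<and>
    (\<forall>x \<theta>. (\<integral>y. normal_density \<theta> \<sigma> y * \<psi> (x - y) \<partial>lborel) = sinc ((x - \<theta>) / h) ^ j)"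
proof -
  obtain M where M: "real_distribution M" "AE s in M. \<bar>s\<bar> \<le> real j"
    "\<And>x. (\<integral>s. cos (x * s) \<partial>M) = sinc x ^ j"
    using sinc_power_cosine_transform by metis
  interpret M: real_distribution M by fact
  \<comment> \<open>The truncation changes nothing on the support of \<open>M\<close> but makes the weight bounded.\<close>
  define e where "e s = exp ((\<sigma> * min \<bar>s\<bar> (real j) / h)\<^sup>2 / 2)" for s :: real
  define E where "E = exp ((\<sigma> * real j / h)\<^sup>2 / 2)"
  have [measurable]: "e \<in> borel_measurable borel" unfolding e_def
    by (intro borel_measurable_continuous_onI continuous_intros) (use h in auto)
  have e0: "0 < e s" "e s \<le> E" for s
  proof -
    show "0 < e s" by (simp add: e_def)
    show "e s \<le> E" unfolding e_def E_def using \<sigma> h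
      by (auto intro!: power_mono divide_right_mono mult_left_mono)
  qed
  define \<psi> where "\<psi> t = (\<integral>s. e s * cos (s * (t / h)) \<partial>M)" for t
  have bnd: "\<bar>e s * cos a\<bar> \<le> E" for s a
    using mult_mono[of "e s" E "\<bar>cos a\<bar>" 1] e0[of s] by (simp add: abs_mult)
  have i: "integrable M (\<lambda>s. e s * cos (s * (t / h)))" for t
    by (rule M.integrable_const_bound[where B=E]) (use bnd in auto)
  have "\<bar>\<psi> t\<bar> \<le> E" for t
  proof -
    have "\<bar>\<psi> t\<bar> \<le> (\<integral>s. \<bar>e s * cos (s * (t / h))\<bar> \<partial>M)"
      unfolding \<psi>_def by (rule integral_abs_bound)
    also have "\<dots> \<le> (\<integral>s. E \<partial>M)"
      by (rule integral_mono) (use i bnd in auto)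
    finally show ?thesis by (simp add: M.prob_space[simplified])
  qed
  moreover have [measurable]: "\<psi> \<in> borel_measurable borel" unfolding \<psi>_def by measurable
  moreover have "(\<integral>y. normal_density \<theta> \<sigma> y * \<psi> (x - y) \<partial>lborel) = sinc ((x - \<theta>) / h) ^ j" for x \<theta>
  proof -
    define N where "N = density lborel (normal_density \<theta> \<sigma>)"
    interpret N: prob_space N unfolding N_def using \<sigma> by (rule prob_space_normal_density)
    have [measurable_cong, simp]: "sets N = sets borel" by (simp add: N_def)
    interpret MN: pair_prob_space M N ..
    have "(\<integral>y. normal_density \<theta> \<sigma> y * \<psi> (x - y) \<partial>lborel) = (\<integral>y. \<psi> (x - y) \<partial>N)"
      unfolding N_def by (subst integral_density) auto
    also have "\<dots> = (\<integral>s. \<integral>y. e s * cos (s * ((x - y) / h)) \<partial>N \<partial>M)"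
      unfolding \<psi>_def
    proof (rule MN.Fubini_integral)
      show "integrable (M \<Otimes>\<^sub>M N) (case_prod (\<lambda>s y. e s * cos (s * ((x - y) / h))))"
        by (rule MN.P.integrable_const_bound[where B=E]) (use bnd in auto)
    qed
    also have "\<dots> = (\<integral>s. cos ((x - \<theta>) / h * s) \<partial>M)"
    proof (rule integral_cong_AE)
      show "AE s in M. (\<integral>y. e s * cos (s * ((x - y) / h)) \<partial>N) = cos ((x - \<theta>) / h * s)"
        using M(2)
      proof eventually_elim
        case (elim s)
        have "(\<integral>y. e s * cos (s * ((x - y) / h)) \<partial>N) = e s * (\<integral>y. cos (s * ((x - y) / h)) \<partial>N)" by simp
        also have "(\<integral>y. cos (s * ((x - y) / h)) \<partial>N) = (\<integral>y. normal_density \<theta> \<sigma> y * cos (s / h * (x - y)) \<partial>lborel)"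
          unfolding N_def by (subst integral_density) auto
        also have "\<dots> = exp (- (\<sigma> * (s / h))\<^sup>2 / 2) * cos (s / h * (x - \<theta>))"
          using \<sigma> by (rule integral_normal_density_cos)
        also have "e s * (exp (- (\<sigma> * (s / h))\<^sup>2 / 2) * cos (s / h * (x - \<theta>))) = cos ((x - \<theta>) / h * s)"
        proof -
          have "e s = exp ((\<sigma> * (s / h))\<^sup>2 / 2)"
            using elim by (simp add: e_def power_divide power_mult_distrib)
          then have "e s * exp (- (\<sigma> * (s / h))\<^sup>2 / 2) = 1"
            by (simp add: exp_minus)
          then show ?thesis by (simp only: mult.assoc[symmetric]) (simp add: mult.commute)
        qed
        finally show ?case .
      qed
    qed measurable
    finally show ?thesis unfolding M(3) .
  qed
  ultimately show ?thesis unfolding E_def by blast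
qed

section \<open>Product kernels in several dimensions, their moments and their deconvolution\<close>

lemma integral_lborel_prod:
  fixes f :: "'a::euclidean_space \<Rightarrow> real \<Rightarrow> real"
  assumes f: "\<And>b. b \<in> Basis \<Longrightarrow> integrable lborel (f b)"
  shows "(\<integral>x. (\<Prod>b\<in>Basis. f b (x \<bullet> b)) \<partial>lborel) = (\<Prod>b\<in>Basis. \<integral>t. f b t \<partial>lborel)"
proof -
  interpret product_sigma_finite "\<lambda>_::'a. lborel :: real measure" ..
  have [measurable]: "f b \<in> borel_measurable borel" if "b \<in> Basis" for b
    using borel_measurable_integrable[OF f[OF that]] by simp
  have "(\<integral>x. (\<Prod>b\<in>Basis. f b (x \<bullet> b)) \<partial>lborel) =
    (\<integral>\<omega>. (\<Prod>b\<in>Basis. f b ((\<Sum>c\<in>Basis. \<omega> c *\<^sub>R c) \<bullet> b)) \<partial>Pi\<^sub>M Basis (\<lambda>_::'a. lborel :: real measure))"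
    by (subst lborel_eq, subst integral_distr) auto
  also have "\<dots> = (\<integral>\<omega>. (\<Prod>b\<in>Basis. f b (\<omega> b)) \<partial>Pi\<^sub>M Basis (\<lambda>_::'a. lborel :: real measure))"
    by (intro Bochner_Integration.integral_cong prod.cong) (auto simp: inner_sum_left inner_Basis if_distrib cong: if_cong)
  also have "\<dots> = (\<Prod>b\<in>Basis. \<integral>t. f b t \<partial>lborel)"
    by (rule product_integral_prod) (auto intro: f)
  finally show ?thesis .
qed

lemma gauss_dens_eq_prod:
  fixes y \<theta> :: "'a::euclidean_space"
  shows "gauss_dens \<sigma> (y - \<theta>) = (\<Prod>b\<in>Basis. normal_density (\<theta> \<bullet> b) \<sigma> (y \<bullet> b))"
proof -
  have "(norm (y - \<theta>))\<^sup>2 = (\<Sum>b\<in>Basis. (y \<bullet> b - \<theta> \<bullet> b)\<^sup>2)"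
    unfolding power2_norm_eq_inner euclidean_inner[of "y - \<theta>" "y - \<theta>"]
    by (simp add: inner_diff_left power2_eq_square)
  then have "exp (- (norm (y - \<theta>))\<^sup>2 / (2 * \<sigma>\<^sup>2)) = (\<Prod>b\<in>Basis. exp (- (y \<bullet> b - \<theta> \<bullet> b)\<^sup>2 / (2 * \<sigma>\<^sup>2)))"
    by (simp add: exp_sum[symmetric] sum_divide_distrib sum_negf)
  then show ?thesis
    unfolding gauss_dens_def normal_density_def by (simp add: prod_dividef)
qed

text \<open>The integrand is dominated by a multiple of 1 / (1 + t^2): for small t both factors are
  at most 1, and for large t the bound 1 / \<bar>t\<bar> on sinc leaves the exponent k - 2P, which
  the hypothesis makes at most -2.\<close>

lemma nn_integral_sinc_moment:
  fixes k :: real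
  assumes k: "k \<ge> 0" "k + 2 \<le> 2 * real P"
  shows "(\<integral>\<^sup>+t. ennreal (\<bar>t\<bar> powr k * sinc t ^ (2 * P)) \<partial>lborel) < \<infinity>"
proof -
  have "set_integrable lborel UNIV (\<lambda>x. inverse (1 + x\<^sup>2) :: real)"
    using integrable_inverse_1_plus_square by (simp add: einterval_def)
  then have "integrable lborel (\<lambda>t. 2 * inverse (1 + t\<^sup>2) :: real)"
    unfolding set_integrable_def by simp
  then have fin: "(\<integral>\<^sup>+t. ennreal (2 * inverse (1 + t\<^sup>2)) \<partial>lborel) < \<infinity>"
    by (subst (asm) integrable_iff_bounded) (simp add: abs_mult)
  have "\<bar>t\<bar> powr k * sinc t ^ (2 * P) \<le> 2 * inverse (1 + t\<^sup>2)" for t :: real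
  proof (cases "\<bar>t\<bar> \<le> 1")
    case True
    have "\<bar>sinc t\<bar> \<le> 1" using abs_sin_x_le_abs_x[of t] by (auto simp: abs_divide divide_le_eq)
    then have "\<bar>sinc t\<bar> ^ (2 * P) \<le> 1" by (intro power_le_one) auto
    moreover have "\<bar>t\<bar> powr k \<le> 1" using True k powr_mono2[of k "\<bar>t\<bar>" 1] by simp
    ultimately have "\<bar>t\<bar> powr k * \<bar>sinc t\<bar> ^ (2 * P) \<le> 1 * 1"
      by (intro mult_mono) auto
    moreover have "t\<^sup>2 \<le> 1" using True by (simp add: abs_square_le_1)
    then have "1 \<le> 2 * inverse (1 + t\<^sup>2)"
      using add_pos_nonneg[OF zero_less_one zero_le_power2[of t]] by (simp add: inverse_eq_divide pos_le_divide_eq)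
    ultimately show ?thesis by (simp add: power_even_abs)
  next
    case False
    then have t: "\<bar>t\<bar> > 1" by simp
    have "\<bar>sinc t\<bar> \<le> 1 / \<bar>t\<bar>" using t abs_sin_le_one[of t] by (auto simp: abs_divide divide_right_mono)
    then have "\<bar>sinc t\<bar> ^ (2 * P) \<le> (1 / \<bar>t\<bar>) ^ (2 * P)" by (intro power_mono) auto
    also have "\<dots> = \<bar>t\<bar> powr (- (2 * real P))"
      using t by (simp add: powr_minus powr_realpow[symmetric] power_one_over inverse_eq_divide)
    finally have "\<bar>t\<bar> powr k * \<bar>sinc t\<bar> ^ (2 * P) \<le> \<bar>t\<bar> powr k * \<bar>t\<bar> powr (- (2 * real P))"
      by (intro mult_left_mono) auto
    also have "\<dots> = \<bar>t\<bar> powr (k - 2 * real P)" by (simp add: powr_add[symmetric])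
    also have "\<dots> \<le> \<bar>t\<bar> powr (- 2)" using t k by (intro powr_mono) auto
    also have "\<dots> = inverse (t\<^sup>2)" using t by (simp add: powr_minus powr_numeral)
    also have "\<dots> \<le> 2 * inverse (1 + t\<^sup>2)"
    proof -
      have "1 \<le> t\<^sup>2" using t by (metis abs_le_square_iff abs_one less_imp_le one_power2)
      then show ?thesis using add_pos_nonneg[OF zero_less_one zero_le_power2[of t]] t
        by (simp add: inverse_eq_divide divide_le_eq pos_le_divide_eq frac_le_eq field_split_simps)
    qed
    finally show ?thesis by (simp add: power_even_abs)
  qed
  then have "(\<integral>\<^sup>+t. ennreal (\<bar>t\<bar> powr k * sinc t ^ (2 * P)) \<partial>lborel) \<le> (\<integral>\<^sup>+t. ennreal (2 * inverse (1 + t\<^sup>2)) \<partial>lborel)"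
    by (intro nn_integral_mono ennreal_leI)
  then show ?thesis using fin by (rule order.strict_trans1)
qed

text \<open>Needed to normalize the kernel: sinc is strictly positive on (0, 1), a set of positive
  measure.\<close>

lemma nn_integral_sinc_power_pos: "(\<integral>\<^sup>+t. ennreal (sinc t ^ (2 * P)) \<partial>lborel) > 0"
proof (rule ccontr)
  assume "\<not> ?thesis"
  then have "(\<integral>\<^sup>+t. ennreal (sinc t ^ (2 * P)) \<partial>lborel) = 0" by simp
  moreover have [measurable]: "(\<lambda>t. ennreal (sinc t ^ (2 * P))) \<in> borel_measurable borel"
    using borel_measurable_sinc by measurable
  ultimately have "AE t in lborel. ennreal (sinc t ^ (2 * P)) = 0"
    by (subst (asm) nn_integral_0_iff_AE) simp_all
  then have "AE t in lborel. t \<notin> {0<..<1::real}"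
  proof eventually_elim
    case (elim t)
    show ?case
    proof
      assume t: "t \<in> {0<..<1}"
      then have "sin t > 0" using pi_gt3 by (intro sin_gt_zero) auto
      then have "sinc t ^ (2 * P) > 0" using t by simp
      then show False using elim by (simp add: ennreal_eq_0_iff)
    qed
  qed
  then have "emeasure lborel {0<..<1::real} = 0"
    by (subst (asm) AE_iff_measurable[where N="{0<..<1}"]) auto
  then show False by simp
qed

text \<open>The norm is at most the dimension times the largest coordinate. This reduces moments of
  a product kernel to one-dimensional moments, without convexity of the power.\<close>

lemma norm_powr_le_sum:
  fixes x :: "'a::euclidean_space"
  assumes k: "k \<ge> 0"
  shows "norm x powr k \<le> real DIM('a) powr k * (\<Sum>b\<in>Basis. \<bar>x \<bullet> b\<bar> powr k)"
proof -
  obtain c where c: "c \<in> Basis" "\<And>b. b \<in> Basis \<Longrightarrow> \<bar>x \<bullet> b\<bar> \<le> \<bar>x \<bullet> c\<bar>"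
  proof -
    have "Max ((\<lambda>b. \<bar>x \<bullet> b\<bar>) ` Basis) \<in> (\<lambda>b. \<bar>x \<bullet> b\<bar>) ` Basis" by (rule Max_in) auto
    then obtain c where c: "c \<in> Basis" "Max ((\<lambda>b. \<bar>x \<bullet> b\<bar>) ` Basis) = \<bar>x \<bullet> c\<bar>"
      by (elim imageE)
    show thesis
    proof (rule that[OF c(1)])
      fix b :: 'a assume "b \<in> Basis"
      then have "\<bar>x \<bullet> b\<bar> \<le> Max ((\<lambda>b. \<bar>x \<bullet> b\<bar>) ` Basis)" by (intro Max_ge) auto
      then show "\<bar>x \<bullet> b\<bar> \<le> \<bar>x \<bullet> c\<bar>" unfolding c(2) .
    qed
  qed
  have "norm x \<le> (\<Sum>b\<in>Basis. \<bar>x \<bullet> b\<bar>)" by (rule norm_le_l1)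
  also have "\<dots> \<le> real DIM('a) * \<bar>x \<bullet> c\<bar>" by (rule sum_bounded_above[OF c(2)])
  finally have "norm x powr k \<le> (real DIM('a) * \<bar>x \<bullet> c\<bar>) powr k"
    using k by (intro powr_mono2) auto
  also have "\<dots> = real DIM('a) powr k * \<bar>x \<bullet> c\<bar> powr k" by (simp add: powr_mult)
  also have "\<dots> \<le> real DIM('a) powr k * (\<Sum>b\<in>Basis. \<bar>x \<bullet> b\<bar> powr k)"
    using c(1) by (intro mult_left_mono member_le_sum) auto
  finally show ?thesis .
qed

lemma ennreal_mult3:
  "0 \<le> a \<Longrightarrow> 0 \<le> b \<Longrightarrow> ennreal a * (ennreal b * ennreal c) = ennreal (a * (b * c))"
  by (simp add: ennreal_mult')

text \<open>\<open>K\<close> is the product over the coordinates of a normalized \<open>sinc\<close>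
  power at scale h. The even exponent makes it nonnegative, a large exponent gives it k moments, and
  the band limit makes it the Gaussian convolved with a bounded \<psi>. The constants
  \<open>P\<close>, \<open>I\<close> and \<open>J\<close> precede h, so the whole dependence on the
  bandwidth is explicit; the sup bound on \<open>K\<close> later provides integrability.\<close>

lemma deconvolution_kernel:
  fixes k \<sigma> :: real
  assumes k: "k \<ge> 0" and \<sigma>: "\<sigma> > 0"
  shows "\<exists>(P::nat) I J. I > 0 \<and> J \<ge> 0 \<and> (\<forall>h>0. \<exists>(K :: 'a::euclidean_space \<Rightarrow> real) \<psi>.
     K \<in> borel_measurable borel \<and> \<psi> \<in> borel_measurable borel \<and>
     (\<forall>x. 0 \<le> K x \<and> K x \<le> (1 / (h * I)) ^ DIM('a)) \<and>
     (\<integral>\<^sup>+x. ennreal (K x) \<partial>lborel) = 1 \<and>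
     (\<integral>\<^sup>+x. ennreal (norm x powr k * K x) \<partial>lborel) \<le> ennreal (J * h powr k) \<and>
     (\<forall>x. \<bar>\<psi> x\<bar> \<le> (exp ((\<sigma> * real P / h)\<^sup>2 / 2) / (h * I)) ^ DIM('a)) \<and>
     (\<forall>x \<theta>. (\<integral>y. gauss_dens \<sigma> (y - \<theta>) * \<psi> (x - y) \<partial>lborel) = K (x - \<theta>)))"
proof -
  obtain P :: nat where P: "k + 2 \<le> 2 * real P"
    using real_arch_simple[of "k + 2"] by (metis add_increasing2 mult_2 of_nat_0_le_iff order_trans)
  have [measurable]: "sinc \<in> borel_measurable borel" by (rule borel_measurable_sinc)
  define S where "S t = sinc t ^ (2 * P)" for t
  have [measurable]: "S \<in> borel_measurable borel" unfolding S_def by measurable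
  have S0: "0 \<le> S t" and S1: "S t \<le> 1" for t
  proof -
    show "0 \<le> S t" by (simp only: S_def power_mult zero_le_power zero_le_power2)
    have "\<bar>sinc t\<bar> \<le> 1" using abs_sin_x_le_abs_x[of t] by (auto simp: abs_divide divide_le_eq)
    then have "\<bar>sinc t\<bar> ^ (2 * P) \<le> 1" by (intro power_le_one) auto
    then show "S t \<le> 1" by (simp only: S_def power_even_abs[of "2 * P"] even_mult_iff even_numeral simp_thms)
  qed
  define I where "I = enn2real (\<integral>\<^sup>+t. ennreal (S t) \<partial>lborel)"
  define J where "J = enn2real (\<integral>\<^sup>+t. ennreal (\<bar>t\<bar> powr k * S t) \<partial>lborel)"
  have fin0: "(\<integral>\<^sup>+t. ennreal (S t) \<partial>lborel) < \<infinity>"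
  proof -
    have "(\<integral>\<^sup>+t. ennreal (S t) \<partial>lborel) = (\<integral>\<^sup>+t. ennreal (\<bar>t\<bar> powr 0 * S t) \<partial>lborel)"
      \<comment> \<open>\<open>0 powr 0\<close> is 0, so the two integrands agree only off the point
        0.\<close>
      by (rule nn_integral_cong_AE) (use AE_lborel_singleton[of 0] in eventually_elim, simp)
    also have "\<dots> < \<infinity>" unfolding S_def by (rule nn_integral_sinc_moment) (use P k in auto)
    finally show ?thesis .
  qed
  then have I: "(\<integral>\<^sup>+t. ennreal (S t) \<partial>lborel) = ennreal I" unfolding I_def by simp
  have I0: "I > 0"
    using nn_integral_sinc_power_pos[of P] fin0
    unfolding I_def by (simp add: enn2real_positive_iff S_def)
  have J: "(\<integral>\<^sup>+t. ennreal (\<bar>t\<bar> powr k * S t) \<partial>lborel) = ennreal J"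
    using nn_integral_sinc_moment[of k P] P k unfolding J_def S_def by simp
  have J0: "J \<ge> 0" unfolding J_def by simp
  let ?d = "DIM('a)"
  \<comment> \<open>\<open>real ?d powr k\<close> comes from \<open>norm_powr_le_sum\<close>, the
    second factor counts the coordinates, and J / I is the k-th moment of the normalized
    one-dimensional kernel at scale 1.\<close>
  define J' where "J' = real ?d powr k * (real ?d * (J / I))"
  have "\<exists>(K :: 'a \<Rightarrow> real) \<psi>.
     K \<in> borel_measurable borel \<and> \<psi> \<in> borel_measurable borel \<and>
     (\<forall>x. 0 \<le> K x \<and> K x \<le> (1 / (h * I)) ^ DIM('a)) \<and>
     (\<integral>\<^sup>+x. ennreal (K x) \<partial>lborel) = 1 \<and>
     (\<integral>\<^sup>+x. ennreal (norm x powr k * K x) \<partial>lborel) \<le> ennreal (J' * h powr k) \<and>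
     (\<forall>x. \<bar>\<psi> x\<bar> \<le> (exp ((\<sigma> * real (2 * P) / h)\<^sup>2 / 2) / (h * I)) ^ DIM('a)) \<and>
     (\<forall>x \<theta>. (\<integral>y. gauss_dens \<sigma> (y - \<theta>) * \<psi> (x - y) \<partial>lborel) = K (x - \<theta>))"
    if h: "h > 0" for h
  proof -
    obtain \<psi>1 where \<psi>1[measurable]: "\<psi>1 \<in> borel_measurable borel"
      and \<psi>1b: "\<And>t. \<bar>\<psi>1 t\<bar> \<le> exp ((\<sigma> * real (2 * P) / h)\<^sup>2 / 2)"
      and \<psi>1c: "\<And>x \<theta>. (\<integral>y. normal_density \<theta> \<sigma> y * \<psi>1 (x - y) \<partial>lborel) = S ((x - \<theta>) / h)"
      using sinc_power_gaussian_deconvolution[OF \<sigma> h, of "2 * P"] unfolding S_def by metis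
    define \<kappa> where "\<kappa> t = S (t / h) / (h * I)" for t
    define K where "K x = (\<Prod>b\<in>Basis. \<kappa> (x \<bullet> b))" for x :: 'a
    define \<psi> where "\<psi> x = (\<Prod>b\<in>Basis. \<psi>1 (x \<bullet> b) / (h * I))" for x :: 'a
    have [measurable]: "\<kappa> \<in> borel_measurable borel" unfolding \<kappa>_def by measurable
    have [measurable]: "K \<in> borel_measurable borel" "\<psi> \<in> borel_measurable borel"
      unfolding K_def \<psi>_def by measurable
    have \<kappa>0: "0 \<le> \<kappa> t" "\<kappa> t \<le> 1 / (h * I)" for t
      using S0[of "t/h"] S1[of "t/h"] h I0 unfolding \<kappa>_def by (auto intro!: divide_right_mono)
    have aff: "(\<integral>\<^sup>+t. f t \<partial>lborel) = ennreal h * (\<integral>\<^sup>+t. f (h * t) \<partial>lborel)"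
      if "f \<in> borel_measurable borel" for f :: "real \<Rightarrow> ennreal"
      using nn_integral_real_affine[OF that, of h 0] h by simp
    have \<kappa>1: "(\<integral>\<^sup>+t. ennreal (\<kappa> t) \<partial>lborel) = 1"
    proof -
      have "(\<integral>\<^sup>+t. ennreal (\<kappa> t) \<partial>lborel) = ennreal h * (\<integral>\<^sup>+t. ennreal (1 / (h * I)) * ennreal (S t) \<partial>lborel)"
        using h I0 S0 by (subst aff) (simp_all add: \<kappa>_def ennreal_mult'[symmetric])
      also have "\<dots> = ennreal h * (ennreal (1 / (h * I)) * ennreal I)"
        by (simp add: nn_integral_cmult I)
      also have "\<dots> = ennreal (h * (1 / (h * I) * I))"
        using h I0 by (intro ennreal_mult3) simp_all
      also have "\<dots> = 1" using h I0 by simp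
      finally show ?thesis .
    qed
    have \<kappa>k: "(\<integral>\<^sup>+t. ennreal (\<bar>t\<bar> powr k * \<kappa> t) \<partial>lborel) = ennreal (h powr k * (J / I))"
    proof -
      have "(\<integral>\<^sup>+t. ennreal (\<bar>t\<bar> powr k * \<kappa> t) \<partial>lborel)
        = ennreal h * (\<integral>\<^sup>+t. ennreal (h powr k / (h * I)) * ennreal (\<bar>t\<bar> powr k * S t) \<partial>lborel)"
        using h I0 S0 by (subst aff) (simp_all add: \<kappa>_def ennreal_mult'[symmetric] abs_mult powr_mult mult_ac)
      also have "\<dots> = ennreal h * (ennreal (h powr k / (h * I)) * ennreal J)"
        by (simp add: nn_integral_cmult J)
      also have "\<dots> = ennreal (h * (h powr k / (h * I) * J))"
        using h I0 J0 by (intro ennreal_mult3) simp_all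
      also have "h * (h powr k / (h * I) * J) = h powr k * (J / I)" using h I0 by simp
      finally show ?thesis .
    qed
    have K0: "0 \<le> K x" for x unfolding K_def by (intro prod_nonneg) (simp add: \<kappa>0)
    have Kb: "K x \<le> (1 / (h * I)) ^ ?d" for x
      unfolding K_def using prod_mono[of Basis "\<lambda>b. \<kappa> (x \<bullet> b)" "\<lambda>_. 1 / (h * I)"] \<kappa>0 by simp
    have K1: "(\<integral>\<^sup>+x. ennreal (K x) \<partial>lborel) = 1"
      unfolding K_def using nn_integral_lborel_prod[of "\<lambda>(_::'a) t. ennreal (\<kappa> t)"]
      by (simp add: prod_ennreal \<kappa>0 \<kappa>1)
    have Kc: "(\<integral>\<^sup>+x. ennreal (\<bar>x \<bullet> c\<bar> powr k * K x) \<partial>lborel) = ennreal (h powr k * (J / I))"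
      if c: "c \<in> Basis" for c
    proof -
      \<comment> \<open>Placing the weight into the factor of coordinate c keeps the product form;
        all other factors integrate to 1.\<close>
      have "ennreal (\<bar>x \<bullet> c\<bar> powr k * K x) = (\<Prod>b\<in>Basis. ennreal ((if b = c then \<bar>x \<bullet> b\<bar> powr k else 1) * \<kappa> (x \<bullet> b)))" for x
        unfolding K_def using c \<kappa>0
        by (simp add: prod_ennreal prod.distrib prod.delta)
      then have "(\<integral>\<^sup>+x. ennreal (\<bar>x \<bullet> c\<bar> powr k * K x) \<partial>lborel) =
        (\<Prod>b\<in>Basis. \<integral>\<^sup>+t. ennreal ((if b = c then \<bar>t\<bar> powr k else 1) * \<kappa> t) \<partial>lborel)"
        using nn_integral_lborel_prod[of "\<lambda>b t. ennreal ((if b = c then \<bar>t\<bar> powr k else 1) * \<kappa> t)"] by simp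
      also have "\<dots> = (\<Prod>b\<in>Basis. if b = c then ennreal (h powr k * (J / I)) else 1)"
        by (rule prod.cong) (auto simp: \<kappa>1 \<kappa>k)
      also have "\<dots> = ennreal (h powr k * (J / I))" using c by (simp add: prod.delta)
      finally show ?thesis .
    qed
    have Km: "(\<integral>\<^sup>+x. ennreal (norm x powr k * K x) \<partial>lborel) \<le> ennreal (J' * h powr k)"
    proof -
      have "(\<integral>\<^sup>+x. ennreal (norm x powr k * K x) \<partial>lborel)
        \<le> (\<integral>\<^sup>+x. ennreal (real ?d powr k) * (\<Sum>b\<in>Basis. ennreal (\<bar>x \<bullet> b\<bar> powr k * K x)) \<partial>lborel)"
      proof (rule nn_integral_mono)
        fix x :: 'a
        have "norm x powr k * K x \<le> real ?d powr k * (\<Sum>b\<in>Basis. \<bar>x \<bullet> b\<bar> powr k) * K x"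
          by (intro mult_right_mono norm_powr_le_sum k K0)
        also have "\<dots> = real ?d powr k * (\<Sum>b\<in>Basis. \<bar>x \<bullet> b\<bar> powr k * K x)"
          by (simp add: sum_distrib_right mult.assoc)
        finally have "ennreal (norm x powr k * K x) \<le> ennreal (real ?d powr k * (\<Sum>b\<in>Basis. \<bar>x \<bullet> b\<bar> powr k * K x))"
          by (rule ennreal_leI)
        also have "\<dots> = ennreal (real ?d powr k) * (\<Sum>b\<in>Basis. ennreal (\<bar>x \<bullet> b\<bar> powr k * K x))"
          by (subst ennreal_mult') (auto simp: K0 sum_ennreal)
        finally show "ennreal (norm x powr k * K x) \<le> \<dots>" .
      qed
      also have "\<dots> = ennreal (real ?d powr k) * (\<Sum>b\<in>(Basis::'a set). ennreal (h powr k * (J / I)))"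
        by (simp add: nn_integral_cmult nn_integral_sum Kc)
      also have "\<dots> = ennreal (real ?d powr k * (\<Sum>b\<in>(Basis::'a set). h powr k * (J / I)))"
        using I0 J0 by (subst ennreal_mult') (auto simp: sum_ennreal simp del: sum_constant)
      also have "real ?d powr k * (\<Sum>b\<in>(Basis::'a set). h powr k * (J / I)) = J' * h powr k"
        by (simp add: J'_def)
      finally show ?thesis .
    qed
    have \<psi>b: "\<bar>\<psi> x\<bar> \<le> (exp ((\<sigma> * real (2 * P) / h)\<^sup>2 / 2) / (h * I)) ^ ?d" for x
    proof -
      have "\<bar>\<psi> x\<bar> = (\<Prod>b\<in>Basis. \<bar>\<psi>1 (x \<bullet> b) / (h * I)\<bar>)"
        unfolding \<psi>_def by (rule abs_prod)
      also have "\<dots> \<le> (\<Prod>b\<in>(Basis::'a set). exp ((\<sigma> * real (2 * P) / h)\<^sup>2 / 2) / (h * I))"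
        using h I0 \<psi>1b by (intro prod_mono) (auto simp: abs_divide abs_mult intro!: divide_right_mono)
      finally show ?thesis by (simp only: prod_constant)
    qed
    have conv: "(\<integral>y. gauss_dens \<sigma> (y - \<theta>) * \<psi> (x - y) \<partial>lborel) = K (x - \<theta>)" for x \<theta>
    proof -
      have "(\<integral>y. gauss_dens \<sigma> (y - \<theta>) * \<psi> (x - y) \<partial>lborel) =
        (\<integral>y. (\<Prod>b\<in>Basis. normal_density (\<theta> \<bullet> b) \<sigma> (y \<bullet> b) * (\<psi>1 (x \<bullet> b - y \<bullet> b) / (h * I))) \<partial>lborel)"
        unfolding gauss_dens_eq_prod \<psi>_def by (simp add: prod.distrib[symmetric] inner_diff_left)
      also have "\<dots> = (\<Prod>b\<in>Basis. \<integral>t. normal_density (\<theta> \<bullet> b) \<sigma> t * (\<psi>1 (x \<bullet> b - t) / (h * I)) \<partial>lborel)"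
      proof (rule integral_lborel_prod)
        fix b :: 'a
        let ?E = "exp ((\<sigma> * real (2 * P) / h)\<^sup>2 / 2) / (h * I)"
        show "integrable lborel (\<lambda>t. normal_density (\<theta> \<bullet> b) \<sigma> t * (\<psi>1 (x \<bullet> b - t) / (h * I)))"
        proof (rule Bochner_Integration.integrable_bound)
          show "integrable lborel (\<lambda>t. normal_density (\<theta> \<bullet> b) \<sigma> t * ?E)"
            using integrable_normal_density[OF \<sigma>] by simp
          show "AE t in lborel. norm (normal_density (\<theta> \<bullet> b) \<sigma> t * (\<psi>1 (x \<bullet> b - t) / (h * I)))
              \<le> norm (normal_density (\<theta> \<bullet> b) \<sigma> t * ?E)"
            using h I0 \<psi>1b by (intro AE_I2)
             (auto simp: abs_mult abs_divide intro!: mult_left_mono divide_right_mono)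
        qed measurable
      qed
      also have "\<dots> = K (x - \<theta>)"
        unfolding K_def
      proof (rule prod.cong)
        fix b :: 'a
        have "(\<integral>t. normal_density (\<theta> \<bullet> b) \<sigma> t * (\<psi>1 (x \<bullet> b - t) / (h * I)) \<partial>lborel)
          = (\<integral>t. normal_density (\<theta> \<bullet> b) \<sigma> t * \<psi>1 (x \<bullet> b - t) \<partial>lborel) / (h * I)"
          by (subst Bochner_Integration.integral_divide_zero[symmetric]) simp
        then show "(\<integral>t. normal_density (\<theta> \<bullet> b) \<sigma> t * (\<psi>1 (x \<bullet> b - t) / (h * I)) \<partial>lborel) = \<kappa> ((x - \<theta>) \<bullet> b)"
          unfolding \<psi>1c \<kappa>_def by (simp add: inner_diff_left)
      qed simp
      finally show ?thesis .
    qed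
    show ?thesis
      using K0 Kb K1 Km \<psi>b conv by (intro exI[of _ K] exI[of _ \<psi>] conjI allI) simp_all
  qed
  note main = this
  have "J' \<ge> 0" using I0 J0 by (simp add: J'_def)
  then show ?thesis
    by (intro exI[of _ "2 * P"] exI[of _ I] exI[of _ J'] conjI allI impI I0 main)
qed

section \<open>Gaussian mixtures and the support of the NPMLE\<close>

lemma gauss_dens_measurable[measurable]: "gauss_dens \<sigma> \<in> borel_measurable borel"
  unfolding gauss_dens_def by measurable

lemma gauss_dens_pos: "\<sigma> > 0 \<Longrightarrow> gauss_dens \<sigma> x > 0"
  unfolding gauss_dens_def by (intro divide_pos_pos zero_less_power) auto

lemma gauss_dens_antimono:
  fixes x y :: "'a::euclidean_space"
  assumes "\<sigma> > 0" "norm x \<le> norm y"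
  shows "gauss_dens \<sigma> y \<le> gauss_dens \<sigma> x"
  unfolding gauss_dens_def using assms
  by (intro divide_right_mono) (auto intro!: divide_right_mono power_mono)

lemma gauss_dens_strict_antimono:
  fixes x y :: "'a::euclidean_space"
  assumes "\<sigma> > 0" "norm x < norm y"
  shows "gauss_dens \<sigma> y < gauss_dens \<sigma> x"
  unfolding gauss_dens_def using assms
  by (intro divide_strict_right_mono zero_less_power) (auto intro!: divide_strict_right_mono power_strict_mono)

lemma gauss_dens_le_0:
  fixes x :: "'a::euclidean_space"
  shows "\<sigma> > 0 \<Longrightarrow> gauss_dens \<sigma> x \<le> gauss_dens \<sigma> (0::'a)"
  by (rule gauss_dens_antimono) auto

lemma gauss_dens_nonneg[simp]: "0 \<le> gauss_dens \<sigma> x"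
  unfolding gauss_dens_def by simp

lemma nn_integral_gauss_dens:
  fixes \<theta> :: "'a::euclidean_space"
  assumes "\<sigma> > 0"
  shows "(\<integral>\<^sup>+y. ennreal (gauss_dens \<sigma> (y - \<theta>)) \<partial>lborel) = 1"
proof -
  have "(\<integral>\<^sup>+y. ennreal (gauss_dens \<sigma> (y - \<theta>)) \<partial>lborel) =
    (\<integral>\<^sup>+y. (\<Prod>b\<in>Basis. ennreal (normal_density (\<theta> \<bullet> b) \<sigma> (y \<bullet> b))) \<partial>lborel)"
    by (simp add: gauss_dens_eq_prod prod_ennreal)
  also have "\<dots> = (\<Prod>b\<in>Basis. \<integral>\<^sup>+t. ennreal (normal_density (\<theta> \<bullet> b) \<sigma> t) \<partial>lborel)"
    by (rule nn_integral_lborel_prod) auto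
  also have "\<dots> = 1"
    using assms by (intro prod.neutral ballI) (subst nn_integral_eq_integral, auto simp: integrable_normal_density)
  finally show ?thesis .
qed

context
  fixes \<sigma> :: real and \<nu> :: "'a::euclidean_space measure"
  assumes \<sigma>: "\<sigma> > 0" and \<nu>: "borel_prob \<nu>"
begin

interpretation N: prob_space \<nu> using \<nu> by (rule borel_probD)

lemma integrable_gauss_dens_mix: "integrable \<nu> (\<lambda>\<theta>. gauss_dens \<sigma> (y - \<theta>))"
  supply [measurable_cong, simp] = borel_probD(2)[OF \<nu>]
  by (rule N.integrable_const_bound[where B="gauss_dens \<sigma> (0::'a)"])
    (auto intro: gauss_dens_le_0[OF \<sigma>])

lemma mix_dens_measurable: "mix_dens \<sigma> \<nu> \<in> borel_measurable borel"
  supply [measurable_cong, simp] = borel_probD(2)[OF \<nu>]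
  unfolding mix_dens_def[abs_def] by measurable

lemma nn_integral_mix: "(\<integral>\<^sup>+\<theta>. ennreal (gauss_dens \<sigma> (y - \<theta>)) \<partial>\<nu>) = ennreal (mix_dens \<sigma> \<nu> y)"
  unfolding mix_dens_def
  by (rule nn_integral_eq_integral[OF integrable_gauss_dens_mix])
    auto

lemma mix_dens_pos: "mix_dens \<sigma> \<nu> y > 0"
proof -
  note [measurable_cong, simp] = borel_probD(2)[OF \<nu>]
  have "mix_dens \<sigma> \<nu> y \<noteq> 0"
  proof
    assume "mix_dens \<sigma> \<nu> y = 0"
    then have "AE \<theta> in \<nu>. gauss_dens \<sigma> (y - \<theta>) = 0"
      unfolding mix_dens_def
      by (subst (asm) integral_nonneg_eq_0_iff_AE)
        (use integrable_gauss_dens_mix gauss_dens_nonneg in auto)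
    then have "AE \<theta> in \<nu>. False"
      by eventually_elim (use gauss_dens_pos[OF \<sigma>] in \<open>metis less_irrefl\<close>)
    then show False using N.AE_False by simp
  qed
  moreover have "mix_dens \<sigma> \<nu> y \<ge> 0"
    unfolding mix_dens_def by simp
  ultimately show ?thesis by simp
qed

lemma nn_integral_mix_dens: "(\<integral>\<^sup>+y. ennreal (mix_dens \<sigma> \<nu> y) \<partial>lborel) = 1"
proof -
  note [measurable_cong, simp] = borel_probD(2)[OF \<nu>]
  interpret pair_sigma_finite \<nu> "lborel :: 'a measure" ..
  have "(\<integral>\<^sup>+y. ennreal (mix_dens \<sigma> \<nu> y) \<partial>lborel) = (\<integral>\<^sup>+\<theta>. \<integral>\<^sup>+y. ennreal (gauss_dens \<sigma> (y - \<theta>)) \<partial>lborel \<partial>\<nu>)"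
    unfolding nn_integral_mix[symmetric] by (rule Fubini') simp
  also have "\<dots> = 1" using N.emeasure_space_1 by (simp add: nn_integral_gauss_dens[OF \<sigma>])
  finally show ?thesis .
qed

lemma integrable_mix_dens: "integrable lborel (mix_dens \<sigma> \<nu>)"
  by (rule integrableI_nonneg)
    (use nn_integral_mix_dens mix_dens_measurable less_imp_le[OF mix_dens_pos] in auto)

text \<open>Fubini turns a smoothed version of the unknown mixing measure into a linear functional
  of its mixture density, which is the object that the likelihood controls. Boundedness of \<psi>
  provides the joint integrability.\<close>

lemma kernel_mixture_eq_deconvolution:
  fixes \<psi> K :: "'a \<Rightarrow> real"
  assumes [measurable]: "\<psi> \<in> borel_measurable borel" and b: "\<And>x. \<bar>\<psi> x\<bar> \<le> \<Psi>"
    and K: "\<And>\<theta>. (\<integral>y. gauss_dens \<sigma> (y - \<theta>) * \<psi> (x - y) \<partial>lborel) = K (x - \<theta>)"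
  shows "(\<integral>\<theta>. K (x - \<theta>) \<partial>\<nu>) = (\<integral>y. mix_dens \<sigma> \<nu> y * \<psi> (x - y) \<partial>lborel)"
proof -
  note [measurable_cong, simp] = borel_probD(2)[OF \<nu>]
  interpret L: pair_sigma_finite \<nu> "lborel :: 'a measure" ..
  have "integrable (\<nu> \<Otimes>\<^sub>M lborel) (\<lambda>(\<theta>, y). gauss_dens \<sigma> (y - \<theta>) * \<psi> (x - y))"
  proof (rule Bochner_Integration.integrable_bound)
    have "(\<integral>\<^sup>+z. ennreal (gauss_dens \<sigma> (snd z - fst z)) \<partial>(\<nu> \<Otimes>\<^sub>M lborel))
      = (\<integral>\<^sup>+\<theta>. \<integral>\<^sup>+y. ennreal (gauss_dens \<sigma> (y - \<theta>)) \<partial>lborel \<partial>\<nu>)"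
      by (subst lborel.nn_integral_fst[symmetric]) auto
    also have "\<dots> = 1" using N.emeasure_space_1 by (simp add: nn_integral_gauss_dens[OF \<sigma>])
    finally have "integrable (\<nu> \<Otimes>\<^sub>M lborel) (\<lambda>z. gauss_dens \<sigma> (snd z - fst z))"
      by (intro integrableI_nonneg) auto
    then show "integrable (\<nu> \<Otimes>\<^sub>M lborel) (\<lambda>z. gauss_dens \<sigma> (snd z - fst z) * \<Psi>)" by simp
    show "AE z in \<nu> \<Otimes>\<^sub>M lborel. norm (case z of (\<theta>, y) \<Rightarrow> gauss_dens \<sigma> (y - \<theta>) * \<psi> (x - y))
       \<le> norm (gauss_dens \<sigma> (snd z - fst z) * \<Psi>)"
      using b by (auto simp: abs_mult intro!: mult_left_mono AE_I2 order_trans[OF b abs_ge_self])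
  qed measurable
  from L.Fubini_integral[OF this] show ?thesis
    unfolding K mix_dens_def by simp
qed

end

text \<open>An integral bound between mixture densities becomes a uniform bound between smoothed
  mixing measures; the price is the sup norm of the deconvolving function.\<close>

lemma kernel_mixture_diff_le:
  fixes \<mu> \<nu> :: "'a::euclidean_space measure" and \<psi> K :: "'a \<Rightarrow> real"
  assumes \<sigma>: "\<sigma> > 0" and \<mu>: "borel_prob \<mu>" and \<nu>: "borel_prob \<nu>"
    and \<psi>[measurable]: "\<psi> \<in> borel_measurable borel" and b: "\<And>x. \<bar>\<psi> x\<bar> \<le> \<Psi>"
    and K: "\<And>\<theta>. (\<integral>y. gauss_dens \<sigma> (y - \<theta>) * \<psi> (x - y) \<partial>lborel) = K (x - \<theta>)"
    and L: "(\<integral>\<^sup>+y. ennreal \<bar>mix_dens \<sigma> \<mu> y - mix_dens \<sigma> \<nu> y\<bar> \<partial>lborel) \<le> ennreal L" and L0: "L \<ge> 0"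
  shows "\<bar>(\<integral>\<theta>. K (x - \<theta>) \<partial>\<mu>) - (\<integral>\<theta>. K (x - \<theta>) \<partial>\<nu>)\<bar> \<le> \<Psi> * L"
proof -
  note [measurable] = mix_dens_measurable[OF \<sigma> \<mu>] mix_dens_measurable[OF \<sigma> \<nu>]
  have \<Psi>: "\<Psi> \<ge> 0" using b[of 0] by linarith
  have i: "integrable lborel (\<lambda>y. mix_dens \<sigma> \<rho> y * \<psi> (x - y))" if \<rho>: "borel_prob \<rho>" for \<rho> :: "'a measure"
  proof (rule Bochner_Integration.integrable_bound)
    show "integrable lborel (\<lambda>y. mix_dens \<sigma> \<rho> y * \<Psi>)" using integrable_mix_dens[OF \<sigma> \<rho>] by simp
    note [measurable] = mix_dens_measurable[OF \<sigma> \<rho>]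
    have "(\<lambda>y. mix_dens \<sigma> \<rho> y * \<psi> (x - y)) \<in> borel_measurable borel" by measurable
    then show "(\<lambda>y. mix_dens \<sigma> \<rho> y * \<psi> (x - y)) \<in> borel_measurable lborel" by simp
  qed (use b in \<open>auto simp: abs_mult intro!: mult_left_mono order_trans[OF b abs_ge_self]\<close>)
  have id: "integrable lborel (\<lambda>y. \<bar>mix_dens \<sigma> \<mu> y - mix_dens \<sigma> \<nu> y\<bar>)"
    using integrable_mix_dens[OF \<sigma> \<mu>] integrable_mix_dens[OF \<sigma> \<nu>] by auto
  have le: "(\<integral>y. \<bar>mix_dens \<sigma> \<mu> y - mix_dens \<sigma> \<nu> y\<bar> \<partial>lborel) \<le> L"
    using L L0 nn_integral_eq_integral[OF id] by (simp add: ennreal_le_iff)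
  have "(\<integral>\<theta>. K (x - \<theta>) \<partial>\<mu>) - (\<integral>\<theta>. K (x - \<theta>) \<partial>\<nu>)
     = (\<integral>y. mix_dens \<sigma> \<mu> y * \<psi> (x - y) - mix_dens \<sigma> \<nu> y * \<psi> (x - y) \<partial>lborel)"
    using i[OF \<mu>] i[OF \<nu>] kernel_mixture_eq_deconvolution[OF \<sigma> \<mu> \<psi> b K]
      kernel_mixture_eq_deconvolution[OF \<sigma> \<nu> \<psi> b K] by simp
  also have "\<bar>\<dots>\<bar> \<le> (\<integral>y. \<bar>mix_dens \<sigma> \<mu> y * \<psi> (x - y) - mix_dens \<sigma> \<nu> y * \<psi> (x - y)\<bar> \<partial>lborel)"
    by (rule integral_abs_bound)
  also have "\<dots> \<le> (\<integral>y. \<bar>mix_dens \<sigma> \<mu> y - mix_dens \<sigma> \<nu> y\<bar> * \<Psi> \<partial>lborel)"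
  proof (rule integral_mono)
    show "integrable lborel (\<lambda>y. \<bar>mix_dens \<sigma> \<mu> y * \<psi> (x - y) - mix_dens \<sigma> \<nu> y * \<psi> (x - y)\<bar>)"
      using i[OF \<mu>] i[OF \<nu>] by auto
    show "integrable lborel (\<lambda>y. \<bar>mix_dens \<sigma> \<mu> y - mix_dens \<sigma> \<nu> y\<bar> * \<Psi>)" using id by auto
    fix y
    show "\<bar>mix_dens \<sigma> \<mu> y * \<psi> (x - y) - mix_dens \<sigma> \<nu> y * \<psi> (x - y)\<bar> \<le> \<bar>mix_dens \<sigma> \<mu> y - mix_dens \<sigma> \<nu> y\<bar> * \<Psi>"
      unfolding left_diff_distrib[symmetric] abs_mult by (rule mult_left_mono[OF b]) simp
  qed
  also have "\<dots> = (\<integral>y. \<bar>mix_dens \<sigma> \<mu> y - mix_dens \<sigma> \<nu> y\<bar> \<partial>lborel) * \<Psi>" by simp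
  also have "\<dots> \<le> L * \<Psi>" using le \<Psi> by (rule mult_right_mono)
  finally show ?thesis by (simp add: mult.commute)
qed

text \<open>Projecting onto a ball that contains all observations brings every location outside the
  ball strictly closer to each observation and fixes the others. If \<nu> had mass outside, its
  image under the projection would have strictly larger density at every observation, contradicting
  minimality.\<close>

lemma npmle_support:
  fixes \<nu> :: "'a::euclidean_space measure"
  assumes \<sigma>: "\<sigma> > 0" and n: "n \<ge> 1" and y: "\<And>i. i < n \<Longrightarrow> norm (y i) \<le> R"
    and npmle: "npmle \<sigma> n y \<nu>"
  shows "AE \<theta> in \<nu>. norm \<theta> \<le> R"
proof (rule ccontr)
  assume neg: "\<not> ?thesis"
  have \<nu>: "borel_prob \<nu>" using npmle by (simp add: npmle_def)
  interpret N: prob_space \<nu> using \<nu> by (rule borel_probD)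
  note [measurable_cong, simp] = borel_probD(2)[OF \<nu>]
  have [simp]: "space \<nu> = UNIV" using \<nu> by (rule borel_probD)
  let ?S = "cball (0::'a) R"
  have S: "closed ?S" "convex ?S" by auto
  have Sne: "?S \<noteq> {}" using y[of 0] n by (metis One_nat_def Suc_le_lessD dist_0_norm empty_iff mem_cball)
  define T where "T = closest_point ?S"
  have "continuous_on UNIV T" unfolding T_def
    by (rule continuous_on_closest_point) (use S Sne in auto)
  then have T[measurable]: "T \<in> borel_measurable borel" by (rule borel_measurable_continuous_onI)
  have closer: "norm (x - T \<theta>) < norm (x - \<theta>)" if "norm x \<le> R" "norm \<theta> > R" for x \<theta>
  proof -
    \<comment> \<open>Obtuse angle property of the projection onto a convex set; expanding the
      square of \<theta> - x around \<open>T \<theta>\<close> then gives the strict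
      inequality.\<close>
    have "(\<theta> - T \<theta>) \<bullet> (x - T \<theta>) \<le> 0" unfolding T_def
      by (rule closest_point_dot) (use S that in auto)
    moreover have "\<theta> \<noteq> T \<theta>"
      using closest_point_in_set[of ?S \<theta>] S Sne that by (metis T_def linorder_not_le mem_cball_0)
    moreover have "(norm (x - \<theta>))\<^sup>2 = (norm (x - T \<theta>))\<^sup>2 + (norm (\<theta> - T \<theta>))\<^sup>2 - 2 * ((\<theta> - T \<theta>) \<bullet> (x - T \<theta>))"
      by (simp add: power2_norm_eq_inner inner_diff_left inner_diff_right inner_commute algebra_simps)
    ultimately have "(norm (x - T \<theta>))\<^sup>2 < (norm (x - \<theta>))\<^sup>2"
      by (smt (verit) zero_less_power2 right_minus_eq norm_eq_zero)
    then show ?thesis by (rule power2_less_imp_less) simp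
  qed
  have T_in: "T \<theta> = \<theta>" if "norm \<theta> \<le> R" for \<theta>
    unfolding T_def using that by (intro closest_point_self) simp
  have T': "T \<in> measurable \<nu> borel" by measurable
  define \<mu> where "\<mu> = distr \<nu> borel T"
  have \<mu>: "borel_prob \<mu>" unfolding \<mu>_def borel_prob_def by (simp add: N.prob_space_distr[OF T'])
  have lt: "mix_dens \<sigma> \<nu> x < mix_dens \<sigma> \<mu> x" if x: "norm x \<le> R" for x
  proof -
    have eq: "mix_dens \<sigma> \<mu> x = (\<integral>\<theta>. gauss_dens \<sigma> (x - T \<theta>) \<partial>\<nu>)"
      unfolding mix_dens_def \<mu>_def by (subst integral_distr) auto
    have int: "integrable \<nu> (\<lambda>\<theta>. gauss_dens \<sigma> (x - T \<theta>))"
      by (rule N.integrable_const_bound[where B="gauss_dens \<sigma> (0::'a)"])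
        (auto intro: gauss_dens_le_0[OF \<sigma>])
    have le: "gauss_dens \<sigma> (x - \<theta>) \<le> gauss_dens \<sigma> (x - T \<theta>)" for \<theta>
      using closer[OF x, of \<theta>] T_in[of \<theta>] \<sigma> by (cases "norm \<theta> \<le> R") (auto intro!: gauss_dens_antimono)
    \<comment> \<open>Equal integrals of pointwise ordered functions would force equality almost
      everywhere, but the inequality is strict wherever \<open>norm \<theta> > R\<close>.\<close>
    have "mix_dens \<sigma> \<nu> x \<noteq> mix_dens \<sigma> \<mu> x"
    proof
      assume "mix_dens \<sigma> \<nu> x = mix_dens \<sigma> \<mu> x"
      then have "(\<integral>\<theta>. gauss_dens \<sigma> (x - T \<theta>) - gauss_dens \<sigma> (x - \<theta>) \<partial>\<nu>) = 0"
        using int integrable_gauss_dens_mix[OF \<sigma> \<nu>, of x] eq by (simp add: mix_dens_def)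
      then have "AE \<theta> in \<nu>. gauss_dens \<sigma> (x - T \<theta>) - gauss_dens \<sigma> (x - \<theta>) = 0"
        by (subst (asm) integral_nonneg_eq_0_iff_AE)
          (use int integrable_gauss_dens_mix[OF \<sigma> \<nu>, of x] le in auto)
      then have "AE \<theta> in \<nu>. norm \<theta> \<le> R"
      proof eventually_elim
        case (elim \<theta>)
        show ?case
        proof (rule ccontr)
          assume "\<not> norm \<theta> \<le> R"
          then have "gauss_dens \<sigma> (x - \<theta>) < gauss_dens \<sigma> (x - T \<theta>)"
            using closer[OF x, of \<theta>] \<sigma> by (intro gauss_dens_strict_antimono) auto
          then show False using elim by simp
        qed
      qed
      then show False using neg by simp
    qed
    moreover have "mix_dens \<sigma> \<nu> x \<le> mix_dens \<sigma> \<mu> x"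
      unfolding eq unfolding mix_dens_def
      by (rule integral_mono) (use int integrable_gauss_dens_mix[OF \<sigma> \<nu>, of x] le in auto)
    ultimately show ?thesis by simp
  qed
  have "(\<Sum>i<n. ln (mix_dens \<sigma> \<nu> (y i))) < (\<Sum>i<n. ln (mix_dens \<sigma> \<mu> (y i)))"
    using lt y n mix_dens_pos[OF \<sigma> \<nu>] mix_dens_pos[OF \<sigma> \<mu>]
    by (intro sum_strict_mono) (auto simp: lessThan_empty_iff)
  moreover have "- (\<Sum>i<n. ln (mix_dens \<sigma> \<nu> (y i))) \<le> - (\<Sum>i<n. ln (mix_dens \<sigma> \<mu> (y i)))"
    using npmle \<mu> unfolding npmle_def by blast
  ultimately show False by linarith
qed

section \<open>Likelihood ratios and upper brackets\<close>

text \<open>An exponent with variance inflated by c under the old normalization is an inflated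
  Gaussian density times the ratio of the two normalizing constants. It serves the tail bound with c
  = 2 and the brackets with c = 1 + \<epsilon>.\<close>

lemma gauss_dens_scale:
  fixes z :: "'a::euclidean_space"
  assumes "c > 0" "\<sigma> > 0"
  shows "exp (- (norm z)\<^sup>2 / (2 * \<sigma>\<^sup>2 * c)) / sqrt (2 * pi * \<sigma>\<^sup>2) ^ DIM('a)
    = sqrt c ^ DIM('a) * gauss_dens (\<sigma> * sqrt c) z"
proof -
  have "sqrt (2 * pi * (\<sigma> * sqrt c)\<^sup>2) = sqrt c * sqrt (2 * pi * \<sigma>\<^sup>2)"
    using assms by (simp add: real_sqrt_mult power_mult_distrib)
  then show ?thesis
    using assms by (simp add: gauss_dens_def power_mult_distrib mult.assoc)
qed

text \<open>Split the Gaussian exponent in half. One half stays as a Gaussian of variance 2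
  \<sigma>^2, which integrates to a constant; the other is bounded through R^2 \<le> 2 \<bar>y -
  \<theta>\<bar>^2 + 2 B^2, valid for \<open>norm y > R\<close>, and yields the factor exp(- R^2 /
  (8 \<sigma>^2)).\<close>

lemma nn_integral_mix_dens_tail:
  fixes \<mu> :: "'a::euclidean_space measure"
  assumes \<sigma>: "\<sigma> > 0" and \<mu>: "borel_prob \<mu>" and supp: "AE \<theta> in \<mu>. norm \<theta> \<le> B" and R: "R \<ge> 0"
  shows "(\<integral>\<^sup>+y. ennreal (mix_dens \<sigma> \<mu> y) * indicator {y. norm y > R} y \<partial>lborel)
    \<le> ennreal (exp (B\<^sup>2 / (4 * \<sigma>\<^sup>2)) * sqrt 2 ^ DIM('a) * exp (- R\<^sup>2 / (8 * \<sigma>\<^sup>2)))"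
proof -
  interpret M: prob_space \<mu> using \<mu> by (rule borel_probD)
  note [measurable_cong, simp] = borel_probD(2)[OF \<mu>]
  interpret L: pair_sigma_finite \<mu> "lborel :: 'a measure" ..
  let ?c = "exp (B\<^sup>2 / (4 * \<sigma>\<^sup>2)) * sqrt 2 ^ DIM('a) * exp (- R\<^sup>2 / (8 * \<sigma>\<^sup>2))"
  have le: "gauss_dens \<sigma> (y - \<theta>) \<le> ?c * gauss_dens (\<sigma> * sqrt 2) (y - \<theta>)"
    if \<theta>: "norm \<theta> \<le> B" and y: "norm y > R" for y \<theta> :: 'a
  proof -
    have "R\<^sup>2 \<le> (norm y)\<^sup>2" using R y by (intro power_mono) auto
    also have "(norm y)\<^sup>2 \<le> (norm (y - \<theta>) + B)\<^sup>2"
      using norm_triangle_ineq[of "y - \<theta>" \<theta>] \<theta> by (intro power_mono) auto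
    also have "\<dots> \<le> 2 * (norm (y - \<theta>))\<^sup>2 + 2 * B\<^sup>2"
      using zero_le_power2[of "norm (y - \<theta>) - B"] by (simp add: power2_eq_square algebra_simps)
    finally have R2: "R\<^sup>2 \<le> 2 * (norm (y - \<theta>))\<^sup>2 + 2 * B\<^sup>2" .
    have "- (norm (y - \<theta>))\<^sup>2 / (2 * \<sigma>\<^sup>2) \<le> B\<^sup>2 / (4 * \<sigma>\<^sup>2) + (- R\<^sup>2 / (8 * \<sigma>\<^sup>2) + - (norm (y - \<theta>))\<^sup>2 / (2 * \<sigma>\<^sup>2 * 2))"
      using R2 \<sigma> by (simp add: field_simps)
    then have "exp (- (norm (y - \<theta>))\<^sup>2 / (2 * \<sigma>\<^sup>2)) \<le> exp (B\<^sup>2 / (4 * \<sigma>\<^sup>2)) * (exp (- R\<^sup>2 / (8 * \<sigma>\<^sup>2)) * exp (- (norm (y - \<theta>))\<^sup>2 / (2 * \<sigma>\<^sup>2 * 2)))"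
      unfolding exp_add[symmetric] by simp
    then have "gauss_dens \<sigma> (y - \<theta>) \<le> exp (B\<^sup>2 / (4 * \<sigma>\<^sup>2)) * (exp (- R\<^sup>2 / (8 * \<sigma>\<^sup>2)) * exp (- (norm (y - \<theta>))\<^sup>2 / (2 * \<sigma>\<^sup>2 * 2))) / sqrt (2 * pi * \<sigma>\<^sup>2) ^ DIM('a)"
      unfolding gauss_dens_def by (rule divide_right_mono) simp
    also have "\<dots> = exp (B\<^sup>2 / (4 * \<sigma>\<^sup>2)) * exp (- R\<^sup>2 / (8 * \<sigma>\<^sup>2)) * (exp (- (norm (y - \<theta>))\<^sup>2 / (2 * \<sigma>\<^sup>2 * 2)) / sqrt (2 * pi * \<sigma>\<^sup>2) ^ DIM('a))"
      by simp
    also have "\<dots> = ?c * gauss_dens (\<sigma> * sqrt 2) (y - \<theta>)"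
      using \<sigma> by (subst gauss_dens_scale) auto
    finally show ?thesis .
  qed
  have "(\<integral>\<^sup>+y. ennreal (mix_dens \<sigma> \<mu> y) * indicator {y. norm y > R} y \<partial>lborel)
    = (\<integral>\<^sup>+y. \<integral>\<^sup>+\<theta>. ennreal (gauss_dens \<sigma> (y - \<theta>)) * indicator {y. norm y > R} y \<partial>\<mu> \<partial>lborel)"
    by (simp add: nn_integral_multc nn_integral_mix[OF \<sigma> \<mu>])
  also have "\<dots> \<le> (\<integral>\<^sup>+y. \<integral>\<^sup>+\<theta>. ennreal ?c * ennreal (gauss_dens (\<sigma> * sqrt 2) (y - \<theta>)) \<partial>\<mu> \<partial>lborel)"
  proof (rule nn_integral_mono, rule nn_integral_mono_AE)
    fix y :: 'a
    show "AE \<theta> in \<mu>. ennreal (gauss_dens \<sigma> (y - \<theta>)) * indicator {y. norm y > R} y \<le> ennreal ?c * ennreal (gauss_dens (\<sigma> * sqrt 2) (y - \<theta>))"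
      using supp
    proof eventually_elim
      case (elim \<theta>)
      show ?case
      proof (cases "norm y > R")
        case True
        then show ?thesis using le[OF elim True] by (subst ennreal_mult'[symmetric]) (auto intro!: ennreal_leI)
      qed simp
    qed
  qed
  also have "\<dots> = (\<integral>\<^sup>+\<theta>. \<integral>\<^sup>+y. ennreal ?c * ennreal (gauss_dens (\<sigma> * sqrt 2) (y - \<theta>)) \<partial>lborel \<partial>\<mu>)"
    by (rule L.Fubini') simp
  also have "\<dots> = ennreal ?c"
    using \<sigma> M.emeasure_space_1 by (simp add: nn_integral_cmult nn_integral_gauss_dens)
  finally show ?thesis .
qed

text \<open>Under the product law the expectation of the square root of the likelihood ratio
  factorizes into the n-th power of the affinity, the integral of sqrt(g f). Here \<open>g\<close>
  may have mass above 1, as upper brackets do.\<close>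

lemma likelihood_ratio_bound:
  fixes f g :: "'a::euclidean_space \<Rightarrow> real"
  assumes [measurable]: "f \<in> borel_measurable borel" "g \<in> borel_measurable borel"
    and f: "\<And>y. f y > 0" and g: "\<And>y. g y \<ge> 0"
    and f1: "(\<integral>\<^sup>+y. ennreal (f y) \<partial>lborel) = 1"
    and \<rho>: "(\<integral>\<^sup>+y. ennreal (sqrt (g y * f y)) \<partial>lborel) \<le> ennreal \<rho>" "\<rho> \<ge> 0"
  shows "emeasure (PiM {..<n} (\<lambda>_. density lborel (\<lambda>y. ennreal (f y))))
    {\<omega> \<in> space (PiM {..<n} (\<lambda>_. density lborel (\<lambda>y. ennreal (f y)))). (\<Prod>i<n. f (\<omega> i)) \<le> (\<Prod>i<n. g (\<omega> i))}
    \<le> ennreal (\<rho> ^ n)"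
proof -
  define M where "M = density lborel (\<lambda>y. ennreal (f y))"
  have [measurable_cong, simp]: "sets M = sets borel" by (simp add: M_def)
  interpret M: prob_space M
    by (rule prob_spaceI) (simp add: M_def emeasure_density f1)
  interpret P: product_prob_space "\<lambda>_::nat. M" "{..<n}" ..
  let ?P = "PiM {..<n} (\<lambda>_. M)"
  define u where "u \<omega> = (\<Prod>i<n. ennreal (sqrt (g (\<omega> i) / f (\<omega> i))))" for \<omega> :: "nat \<Rightarrow> 'a"
  have [measurable]: "u \<in> borel_measurable ?P" unfolding u_def by measurable
  have "{\<omega> \<in> space ?P. (\<Prod>i<n. f (\<omega> i)) \<le> (\<Prod>i<n. g (\<omega> i))} \<subseteq> {\<omega> \<in> space ?P. 1 \<le> 1 * u \<omega>}"
  proof safe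
    fix \<omega> assume "(\<Prod>i<n. f (\<omega> i)) \<le> (\<Prod>i<n. g (\<omega> i))"
    then have "1 \<le> (\<Prod>i<n. g (\<omega> i) / f (\<omega> i))"
      using f by (simp add: prod_dividef prod_pos)
    then have "1 \<le> sqrt (\<Prod>i<n. g (\<omega> i) / f (\<omega> i))" by simp
    also have "\<dots> = (\<Prod>i<n. sqrt (g (\<omega> i) / f (\<omega> i)))"
      by (induction n) (auto simp: real_sqrt_mult real_sqrt_divide)
    finally have "ennreal 1 \<le> ennreal (\<Prod>i<n. sqrt (g (\<omega> i) / f (\<omega> i)))" by (rule ennreal_leI)
    then show "1 \<le> 1 * u \<omega>" using f g by (simp add: u_def prod_ennreal less_imp_le)
  qed
  then have "emeasure ?P {\<omega> \<in> space ?P. (\<Prod>i<n. f (\<omega> i)) \<le> (\<Prod>i<n. g (\<omega> i))} \<le> emeasure ?P {\<omega> \<in> space ?P. 1 \<le> 1 * u \<omega>}"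
    by (rule emeasure_mono) measurable
  also have "\<dots> \<le> 1 * (\<integral>\<^sup>+\<omega>. u \<omega> * indicator (space ?P) \<omega> \<partial>?P)"
    by (rule nn_integral_Markov_inequality) auto
  also have "\<dots> = (\<integral>\<^sup>+\<omega>. u \<omega> \<partial>?P)" by (simp cong: nn_integral_cong)
  also have "\<dots> = (\<Prod>i<n. \<integral>\<^sup>+y. ennreal (sqrt (g y / f y)) \<partial>M)"
    unfolding u_def by (rule P.product_nn_integral_prod) auto
  also have "(\<integral>\<^sup>+y. ennreal (sqrt (g y / f y)) \<partial>M) = (\<integral>\<^sup>+y. ennreal (f y) * ennreal (sqrt (g y / f y)) \<partial>lborel)"
    unfolding M_def by (rule nn_integral_density) auto
  also have "\<dots> = (\<integral>\<^sup>+y. ennreal (sqrt (g y * f y)) \<partial>lborel)"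
  proof (rule nn_integral_cong)
    fix y
    have "f y * sqrt (g y / f y) = sqrt (g y * f y)"
      using f[of y] by (simp add: real_sqrt_mult real_sqrt_divide field_simps)
    then show "ennreal (f y) * ennreal (sqrt (g y / f y)) = ennreal (sqrt (g y * f y))"
      using f[of y] by (simp flip: ennreal_mult')
  qed
  finally have "emeasure ?P {\<omega> \<in> space ?P. (\<Prod>i<n. f (\<omega> i)) \<le> (\<Prod>i<n. g (\<omega> i))}
     \<le> (\<integral>\<^sup>+y. ennreal (sqrt (g y * f y)) \<partial>lborel) ^ n" by simp
  also have "\<dots> \<le> ennreal \<rho> ^ n" by (rule power_mono) (use \<rho> in auto)
  also have "\<dots> = ennreal (\<rho> ^ n)" using \<rho> by (simp add: ennreal_power)
  finally show ?thesis unfolding M_def .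
qed

lemma integrable_sqrt_mult:
  fixes f g :: "'a \<Rightarrow> real"
  assumes f: "integrable M f" "\<And>x. f x \<ge> 0" and g: "integrable M g" "\<And>x. g x \<ge> 0"
  shows "integrable M (\<lambda>x. sqrt (g x * f x))"
proof (rule Bochner_Integration.integrable_bound)
  show "integrable M (\<lambda>x. (g x + f x) / 2)" using f g by auto
  show "(\<lambda>x. sqrt (g x * f x)) \<in> borel_measurable M" using f g by measurable
  show "AE x in M. norm (sqrt (g x * f x)) \<le> norm ((g x + f x) / 2)"
    using arith_geo_mean_sqrt[OF g(2) f(2)] f(2) g(2) by (auto simp: abs_of_nonneg)
qed

text \<open>With a = sqrt g and b = sqrt f, \<bar>g - f\<bar> = \<bar>a - b\<bar> (a + b), and the
  squared Hellinger integral of (a - b)^2 is at most \<tau> + 2 \<beta>. Cauchy-Schwarz is replaced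
  by a pointwise weighted inequality, so only linear integrals occur.\<close>

lemma l1_le_affinity:
  fixes f g :: "'a \<Rightarrow> real"
  assumes f: "integrable M f" "\<And>x. f x \<ge> 0" "(\<integral>x. f x \<partial>M) = 1"
    and g: "integrable M g" "\<And>x. g x \<ge> 0" "(\<integral>x. g x \<partial>M) \<le> 1 + \<tau>"
    and \<tau>: "0 \<le> \<tau>" "\<tau> \<le> 1" and \<beta>: "\<beta> > 0" and \<rho>: "(\<integral>x. sqrt (g x * f x) \<partial>M) \<ge> 1 - \<beta>"
  shows "(\<integral>x. \<bar>g x - f x\<bar> \<partial>M) \<le> 4 * sqrt (\<tau> + 2 * \<beta>)"
proof -
  \<comment> \<open>The integral of (a - b)^2 is the mass of g plus 1 minus twice the affinity,
    hence at most \<open>s * s\<close>. Weighting (a - b)^2 by 1 / (2 s) and (a + b)^2 by s / 2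
    makes both contributions of order s.\<close>
  define s where "s = sqrt (\<tau> + 2 * \<beta>)"
  have s: "s > 0" using \<tau> \<beta> by (simp add: s_def)
  have s2: "s * s = \<tau> + 2 * \<beta>" using \<tau> \<beta> by (simp add: s_def)
  define l where "l = 1 / s"
  have l: "l > 0" using s by (simp add: l_def)
  have pt: "\<bar>g x - f x\<bar> + l * sqrt (g x * f x) \<le> (l / 2 + s) * (g x + f x)" for x
  proof -
    define a b where "a = sqrt (g x)" and "b = sqrt (f x)"
    have ab: "g x = a * a" "f x = b * b" "a \<ge> 0" "b \<ge> 0" "sqrt (g x * f x) = a * b"
      using f(2)[of x] g(2)[of x] by (auto simp: a_def b_def real_sqrt_mult)
    have "\<bar>a - b\<bar> * (a + b) \<le> l / 2 * (a - b)\<^sup>2 + s / 2 * (a + b)\<^sup>2"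
    proof -
      have "0 \<le> l / 2 * (\<bar>a - b\<bar> - s * (a + b))\<^sup>2" using l by simp
      also have "\<dots> = l / 2 * (a - b)\<^sup>2 - (l * s) * (\<bar>a - b\<bar> * (a + b)) + (l * s) * s / 2 * (a + b)\<^sup>2"
        by (simp add: power2_diff power_mult_distrib algebra_simps power2_eq_square)
      also have "l * s = 1" using s by (simp add: l_def)
      finally show ?thesis by simp
    qed
    also have "\<dots> \<le> l / 2 * (a - b)\<^sup>2 + s / 2 * (2 * (a * a + b * b))"
    proof -
      have "(a + b)\<^sup>2 \<le> 2 * (a * a + b * b)"
        using zero_le_power2[of "a - b"] by (simp add: power2_eq_square algebra_simps)
      then show ?thesis using s by (intro add_left_mono mult_left_mono) auto
    qed
    finally have "\<bar>a - b\<bar> * (a + b) + l * (a * b) \<le> (l / 2 + s) * (a * a + b * b)"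
      by (simp add: power2_eq_square algebra_simps)
    moreover have "\<bar>g x - f x\<bar> = \<bar>a - b\<bar> * (a + b)"
    proof -
      have "g x - f x = (a - b) * (a + b)" unfolding ab by (simp add: algebra_simps)
      then show ?thesis using ab by (simp add: abs_mult)
    qed
    ultimately show ?thesis using ab by simp
  qed
  have i: "integrable M (\<lambda>x. sqrt (g x * f x))" by (rule integrable_sqrt_mult) (use f g in auto)
  have "(\<integral>x. \<bar>g x - f x\<bar> \<partial>M) + l * (\<integral>x. sqrt (g x * f x) \<partial>M)
      = (\<integral>x. \<bar>g x - f x\<bar> + l * sqrt (g x * f x) \<partial>M)"
    using i f g by simp
  also have "\<dots> \<le> (\<integral>x. (l / 2 + s) * (g x + f x) \<partial>M)"
    by (rule integral_mono) (use i f g pt in auto)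
  also have "\<dots> = (l / 2 + s) * ((\<integral>x. g x \<partial>M) + 1)" using f g by simp
  also have "\<dots> \<le> (l / 2 + s) * (2 + \<tau>)" using l s g by (intro mult_left_mono) auto
  finally have "(\<integral>x. \<bar>g x - f x\<bar> \<partial>M) \<le> (l / 2 + s) * (2 + \<tau>) - l * (\<integral>x. sqrt (g x * f x) \<partial>M)" by simp
  also have "\<dots> \<le> (l / 2 + s) * (2 + \<tau>) - l * (1 - \<beta>)"
    using mult_left_mono[OF \<rho>, of l] l by linarith
  also have "\<dots> = l * (s * s) / 2 + s * (2 + \<tau>)" unfolding s2 by (simp add: field_simps)
  also have "l * (s * s) = s" using s by (simp add: l_def)
  also have "s / 2 + s * (2 + \<tau>) \<le> 4 * s"
  proof -
    have "s * \<tau> \<le> s * 1" using s \<tau> by (intro mult_left_mono) auto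
    then show ?thesis using s unfolding distrib_left by linarith
  qed
  finally show ?thesis unfolding s_def .
qed

section \<open>Discretization of the mixing measures and upper brackets for the mixtures\<close>

lemma grid_rounding:
  fixes R \<epsilon> :: real
  assumes R: "R \<ge> 0" and \<epsilon>: "\<epsilon> > 0"
  shows "\<exists>r :: 'a::euclidean_space \<Rightarrow> 'a. r \<in> borel_measurable borel \<and> (\<forall>\<theta>. norm (\<theta> - r \<theta>) \<le> \<epsilon>) \<and>
     finite (r ` cball 0 R) \<and> card (r ` cball 0 R) \<le> (2 * nat \<lceil>R * DIM('a) / \<epsilon>\<rceil> + 1) ^ DIM('a)"
proof -
  \<comment> \<open>The error is measured by the sum of the coordinate errors, so each coordinate
    may contribute only \<epsilon> divided by the dimension.\<close>
  define \<delta> where "\<delta> = \<epsilon> / DIM('a)"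
  have \<delta>: "\<delta> > 0" using \<epsilon> by (simp add: \<delta>_def)
  define m where "m = \<lceil>R / \<delta>\<rceil>"
  have m0: "m \<ge> 0" using R \<delta> unfolding m_def by (simp add: ceiling_mono[of 0, simplified])
  define j where "j \<theta> b = \<lfloor>(\<theta> \<bullet> b) / \<delta>\<rfloor>" for \<theta> b :: 'a
  define r where "r \<theta> = (\<Sum>b\<in>Basis. (\<delta> * real_of_int (j \<theta> b)) *\<^sub>R b)" for \<theta> :: 'a
  have "r \<in> borel_measurable borel" unfolding r_def j_def by measurable
  moreover have "norm (\<theta> - r \<theta>) \<le> \<epsilon>" for \<theta>
  proof -
    have "norm (\<theta> - r \<theta>) \<le> (\<Sum>b\<in>Basis. \<bar>(\<theta> - r \<theta>) \<bullet> b\<bar>)" by (rule norm_le_l1)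
    also have "\<dots> \<le> real DIM('a) * \<delta>"
    proof (rule sum_bounded_above)
      fix b :: 'a assume b: "b \<in> Basis"
      have "(\<theta> - r \<theta>) \<bullet> b = \<delta> * ((\<theta> \<bullet> b) / \<delta> - real_of_int (j \<theta> b))"
        using \<delta> b by (simp add: r_def inner_diff_left inner_sum_left inner_Basis if_distrib right_diff_distrib cong: if_cong)
      moreover have "0 \<le> (\<theta> \<bullet> b) / \<delta> - real_of_int (j \<theta> b)" "(\<theta> \<bullet> b) / \<delta> - real_of_int (j \<theta> b) \<le> 1"
        unfolding j_def by linarith+
      ultimately show "\<bar>(\<theta> - r \<theta>) \<bullet> b\<bar> \<le> \<delta>"
        using \<delta> by (simp add: abs_mult)
    qed
    also have "\<dots> = \<epsilon>" by (simp add: \<delta>_def)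
    finally show ?thesis .
  qed
  moreover have sub: "r ` cball 0 R \<subseteq> (\<lambda>k. \<Sum>b\<in>Basis. (\<delta> * real_of_int (k b)) *\<^sub>R b) ` (PiE Basis (\<lambda>_. {-m..m}))"
  proof
    fix t assume "t \<in> r ` cball 0 R"
    then obtain \<theta> where \<theta>: "t = r \<theta>" "norm \<theta> \<le> R" by auto
    have "j \<theta> b \<in> {-m..m}" if b: "b \<in> Basis" for b
    proof -
      have "\<bar>\<theta> \<bullet> b\<bar> \<le> R" using Basis_le_norm[OF b, of \<theta>] \<theta> by linarith
      then have "\<bar>(\<theta> \<bullet> b) / \<delta>\<bar> \<le> R / \<delta>" using \<delta> by (simp add: abs_divide divide_right_mono)
      then have 1: "(\<theta> \<bullet> b) / \<delta> \<le> m" "- real_of_int m \<le> (\<theta> \<bullet> b) / \<delta>"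
        unfolding m_def by linarith+
      then show ?thesis unfolding j_def
        by (auto simp: le_floor_iff floor_le_iff)
    qed
    then have "restrict (j \<theta>) Basis \<in> PiE Basis (\<lambda>_. {-m..m})" by auto
    moreover have "t = (\<Sum>b\<in>Basis. (\<delta> * real_of_int (restrict (j \<theta>) Basis b)) *\<^sub>R b)"
      unfolding \<theta> r_def by (rule sum.cong) auto
    ultimately show "t \<in> (\<lambda>k. \<Sum>b\<in>Basis. (\<delta> * real_of_int (k b)) *\<^sub>R b) ` (PiE Basis (\<lambda>_. {-m..m}))" by blast
  qed
  moreover have fin: "finite (PiE (Basis::'a set) (\<lambda>_. {-m..m}))" by (intro finite_PiE) auto
  moreover have "card (r ` cball 0 R) \<le> (2 * nat \<lceil>R * DIM('a) / \<epsilon>\<rceil> + 1) ^ DIM('a)"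
  proof -
    have "card (r ` cball 0 R) \<le> card (PiE (Basis::'a set) (\<lambda>_. {-m..m}))"
      using surj_card_le[OF fin sub] .
    also have "\<dots> = (nat (2 * m + 1)) ^ DIM('a)" by (subst card_PiE) auto
    also have "nat (2 * m + 1) = 2 * nat m + 1" using m0 by simp
    also have "m = \<lceil>R * DIM('a) / \<epsilon>\<rceil>" by (simp add: m_def \<delta>_def)
    finally show ?thesis .
  qed
  ultimately show ?thesis using finite_subset[OF sub] by blast
qed

text \<open>Inflating the variance absorbs the displacement uniformly in \<open>y\<close>, so no truncation is needed.\<close>

lemma gauss_dens_shift_le:
  fixes y \<theta> t :: "'a::euclidean_space"
  assumes \<sigma>: "\<sigma> > 0" and \<epsilon>: "\<epsilon> > 0" and t: "norm (\<theta> - t) \<le> \<epsilon>"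
  shows "gauss_dens \<sigma> (y - \<theta>) \<le>
    exp (\<epsilon> / (2 * \<sigma>\<^sup>2)) * sqrt (1 + \<epsilon>) ^ DIM('a) * gauss_dens (\<sigma> * sqrt (1 + \<epsilon>)) (y - t)"
proof -
  define u v where "u = norm (y - \<theta>)" and "v = norm (\<theta> - t)"
  have "norm (y - t) \<le> u + v" unfolding u_def v_def using norm_triangle_ineq[of "y - \<theta>" "\<theta> - t"] by simp
  then have "(norm (y - t))\<^sup>2 \<le> (u + \<epsilon>)\<^sup>2" using t by (intro power_mono) (auto simp: v_def)
  also have "\<dots> \<le> (1 + \<epsilon>) * (u\<^sup>2 + \<epsilon>)"
  proof -
    have "0 \<le> \<epsilon> * (u - 1)\<^sup>2" using \<epsilon> by simp
    then show ?thesis by (simp add: power2_eq_square algebra_simps)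
  qed
  finally have "(norm (y - t))\<^sup>2 / (1 + \<epsilon>) \<le> u\<^sup>2 + \<epsilon>" using \<epsilon> by (simp add: field_simps)
  then have "((norm (y - t))\<^sup>2 / (1 + \<epsilon>)) / (2 * \<sigma>\<^sup>2) \<le> (u\<^sup>2 + \<epsilon>) / (2 * \<sigma>\<^sup>2)"
    by (rule divide_right_mono) simp
  then have "- u\<^sup>2 / (2 * \<sigma>\<^sup>2) \<le> \<epsilon> / (2 * \<sigma>\<^sup>2) + - (norm (y - t))\<^sup>2 / (2 * \<sigma>\<^sup>2 * (1 + \<epsilon>))"
    by (simp add: add_divide_distrib mult.commute)
  then have "exp (- u\<^sup>2 / (2 * \<sigma>\<^sup>2)) \<le> exp (\<epsilon> / (2 * \<sigma>\<^sup>2)) * exp (- (norm (y - t))\<^sup>2 / (2 * \<sigma>\<^sup>2 * (1 + \<epsilon>)))"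
    unfolding exp_add[symmetric] by simp
  then have "gauss_dens \<sigma> (y - \<theta>) \<le> exp (\<epsilon> / (2 * \<sigma>\<^sup>2)) * exp (- (norm (y - t))\<^sup>2 / (2 * \<sigma>\<^sup>2 * (1 + \<epsilon>))) / sqrt (2 * pi * \<sigma>\<^sup>2) ^ DIM('a)"
    unfolding gauss_dens_def u_def by (rule divide_right_mono) simp
  also have "\<dots> = exp (\<epsilon> / (2 * \<sigma>\<^sup>2)) * (exp (- (norm (y - t))\<^sup>2 / (2 * \<sigma>\<^sup>2 * (1 + \<epsilon>))) / sqrt (2 * pi * \<sigma>\<^sup>2) ^ DIM('a))" by simp
  also have "\<dots> = exp (\<epsilon> / (2 * \<sigma>\<^sup>2)) * sqrt (1 + \<epsilon>) ^ DIM('a) * gauss_dens (\<sigma> * sqrt (1 + \<epsilon>)) (y - t)"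
    using \<sigma> \<epsilon> by (subst gauss_dens_scale) auto
  finally show ?thesis .
qed

text \<open>A bracket is a combination of inflated Gaussians centred at the at most \<open>N\<close>
  grid points, with weights in {0, 1/m, ..., 1}; this gives the count \<open>(m + 1) ^ N\<close>.
  The mass of the bracket exceeds 1 for two reasons only: the inflation of the kernel, and the
  rounding up of each weight by at most 1/m, in total N/m.\<close>

lemma finite_upper_brackets:
  fixes \<sigma> R \<epsilon> :: real and m :: nat
  defines "N \<equiv> (2 * nat \<lceil>R * DIM('a::euclidean_space) / \<epsilon>\<rceil> + 1) ^ DIM('a)"
  assumes \<sigma>: "\<sigma> > 0" and R: "R \<ge> 0" and \<epsilon>: "\<epsilon> > 0" and m: "m \<ge> 1"
  shows "\<exists>G :: ('a \<Rightarrow> real) set. finite G \<and> card G \<le> (m + 1) ^ N \<and>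
    (\<forall>g\<in>G. integrable lborel g \<and> (\<forall>y. 0 \<le> g y)) \<and>
    (\<forall>\<nu>. borel_prob \<nu> \<and> (AE \<theta> in \<nu>. norm \<theta> \<le> R) \<longrightarrow>
       (\<exists>g\<in>G. (\<forall>y. mix_dens \<sigma> \<nu> y \<le> g y) \<and>
          (\<integral>y. g y \<partial>lborel) \<le> exp (\<epsilon> / (2 * \<sigma>\<^sup>2)) * sqrt (1 + \<epsilon>) ^ DIM('a) * (1 + N / m)))"
proof -
  obtain r :: "'a \<Rightarrow> 'a" where r[measurable]: "r \<in> borel_measurable borel"
    and r\<epsilon>: "\<And>\<theta>. norm (\<theta> - r \<theta>) \<le> \<epsilon>" and Tfin: "finite (r ` cball 0 R)"
    and Tcard: "card (r ` cball 0 R) \<le> N"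
    using grid_rounding[OF R \<epsilon>, where 'a='a] unfolding N_def by blast
  define T where "T = r ` cball 0 R"
  have T: "finite T" "card T \<le> N" using Tfin Tcard by (auto simp: T_def)
  define \<Lambda> where "\<Lambda> = exp (\<epsilon> / (2 * \<sigma>\<^sup>2)) * sqrt (1 + \<epsilon>) ^ DIM('a)"
  have \<Lambda>: "\<Lambda> \<ge> 0" using \<epsilon> by (simp add: \<Lambda>_def)
  define F where "F z = \<Lambda> * gauss_dens (\<sigma> * sqrt (1 + \<epsilon>)) z" for z :: 'a
  have F0: "F z \<ge> 0" for z using \<Lambda> by (simp add: F_def)
  have \<sigma>': "\<sigma> * sqrt (1 + \<epsilon>) > 0" using \<sigma> \<epsilon> by simp
  have gi: "integrable lborel (\<lambda>y. gauss_dens (\<sigma> * sqrt (1 + \<epsilon>)) (y - t))" for t :: 'a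
    by (rule integrableI_nonneg) (use nn_integral_gauss_dens[OF \<sigma>', of t] in auto)
  have Fi: "integrable lborel (\<lambda>y. F (y - t))" for t
    unfolding F_def using gi by simp
  have g1: "(\<integral>y. gauss_dens (\<sigma> * sqrt (1 + \<epsilon>)) (y - t) \<partial>lborel) = 1" for t :: 'a
    using nn_integral_eq_integral[OF gi, of t] nn_integral_gauss_dens[OF \<sigma>', of t] by simp
  have F1: "(\<integral>y. F (y - t) \<partial>lborel) = \<Lambda>" for t
    unfolding F_def using g1[of t] by simp
  define mk where "mk w y = (\<Sum>t\<in>T. real (w t) / real m * F (y - t))" for w :: "'a \<Rightarrow> nat" and y
  define G where "G = mk ` (PiE T (\<lambda>_. {0..m}))"
  have fin: "finite (PiE T (\<lambda>_. {0..m}))" using T by (intro finite_PiE) auto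
  have "card G \<le> card (PiE T (\<lambda>_. {0..m}))" unfolding G_def by (rule card_image_le[OF fin])
  also have "\<dots> = (m + 1) ^ card T" using T by (subst card_PiE) auto
  also have "\<dots> \<le> (m + 1) ^ N" using T by (intro power_increasing) auto
  finally have "card G \<le> (m + 1) ^ N" .
  moreover have "finite G" unfolding G_def using fin by simp
  moreover have "integrable lborel g \<and> (\<forall>y. 0 \<le> g y)" if "g \<in> G" for g
    using that Fi F0 unfolding G_def mk_def by (auto intro!: sum_nonneg)
  moreover have "\<exists>g\<in>G. (\<forall>y. mix_dens \<sigma> \<nu> y \<le> g y) \<and> (\<integral>y. g y \<partial>lborel) \<le> \<Lambda> * (1 + N / m)"
    if \<nu>: "borel_prob \<nu>" and supp: "AE \<theta> in \<nu>. norm \<theta> \<le> R" for \<nu> :: "'a measure"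
  proof -
    interpret prob_space \<nu> using \<nu> by (rule borel_probD)
    note [measurable_cong, simp] = borel_probD(2)[OF \<nu>]
    have [simp]: "space \<nu> = UNIV" using \<nu> by (rule borel_probD)
    define p where "p t = measure \<nu> (r -` {t})" for t
    have [measurable]: "r -` {t} \<in> sets borel" for t
      using measurable_sets[OF r, of "{t}"] by simp
    have p01: "0 \<le> p t" "p t \<le> 1" for t unfolding p_def by auto
    have psum: "(\<Sum>t\<in>T. p t) \<le> 1"
    proof -
      have "(\<Sum>t\<in>T. p t) = measure \<nu> (\<Union>t\<in>T. r -` {t})"
        unfolding p_def using T by (intro finite_measure_finite_Union[symmetric]) (auto simp: disjoint_family_on_def)
      then show ?thesis by simp
    qed
    \<comment> \<open>Rounding up keeps the bracket above the mixture, and since cell masses are at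
      most 1 the rounded weights stay in {0..m}.\<close>
    define w where "w = restrict (\<lambda>t. nat \<lceil>m * p t\<rceil>) T"
    have w: "w \<in> PiE T (\<lambda>_. {0..m})"
    proof -
      have "nat \<lceil>m * p t\<rceil> \<le> m" for t
      proof -
        have "m * p t \<le> real m" using mult_left_mono[OF p01(2), of m t] by simp
        then show ?thesis by (simp add: ceiling_le_iff nat_le_iff)
      qed
      then show ?thesis unfolding w_def by auto
    qed
    have wt: "p t \<le> real (w t) / m" "real (w t) / m \<le> p t + 1 / m" if "t \<in> T" for t
    proof -
      have wr: "real (w t) = of_int \<lceil>m * p t\<rceil>" using that p01[of t] unfolding w_def by simp
      have "m * p t \<le> real (w t)" "real (w t) \<le> m * p t + 1" unfolding wr by linarith+
      then show "p t \<le> real (w t) / m" "real (w t) / m \<le> p t + 1 / m"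
        using m by (simp_all add: field_simps)
    qed
    have "mix_dens \<sigma> \<nu> y \<le> mk w y" for y
    proof -
      have "mix_dens \<sigma> \<nu> y \<le> (\<integral>\<theta>. (\<Sum>t\<in>T. F (y - t) * indicator (r -` {t}) \<theta>) \<partial>\<nu>)"
        unfolding mix_dens_def
      proof (rule integral_mono_AE)
        show "integrable \<nu> (\<lambda>\<theta>. gauss_dens \<sigma> (y - \<theta>))" by (rule integrable_gauss_dens_mix[OF \<sigma> \<nu>])
        show "integrable \<nu> (\<lambda>\<theta>. \<Sum>t\<in>T. F (y - t) * indicator (r -` {t}) \<theta>)"
          by (intro Bochner_Integration.integrable_sum integrable_mult_right) (auto simp: integrable_indicator_iff less_top[symmetric])
        show "AE \<theta> in \<nu>. gauss_dens \<sigma> (y - \<theta>) \<le> (\<Sum>t\<in>T. F (y - t) * indicator (r -` {t}) \<theta>)"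
          using supp
        proof eventually_elim
          case (elim \<theta>)
          then have rT: "r \<theta> \<in> T" unfolding T_def by auto
          have "(\<Sum>t\<in>T. F (y - t) * indicator (r -` {t}) \<theta>) = (\<Sum>t\<in>T. if t = r \<theta> then F (y - t) else 0)"
            by (rule sum.cong) (auto simp: indicator_def)
          also have "\<dots> = F (y - r \<theta>)" using rT T by simp
          finally show ?case
            using gauss_dens_shift_le[OF \<sigma> \<epsilon> r\<epsilon>[of \<theta>], of y] by (simp add: F_def \<Lambda>_def)
        qed
      qed
      also have "\<dots> = (\<Sum>t\<in>T. F (y - t) * p t)"
        by (subst Bochner_Integration.integral_sum) (auto simp: p_def integrable_indicator_iff less_top[symmetric])
      also have "\<dots> \<le> (\<Sum>t\<in>T. F (y - t) * (real (w t) / m))"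
        using wt F0 by (intro sum_mono mult_left_mono) auto
      finally show ?thesis by (simp add: mk_def mult.commute)
    qed
    moreover have "(\<integral>y. mk w y \<partial>lborel) \<le> \<Lambda> * (1 + N / m)"
    proof -
      have "(\<integral>y. mk w y \<partial>lborel) = (\<Sum>t\<in>T. real (w t) / m * \<Lambda>)"
        unfolding mk_def using Fi F1 by (subst Bochner_Integration.integral_sum) auto
      also have "\<dots> \<le> (\<Sum>t\<in>T. (p t + 1 / m) * \<Lambda>)"
        using wt \<Lambda> by (intro sum_mono mult_right_mono) auto
      also have "\<dots> = ((\<Sum>t\<in>T. p t) + card T / m) * \<Lambda>"
        by (simp add: sum_distrib_right[symmetric] sum.distrib)
      also have "\<dots> \<le> (1 + N / m) * \<Lambda>"
        using psum T \<Lambda> by (intro mult_right_mono add_mono divide_right_mono) auto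
      finally show ?thesis by (simp add: mult.commute)
    qed
    ultimately show ?thesis using w unfolding G_def by blast
  qed
  ultimately show ?thesis unfolding \<Lambda>_def by (intro exI[of _ G]) blast
qed

section \<open>The rate of the NPMLE\<close>

text \<open>\<open>measure_of\<close> returns the given set function only if it is countably
  additive. Recognizing it as the image of the uniform law on the indices settles this and gives
  access to the rules for image measures.\<close>

lemma emp_measure_eq_distr:
  fixes \<theta> :: "nat \<Rightarrow> 'a::euclidean_space"
  assumes n: "n \<ge> 1"
  shows "emp_measure n \<theta> = distr (uniform_count_measure {..<n}) borel \<theta>"
proof -
  let ?D = "distr (uniform_count_measure {..<n}) borel \<theta>"
  have \<theta>: "\<theta> \<in> measurable (uniform_count_measure {..<n}) borel"
    by (auto simp: measurable_def space_uniform_count_measure sets_uniform_count_measure)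
  have "emeasure ?D A = ennreal ((\<Sum>i<n. indicator A (\<theta> i)) / real n)" if "A \<in> sets borel" for A
  proof -
    have "emeasure ?D A = emeasure (uniform_count_measure {..<n}) (\<theta> -` A \<inter> {..<n})"
      using that by (subst emeasure_distr[OF \<theta>]) (auto simp: space_uniform_count_measure)
    also have "\<dots> = ennreal (card (\<theta> -` A \<inter> {..<n}) / card {..<n})"
      by (rule emeasure_uniform_count_measure) auto
    also have "real (card (\<theta> -` A \<inter> {..<n})) = (\<Sum>i<n. indicator A (\<theta> i))"
      by (simp add: indicator_def sum.If_cases Collect_conj_eq vimage_def Int_commute)
    finally show ?thesis by simp
  qed
  then have "emp_measure n \<theta> = measure_of UNIV (sets borel) (emeasure ?D)"
    unfolding emp_measure_def using sets.sigma_sets_eq[of "borel :: 'a measure"]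
    by (intro measure_of_eq) auto
  also have "\<dots> = ?D"
    using measure_of_of_measure[of ?D] by simp
  finally show ?thesis .
qed

lemma emp_measure_props:
  fixes \<theta> :: "nat \<Rightarrow> 'a::euclidean_space"
  assumes n: "n \<ge> 1" and B: "\<And>i. i < n \<Longrightarrow> norm (\<theta> i) \<le> B"
  shows "borel_prob (emp_measure n \<theta>)" "AE x in emp_measure n \<theta>. norm x \<le> B"
proof -
  have \<theta>: "\<theta> \<in> measurable (uniform_count_measure {..<n}) borel"
    by (auto simp: measurable_def space_uniform_count_measure sets_uniform_count_measure)
  have "prob_space (uniform_count_measure {..<n})"
    using n by (intro prob_space_uniform_count_measure) (auto simp: lessThan_empty_iff)
  then show "borel_prob (emp_measure n \<theta>)"
    unfolding borel_prob_def emp_measure_eq_distr[OF n] by (auto intro: prob_space.prob_space_distr[OF _ \<theta>])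
  show "AE x in emp_measure n \<theta>. norm x \<le> B"
    unfolding emp_measure_eq_distr[OF n]
    by (subst AE_distr_iff[OF \<theta>]) (auto intro!: AE_I2 B simp: space_uniform_count_measure)
qed

text \<open>Two kinds of bad event are removed: some observation leaves the ball of radius
  \<open>R\<close>, or some bracket of small affinity with the truth reaches the likelihood of the
  truth. Otherwise the NPMLE is supported in the ball and lies below a bracket. That bracket
  inherits a likelihood at least that of the truth, so its affinity is large and it is close to the
  truth, while the NPMLE differs from it by at most the excess mass \<tau>.\<close>

lemma npmle_l1_event:
  fixes \<mu> :: "'a::euclidean_space measure" and \<sigma> B R \<epsilon> \<beta> \<tau> :: real and n :: nat
  defines "N \<equiv> (2 * nat \<lceil>R * DIM('a) / \<epsilon>\<rceil> + 1) ^ DIM('a)"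
  assumes \<sigma>: "\<sigma> > 0" and \<mu>: "borel_prob \<mu>" and supp: "AE \<theta> in \<mu>. norm \<theta> \<le> B"
    and n: "n \<ge> 1" and R: "R \<ge> 0" and \<epsilon>: "\<epsilon> > 0" and \<beta>: "\<beta> > 0" "\<beta> \<le> 1" and \<tau>: "0 \<le> \<tau>" "\<tau> \<le> 1"
    and \<tau>N: "exp (\<epsilon> / (2 * \<sigma>\<^sup>2)) * sqrt (1 + \<epsilon>) ^ DIM('a) * (1 + N / n) \<le> 1 + \<tau>"
  shows "\<exists>A\<in>sets (PiM {..<n} (\<lambda>_. density lborel (\<lambda>y. ennreal (mix_dens \<sigma> \<mu> y)))).
    measure (PiM {..<n} (\<lambda>_. density lborel (\<lambda>y. ennreal (mix_dens \<sigma> \<mu> y)))) A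
      \<ge> 1 - (n * (exp (B\<^sup>2 / (4 * \<sigma>\<^sup>2)) * sqrt 2 ^ DIM('a) * exp (- R\<^sup>2 / (8 * \<sigma>\<^sup>2)))
         + (real n + 1) ^ N * (1 - \<beta>) ^ n) \<and>
    (\<forall>\<omega>\<in>A. \<forall>\<nu>. npmle \<sigma> n \<omega> \<nu> \<longrightarrow> (AE \<theta> in \<nu>. norm \<theta> \<le> R) \<and>
       (\<integral>\<^sup>+y. ennreal \<bar>mix_dens \<sigma> \<mu> y - mix_dens \<sigma> \<nu> y\<bar> \<partial>lborel) \<le> ennreal (4 * sqrt (\<tau> + 2 * \<beta>) + \<tau>))"
proof -
  define f where "f = mix_dens \<sigma> \<mu>"
  have f[measurable]: "f \<in> borel_measurable borel" unfolding f_def by (rule mix_dens_measurable[OF \<sigma> \<mu>])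
  have f0: "f y > 0" for y unfolding f_def by (rule mix_dens_pos[OF \<sigma> \<mu>])
  have fi: "integrable lborel f" unfolding f_def by (rule integrable_mix_dens[OF \<sigma> \<mu>])
  have f1: "(\<integral>\<^sup>+y. ennreal (f y) \<partial>lborel) = 1" unfolding f_def by (rule nn_integral_mix_dens[OF \<sigma> \<mu>])
  have f1': "(\<integral>y. f y \<partial>lborel) = 1"
    using nn_integral_eq_integral[OF fi] f0 f1 by (simp add: less_imp_le)
  define M where "M = density lborel (\<lambda>y. ennreal (f y))"
  have [measurable_cong, simp]: "sets M = sets borel" by (simp add: M_def)
  interpret M: prob_space M
    by (rule prob_spaceI) (simp add: M_def emeasure_density f1)
  interpret P: product_prob_space "\<lambda>_::nat. M" "{..<n}" ..
  let ?P = "PiM {..<n} (\<lambda>_. M)"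
  let ?K = "exp (B\<^sup>2 / (4 * \<sigma>\<^sup>2)) * sqrt 2 ^ DIM('a) * exp (- R\<^sup>2 / (8 * \<sigma>\<^sup>2))"
  obtain G :: "('a \<Rightarrow> real) set" where G: "finite G" "card G \<le> (n + 1) ^ N"
    "\<And>g. g \<in> G \<Longrightarrow> integrable lborel g" "\<And>g y. g \<in> G \<Longrightarrow> 0 \<le> g y"
    and Gb: "\<And>\<nu>. borel_prob \<nu> \<Longrightarrow> (AE \<theta> in \<nu>. norm \<theta> \<le> R) \<Longrightarrow>
       \<exists>g\<in>G. (\<forall>y. mix_dens \<sigma> \<nu> y \<le> g y) \<and>
          (\<integral>y. g y \<partial>lborel) \<le> exp (\<epsilon> / (2 * \<sigma>\<^sup>2)) * sqrt (1 + \<epsilon>) ^ DIM('a) * (1 + N / n)"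
    using finite_upper_brackets[OF \<sigma> R \<epsilon> n, where 'a='a] unfolding N_def[symmetric] by blast
  \<comment> \<open>The brackets that must lose against the truth. The set is fixed before the
    sample is drawn, which is what permits the union bound.\<close>
  define G0 where "G0 = {g \<in> G. (\<integral>y. sqrt (g y * f y) \<partial>lborel) \<le> 1 - \<beta>}"
  have G0: "finite G0" "G0 \<subseteq> G" using G by (auto simp: G0_def)
  have gm: "g \<in> borel_measurable borel" if "g \<in> G" for g
    using borel_measurable_integrable[OF G(3)[OF that]] by simp
  define E1 where "E1 i = {\<omega> \<in> space ?P. \<omega> i \<in> {y. norm y > R}}" for i
  define E2 where "E2 g = {\<omega> \<in> space ?P. (\<Prod>i<n. f (\<omega> i)) \<le> (\<Prod>i<n. g (\<omega> i))}" for g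
  have E1s: "E1 i \<in> sets ?P" if "i < n" for i
  proof -
    have "(\<lambda>\<omega>. \<omega> i) \<in> measurable ?P M"
      using that by (intro measurable_component_singleton) auto
    from measurable_sets[OF this, of "{y. norm y > R}"] show ?thesis
      unfolding E1_def by (simp add: vimage_def Int_def conj_commute)
  qed
  have E2s: "E2 g \<in> sets ?P" if "g \<in> G" for g
  proof -
    note [measurable] = gm[OF that]
    show ?thesis unfolding E2_def by measurable
  qed
  have E1p: "measure ?P (E1 i) \<le> ?K" if "i < n" for i
  proof -
    have "emeasure ?P (E1 i) = emeasure M {y. norm y > R}"
      unfolding E1_def using that by (subst P.emeasure_PiM_Collect_single) auto
    also have "\<dots> = (\<integral>\<^sup>+y. ennreal (f y) * indicator {y. norm y > R} y \<partial>lborel)"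
      unfolding M_def by (rule emeasure_density) auto
    also have "\<dots> \<le> ennreal ?K"
      unfolding f_def by (rule nn_integral_mix_dens_tail[OF \<sigma> \<mu> supp R])
    finally show ?thesis by (simp add: P.emeasure_eq_measure)
  qed
  have E2p: "measure ?P (E2 g) \<le> (1 - \<beta>) ^ n" if g: "g \<in> G0" for g
  proof -
    have gG: "g \<in> G" using g G0 by auto
    have "(\<integral>\<^sup>+y. ennreal (sqrt (g y * f y)) \<partial>lborel) = ennreal (\<integral>y. sqrt (g y * f y) \<partial>lborel)"
      by (rule nn_integral_eq_integral, rule integrable_sqrt_mult)
        (use fi f0 G gG in \<open>auto simp: less_imp_le\<close>)
    also have "\<dots> \<le> ennreal (1 - \<beta>)" using g by (intro ennreal_leI) (simp add: G0_def)
    finally have "emeasure ?P (E2 g) \<le> ennreal ((1 - \<beta>) ^ n)"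
      unfolding E2_def M_def using \<beta>
      by (intro likelihood_ratio_bound f gm[OF gG] f0 G(4)[OF gG] f1) auto
    then show ?thesis using \<beta> by (simp add: P.emeasure_eq_measure)
  qed
  define Bad where "Bad = (\<Union>i<n. E1 i) \<union> (\<Union>g\<in>G0. E2 g)"
  have Bs: "Bad \<in> sets ?P" unfolding Bad_def using E1s E2s G0 by (intro sets.Un sets.finite_UN) auto
  have "measure ?P Bad \<le> measure ?P (\<Union>i<n. E1 i) + measure ?P (\<Union>g\<in>G0. E2 g)"
    unfolding Bad_def using E1s E2s G0 by (intro measure_subadditive sets.finite_UN) auto
  also have "\<dots> \<le> (\<Sum>i<n. measure ?P (E1 i)) + (\<Sum>g\<in>G0. measure ?P (E2 g))"
    using E1s E2s G0 by (intro add_mono measure_subadditive_finite) auto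
  also have "\<dots> \<le> (\<Sum>i<n. ?K) + (\<Sum>g\<in>G0. (1 - \<beta>) ^ n)"
    using E1p E2p by (intro add_mono sum_mono) auto
  also have "\<dots> = n * ?K + card G0 * (1 - \<beta>) ^ n" by simp
  also have "\<dots> \<le> n * ?K + (real n + 1) ^ N * (1 - \<beta>) ^ n"
  proof -
    have "card G0 \<le> (n + 1) ^ N" using card_mono[OF G(1) G0(2)] G(2) by linarith
    then have "real (card G0) \<le> real ((n + 1) ^ N)" by (rule of_nat_mono)
    then show ?thesis using \<beta> by (intro add_left_mono mult_right_mono) (auto simp: add.commute)
  qed
  finally have pBad: "measure ?P Bad \<le> n * ?K + (real n + 1) ^ N * (1 - \<beta>) ^ n" .
  define A where "A = space ?P - Bad"
  have As: "A \<in> sets ?P" unfolding A_def using Bs by auto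
  have pA: "measure ?P A \<ge> 1 - (n * ?K + (real n + 1) ^ N * (1 - \<beta>) ^ n)"
    using pBad P.prob_compl[OF Bs] by (simp add: A_def)
  have main: "(AE \<theta> in \<nu>. norm \<theta> \<le> R) \<and>
       (\<integral>\<^sup>+y. ennreal \<bar>f y - mix_dens \<sigma> \<nu> y\<bar> \<partial>lborel) \<le> ennreal (4 * sqrt (\<tau> + 2 * \<beta>) + \<tau>)"
    if \<omega>: "\<omega> \<in> A" and np: "npmle \<sigma> n \<omega> \<nu>" for \<omega> \<nu>
  proof -
    have \<nu>: "borel_prob \<nu>" using np by (simp add: npmle_def)
    have "norm (\<omega> i) \<le> R" if "i < n" for i
      using \<omega> that unfolding A_def Bad_def E1_def by (auto simp: not_less)
    from npmle_support[OF \<sigma> n this np] have supp\<nu>: "AE \<theta> in \<nu>. norm \<theta> \<le> R" by simp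
    obtain g where g: "g \<in> G" "\<And>y. mix_dens \<sigma> \<nu> y \<le> g y"
      "(\<integral>y. g y \<partial>lborel) \<le> 1 + \<tau>"
      using Gb[OF \<nu> supp\<nu>] \<tau>N by (meson order_trans)
    define q where "q = mix_dens \<sigma> \<nu>"
    have q0: "q y > 0" for y unfolding q_def by (rule mix_dens_pos[OF \<sigma> \<nu>])
    have qi: "integrable lborel q" unfolding q_def by (rule integrable_mix_dens[OF \<sigma> \<nu>])
    have q1: "(\<integral>y. q y \<partial>lborel) = 1"
      using nn_integral_eq_integral[OF qi] q0 nn_integral_mix_dens[OF \<sigma> \<nu>] by (simp add: less_imp_le q_def)
    have "(\<Sum>i<n. ln (f (\<omega> i))) \<le> (\<Sum>i<n. ln (q (\<omega> i)))"
      using np \<mu> unfolding npmle_def f_def q_def by fastforce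
    then have "ln (\<Prod>i<n. f (\<omega> i)) \<le> ln (\<Prod>i<n. q (\<omega> i))"
      using f0 q0 by (subst (1 2) ln_prod) (auto simp: less_imp_neq[symmetric])
    then have "(\<Prod>i<n. f (\<omega> i)) \<le> (\<Prod>i<n. q (\<omega> i))"
      using f0 q0 by (simp add: prod_pos)
    also have "\<dots> \<le> (\<Prod>i<n. g (\<omega> i))"
      using q0 g by (intro prod_mono) (auto simp: less_imp_le q_def)
    finally have "\<omega> \<in> E2 g" using \<omega> by (simp add: E2_def A_def)
    then have "g \<notin> G0" using \<omega> by (auto simp: A_def Bad_def)
    then have \<rho>: "(\<integral>y. sqrt (g y * f y) \<partial>lborel) \<ge> 1 - \<beta>" using g by (simp add: G0_def)
    have gi: "integrable lborel g" using G g by auto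
    have L: "(\<integral>y. \<bar>g y - f y\<bar> \<partial>lborel) \<le> 4 * sqrt (\<tau> + 2 * \<beta>)"
      by (rule l1_le_affinity) (use fi f0 f1' gi G(4)[OF g(1)] g(3) \<tau> \<beta> \<rho> in \<open>auto simp: less_imp_le\<close>)
    have di: "integrable lborel (\<lambda>y. \<bar>f y - q y\<bar>)" using fi qi by auto
    \<comment> \<open>Since q lies below g, the distance from g to q needs no absolute value and
      integrates to the mass of g minus 1.\<close>
    have "(\<integral>y. \<bar>f y - q y\<bar> \<partial>lborel) \<le> (\<integral>y. \<bar>g y - f y\<bar> + (g y - q y) \<partial>lborel)"
    proof (rule integral_mono[OF di])
      show "integrable lborel (\<lambda>y. \<bar>g y - f y\<bar> + (g y - q y))" using fi qi gi by auto
      fix y show "\<bar>f y - q y\<bar> \<le> \<bar>g y - f y\<bar> + (g y - q y)" using g(2)[of y] unfolding q_def by linarith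
    qed
    also have "\<dots> = (\<integral>y. \<bar>g y - f y\<bar> \<partial>lborel) + ((\<integral>y. g y \<partial>lborel) - 1)"
      using fi qi gi q1 by simp
    also have "\<dots> \<le> 4 * sqrt (\<tau> + 2 * \<beta>) + \<tau>" using L g(3) by linarith
    finally show ?thesis
      using supp\<nu> nn_integral_eq_integral[OF di] unfolding q_def by (simp add: ennreal_leI)
  qed
  show ?thesis
    using As pA main unfolding M_def f_def by blast
qed

section \<open>Choice of the radius, mesh and affinity level, and the resulting rates\<close>

lemma exp_le_1_plus_double:
  fixes x :: real
  assumes "0 \<le> x" "x \<le> 1"
  shows "exp x \<le> 1 + 2 * x"
proof -
  have "x\<^sup>2 \<le> x" using assms by (simp add: power2_eq_square mult_left_le)
  then show ?thesis using exp_bound[OF assms] by linarith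
qed

text \<open>With x = n, take R^2 = 24 \<sigma>^2 ln x, \<epsilon> = x^(-1/(4d)) and \<beta> =
  x^(-1/4) / 2. The grid then has at most order x^(3/8) points, so the logarithm of the number of
  brackets is of order x^(1/2), while n \<beta> is of order x^(3/4). The excess mass \<tau> and
  \<beta> are both of order at most \<epsilon>, and the passage from Hellinger to integral distance
  costs a square root, which gives the exponent -1/(8d).\<close>

lemma npmle_l1_rate:
  fixes \<sigma> B :: real
  assumes \<sigma>: "\<sigma> > 0" and B: "B > 0"
  shows "\<exists>C>0. \<exists>N0>0. \<forall>(n::nat) (\<mu> :: 'a::euclidean_space measure).
    real n \<ge> N0 \<and> borel_prob \<mu> \<and> (AE \<theta> in \<mu>. norm \<theta> \<le> B) \<longrightarrow>
    1 \<le> ln (real n) \<and> B \<le> \<sigma> * sqrt (24 * ln (real n)) \<and>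
    (\<exists>A\<in>sets (PiM {..<n} (\<lambda>_. density lborel (\<lambda>y. ennreal (mix_dens \<sigma> \<mu> y)))).
      measure (PiM {..<n} (\<lambda>_. density lborel (\<lambda>y. ennreal (mix_dens \<sigma> \<mu> y)))) A \<ge> 1 - 5 / real n \<and>
      (\<forall>\<omega>\<in>A. \<forall>\<nu>. npmle \<sigma> n \<omega> \<nu> \<longrightarrow> (AE \<theta> in \<nu>. norm \<theta> \<le> \<sigma> * sqrt (24 * ln (real n))) \<and>
       (\<integral>\<^sup>+y. ennreal \<bar>mix_dens \<sigma> \<mu> y - mix_dens \<sigma> \<nu> y\<bar> \<partial>lborel)
         \<le> ennreal (C * real n powr (- 1 / (8 * real DIM('a))))))"
proof -
  define d where "d = real DIM('a)"
  have d: "d \<ge> 1" unfolding d_def using DIM_positive[where 'a='a] by linarith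
  \<comment> \<open>The total excess mass is at most exp(a \<epsilon>) - 1: 1 / (2 \<sigma>^2) comes
    from the displacement of the atoms, d / 2 from the inflated normalization, and 1 from the
    rounding of the weights, where N / n \<le> \<epsilon>.\<close>
  define a where "a = 1 / (2 * \<sigma>\<^sup>2) + d / 2 + 1"
  have a: "a \<ge> 1" using d \<sigma> by (simp add: a_def)
  \<comment> \<open>\<open>c\<close> bounds the number of grid points per coordinate by c ln x /
    \<epsilon>; the 3 collects the off-by-one terms of the ceiling and of the centre point.\<close>
  define c where "c = 2 * d * (\<sigma> * sqrt 24) + 3"
  have c: "c > 0" using d \<sigma> by (simp add: c_def add_pos_pos)
  define A where "A = (c * (8 * d)) ^ DIM('a)"
  have A: "A > 0" using c d by (simp add: A_def)
  define K where "K = exp (B\<^sup>2 / (4 * \<sigma>\<^sup>2)) * sqrt 2 ^ DIM('a)"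
  have K: "K > 0" by (simp add: K_def)
  \<comment> \<open>A sum instead of a maximum, so that each threshold follows by linear arithmetic.
    In order they give ln x \<ge> 1, B \<le> R, absorption of the tail constant, domination of the
    bracket count together with N / n \<le> \<epsilon>, and a \<epsilon> \<le> 1/2.\<close>
  define N0 where "N0 = exp 1 + exp (B\<^sup>2 / \<sigma>\<^sup>2) + K + (32 * A + 16) powr 4 + (2 * a) powr (4 * d)"
  define C where "C = 4 * sqrt (2 * a + 1) + 2 * a"
  have C: "C > 0" using a by (simp add: C_def add_nonneg_pos)
  have N0: "N0 > 0" using K by (simp add: N0_def add_pos_nonneg)
  have main: "1 \<le> ln (real n) \<and> B \<le> \<sigma> * sqrt (24 * ln (real n)) \<and>
    (\<exists>A\<in>sets (PiM {..<n} (\<lambda>_. density lborel (\<lambda>y. ennreal (mix_dens \<sigma> \<mu> y)))).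
      measure (PiM {..<n} (\<lambda>_. density lborel (\<lambda>y. ennreal (mix_dens \<sigma> \<mu> y)))) A \<ge> 1 - 5 / real n \<and>
      (\<forall>\<omega>\<in>A. \<forall>\<nu>. npmle \<sigma> n \<omega> \<nu> \<longrightarrow> (AE \<theta> in \<nu>. norm \<theta> \<le> \<sigma> * sqrt (24 * ln (real n))) \<and>
       (\<integral>\<^sup>+y. ennreal \<bar>mix_dens \<sigma> \<mu> y - mix_dens \<sigma> \<nu> y\<bar> \<partial>lborel)
         \<le> ennreal (C * real n powr (- 1 / (8 * d)))))"
    if n: "real n \<ge> N0" and \<mu>: "borel_prob \<mu>" and supp: "AE \<theta> in \<mu>. norm \<theta> \<le> B"
    for n :: nat and \<mu> :: "'a measure"
  proof -
    define x where "x = real n"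
    have pos: "exp 1 > (0::real)" "exp (B\<^sup>2 / \<sigma>\<^sup>2) > 0" "(32 * A + 16) powr 4 \<ge> 0" "(2 * a) powr (4 * d) \<ge> 0" by simp_all
    have xe: "x \<ge> exp 1" and xB: "x \<ge> exp (B\<^sup>2 / \<sigma>\<^sup>2)" and xK: "x \<ge> K"
      and xA: "x \<ge> (32 * A + 16) powr 4" and xa: "x \<ge> (2 * a) powr (4 * d)"
      using n pos K unfolding x_def N0_def by linarith+
    have x2: "x \<ge> 2" using xe exp_ge_add_one_self[of 1] by linarith
    have x0: "x > 0" using x2 by linarith
    have lx: "1 \<le> ln x" using xe x0 by (metis ln_exp ln_le_cancel_iff exp_gt_zero)
    have lB: "B\<^sup>2 / \<sigma>\<^sup>2 \<le> ln x" using xB x0 by (metis ln_exp ln_le_cancel_iff exp_gt_zero)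
    \<comment> \<open>The factor 24 makes R^2 / (8 \<sigma>^2) equal to 3 ln x: one power of x pays
      for the union over the observations, one for the constant \<open>K\<close>, and one
      remains.\<close>
    define R where "R = \<sigma> * sqrt (24 * ln x)"
    have R0: "R > 0" using \<sigma> lx by (simp add: R_def)
    have R2: "R\<^sup>2 = 24 * \<sigma>\<^sup>2 * ln x" using lx by (simp add: R_def power_mult_distrib)
    have RB: "B \<le> R"
    proof -
      have "B\<^sup>2 \<le> \<sigma>\<^sup>2 * ln x" using lB \<sigma> by (simp add: field_simps)
      also have "\<dots> \<le> R\<^sup>2" unfolding R2 using lx \<sigma> by simp
      finally show ?thesis using R0 by (meson less_imp_le power2_le_imp_le)
    qed
    \<comment> \<open>In d dimensions this mesh makes the number of grid points x^(1/4) up to a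
      power of ln x.\<close>
    define \<epsilon> where "\<epsilon> = x powr (- 1 / (4 * d))"
    have \<epsilon>0: "\<epsilon> > 0" using x0 by (simp add: \<epsilon>_def)
    have \<epsilon>1: "\<epsilon> \<le> 1"
      using powr_mono[of "- 1 / (4 * d)" 0 x] x2 d unfolding \<epsilon>_def by simp
    have a\<epsilon>: "a * \<epsilon> \<le> 1 / 2"
    proof -
      have "2 * a = ((2 * a) powr (4 * d)) powr (1 / (4 * d))" using a d by (simp add: powr_powr)
      also have "\<dots> \<le> x powr (1 / (4 * d))" using xa d by (intro powr_mono2) auto
      finally have "2 * a * x powr (- 1 / (4 * d)) \<le> x powr (1 / (4 * d)) * x powr (- 1 / (4 * d))"
        by (rule mult_right_mono) simp
      also have "\<dots> = 1" using x0 by (simp add: powr_add[symmetric])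
      finally show ?thesis by (simp add: \<epsilon>_def)
    qed
    have q4: "x powr (- 1 / 4) \<le> \<epsilon>"
      unfolding \<epsilon>_def using x2 d by (intro powr_mono) (auto simp: field_simps)
    define N where "N = (2 * nat \<lceil>R * DIM('a) / \<epsilon>\<rceil> + 1) ^ DIM('a)"
    have N: "real N \<le> A * x powr (3 / 8)"
    proof -
      have "real (2 * nat \<lceil>R * DIM('a) / \<epsilon>\<rceil> + 1) \<le> 2 * (R * d / \<epsilon>) + 3"
      proof -
        have "R * DIM('a) / \<epsilon> \<ge> 0" using R0 \<epsilon>0 by simp
        then have "real (nat \<lceil>R * DIM('a) / \<epsilon>\<rceil>) \<le> R * d / \<epsilon> + 1" unfolding d_def by linarith
        then show ?thesis by simp
      qed
      also have "\<dots> \<le> c * (ln x / \<epsilon>)"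
      proof -
        have s: "sqrt (24 * ln x) \<le> sqrt 24 * ln x"
        proof -
          have "ln x * 1 \<le> ln x * ln x" using lx by (intro mult_left_mono) auto
          then have "sqrt (ln x) \<le> sqrt (ln x * ln x)" by (intro real_sqrt_le_mono) simp
          then have "sqrt (ln x) \<le> ln x" using lx by simp
          then show ?thesis by (simp add: real_sqrt_mult mult_left_mono)
        qed
        have "2 * (R * d / \<epsilon>) \<le> 2 * d * (\<sigma> * (sqrt 24 * ln x)) / \<epsilon>"
          using s \<sigma> d \<epsilon>0 unfolding R_def by (simp add: divide_right_mono mult_left_mono mult.commute)
        moreover have "1 \<le> ln x / \<epsilon>" using lx \<epsilon>0 \<epsilon>1 by (simp add: pos_le_divide_eq)
        ultimately show ?thesis unfolding c_def by (simp add: distrib_right mult.assoc add_divide_distrib)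
      qed
      also have "\<dots> \<le> c * ((8 * d) * x powr (3 / (8 * d)))"
      proof -
        \<comment> \<open>The logarithm is traded for a power so small that after raising to the
          dimension it costs only x^(1/8), which turns x^(1/4) into x^(3/8).\<close>
        have "ln x \<le> x powr (1 / (8 * d)) / (1 / (8 * d))"
          using x2 d by (intro ln_powr_bound) auto
        then have "ln x / \<epsilon> \<le> (8 * d) * x powr (1 / (8 * d)) / \<epsilon>"
          using \<epsilon>0 by (simp add: divide_right_mono mult.commute)
        also have "\<dots> = (8 * d) * (x powr (1 / (8 * d)) * x powr (1 / (4 * d)))"
        proof -
          have "x powr (1 / (4 * d)) * \<epsilon> = 1" unfolding \<epsilon>_def using x0 by (simp add: powr_add[symmetric])
          then have "1 / \<epsilon> = x powr (1 / (4 * d))" using \<epsilon>0 by (simp add: divide_eq_eq)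
          then show ?thesis by (metis mult.assoc mult.right_neutral times_divide_eq_right)
        qed
        also have "x powr (1 / (8 * d)) * x powr (1 / (4 * d)) = x powr (3 / (8 * d))"
        proof -
          have "1 / (8 * d) + 1 / (4 * d) = 3 / (8 * d)" using d by (simp add: field_simps)
          then show ?thesis by (simp only: powr_add[symmetric])
        qed
        finally show ?thesis using c by (intro mult_left_mono) auto
      qed
      finally have "real (2 * nat \<lceil>R * DIM('a) / \<epsilon>\<rceil> + 1) \<le> (c * (8 * d)) * x powr (3 / (8 * d))"
        by (simp add: mult.assoc)
      then have "real (2 * nat \<lceil>R * DIM('a) / \<epsilon>\<rceil> + 1) ^ DIM('a) \<le> ((c * (8 * d)) * x powr (3 / (8 * d))) ^ DIM('a)"
        by (rule power_mono) simp
      also have "\<dots> = A * (x powr (3 / (8 * d))) ^ DIM('a)" by (simp add: A_def power_mult_distrib)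
      also have "(x powr (3 / (8 * d))) ^ DIM('a) = x powr (3 / 8)"
        using x0 d by (simp add: powr_realpow[symmetric] powr_powr d_def[symmetric])
      finally show ?thesis by (simp add: N_def)
    qed
    have x14: "x powr (1 / 4) \<ge> 32 * A + 16"
    proof -
      have "32 * A + 16 = ((32 * A + 16) powr 4) powr (1 / 4)"
        unfolding powr_powr using A by simp
      also have "\<dots> \<le> x powr (1 / 4)" using xA by (intro powr_mono2) auto
      finally show ?thesis .
    qed
    have Nx: "real N / x \<le> \<epsilon>"
    proof -
      have "A \<le> x powr (1 / 4)" using x14 A by linarith
      also have "\<dots> \<le> x powr (3 / 8)" using x2 by (intro powr_mono) auto
      finally have "A * x powr (3 / 8) \<le> x powr (3 / 8) * x powr (3 / 8)"
        by (rule mult_right_mono) simp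
      also have "\<dots> = x powr (- 1 / 4) * x" 
        using x0 powr_add[of x "-1/4" 1] by (simp add: powr_add[symmetric])
      finally have "real N \<le> x powr (- 1 / 4) * x" using N by linarith
      then have "real N / x \<le> x powr (- 1 / 4)" using x0 by (simp add: pos_divide_le_eq)
      then show ?thesis using q4 by linarith
    qed
    define \<tau> where "\<tau> = 2 * (a * \<epsilon>)"
    have \<tau>: "0 \<le> \<tau>" "\<tau> \<le> 1" using a \<epsilon>0 a\<epsilon> by (auto simp: \<tau>_def)
    have \<tau>N: "exp (\<epsilon> / (2 * \<sigma>\<^sup>2)) * sqrt (1 + \<epsilon>) ^ DIM('a) * (1 + real N / real n) \<le> 1 + \<tau>"
    proof -
      have "sqrt (1 + \<epsilon>) \<le> exp (\<epsilon> / 2)"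
      proof (rule real_le_lsqrt)
        show "1 + \<epsilon> \<le> (exp (\<epsilon> / 2))\<^sup>2"
          using exp_ge_add_one_self[of \<epsilon>] by (simp add: exp_double[symmetric])
      qed simp
      then have "sqrt (1 + \<epsilon>) ^ DIM('a) \<le> exp (\<epsilon> / 2) ^ DIM('a)" using \<epsilon>0 by (intro power_mono) auto
      also have "\<dots> = exp (d / 2 * \<epsilon>)" by (simp add: exp_of_nat_mult[symmetric] d_def)
      finally have 1: "sqrt (1 + \<epsilon>) ^ DIM('a) \<le> exp (d / 2 * \<epsilon>)" .
      have 2: "1 + real N / real n \<le> exp \<epsilon>"
        using Nx exp_ge_add_one_self[of \<epsilon>] unfolding x_def by linarith
      have "exp (\<epsilon> / (2 * \<sigma>\<^sup>2)) * sqrt (1 + \<epsilon>) ^ DIM('a) * (1 + real N / real n)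
        \<le> exp (\<epsilon> / (2 * \<sigma>\<^sup>2)) * exp (d / 2 * \<epsilon>) * exp \<epsilon>"
        using 1 2 \<epsilon>0 by (intro mult_mono) auto
      also have "\<dots> = exp (a * \<epsilon>)" by (simp add: exp_add[symmetric] a_def algebra_simps)
      also have "\<dots> \<le> 1 + \<tau>" unfolding \<tau>_def
        using a \<epsilon>0 a\<epsilon> by (intro exp_le_1_plus_double) auto
      finally show ?thesis .
    qed
    \<comment> \<open>Small enough not to spoil the rate, as 2 \<beta> \<le> \<epsilon>, yet large
      enough that x \<beta> exceeds the log-cardinality of the brackets.\<close>
    define \<beta> where "\<beta> = x powr (- 1 / 4) / 2"
    have \<beta>: "\<beta> > 0" "\<beta> \<le> 1" using x0 q4 \<epsilon>1 by (auto simp: \<beta>_def)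
    have n1: "n \<ge> 1" using x2 by (simp add: x_def)
    have tail: "real n * (exp (B\<^sup>2 / (4 * \<sigma>\<^sup>2)) * sqrt 2 ^ DIM('a) * exp (- R\<^sup>2 / (8 * \<sigma>\<^sup>2))) \<le> 1 / x"
    proof -
      have "- R\<^sup>2 / (8 * \<sigma>\<^sup>2) = - 3 * ln x" using \<sigma> by (simp add: R2)
      then have "exp (- R\<^sup>2 / (8 * \<sigma>\<^sup>2)) = x powr (- 3)" using x0 by (simp add: powr_def)
      then have "real n * (exp (B\<^sup>2 / (4 * \<sigma>\<^sup>2)) * sqrt 2 ^ DIM('a) * exp (- R\<^sup>2 / (8 * \<sigma>\<^sup>2))) = x * (K * x powr (- 3))"
        by (simp add: K_def x_def)
      also have "\<dots> \<le> x * (x * x powr (- 3))" using xK x0 by (intro mult_left_mono mult_right_mono) auto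
      also have "\<dots> = 1 / x" using x0 by (simp add: powr_minus powr_numeral field_simps power3_eq_cube)
      finally show ?thesis .
    qed
    have union: "(real n + 1) ^ N * (1 - \<beta>) ^ n \<le> 1 / x"
    proof -
      have l1: "ln (x + 1) \<le> 16 * x powr (1 / 8)"
      proof -
        have "ln (x + 1) \<le> ln (x * x)"
        proof -
          have "x * 2 \<le> x * x" using x2 by (intro mult_left_mono) auto
          then have "x + 1 \<le> x * x" using x2 by linarith
          then show ?thesis using x2 by (subst ln_le_cancel_iff) (auto simp: add_pos_pos)
        qed
        also have "\<dots> = 2 * ln x" using x0 by (simp add: ln_mult)
        also have "ln x \<le> x powr (1 / 8) / (1 / 8)" using x2 by (intro ln_powr_bound) auto
        finally show ?thesis by simp
      qed
      have l2: "ln x \<le> 8 * x powr (1 / 2)"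
      proof -
        have "ln x \<le> x powr (1 / 8) / (1 / 8)" using x2 by (intro ln_powr_bound) auto
        also have "\<dots> \<le> 8 * x powr (1 / 2)" using x2 by (simp add: powr_mono)
        finally show ?thesis .
      qed
      \<comment> \<open>Exponents 3/8 and 1/8 add up to 1/2. One spare factor x^(1/4) lifts this to
        the order of x \<beta>, with ln x included so that a bound 1 / x remains.\<close>
      have "real N * ln (x + 1) \<le> (A * x powr (3 / 8)) * (16 * x powr (1 / 8))"
        using N l1 A x2 by (intro mult_mono) auto
      also have "\<dots> = 16 * A * x powr (1 / 2)" by (simp add: powr_add[symmetric])
      finally have "real N * ln (x + 1) + ln x \<le> (16 * A + 8) * x powr (1 / 2)"
        using l2 by (simp add: distrib_right)
      also have "\<dots> \<le> (x powr (1 / 4) / 2) * x powr (1 / 2)"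
        using x14 by (intro mult_right_mono) auto
      also have "\<dots> = x * \<beta>"
        using x0 powr_add[of x 1 "-1/4"] by (simp add: \<beta>_def powr_add[symmetric])
      finally have e: "real N * ln (x + 1) + - (x * \<beta>) \<le> - ln x" by simp
      have "(real n + 1) ^ N = exp (real N * ln (x + 1))"
        using x0 by (simp add: exp_of_nat_mult x_def)
      moreover have "(1 - \<beta>) ^ n \<le> exp (- (x * \<beta>))"
      proof -
        have "(1 - \<beta>) ^ n \<le> exp (- \<beta>) ^ n"
          using \<beta> exp_ge_add_one_self[of "- \<beta>"] by (intro power_mono) auto
        then show ?thesis by (simp add: exp_of_nat_mult[symmetric] x_def)
      qed
      ultimately have "(real n + 1) ^ N * (1 - \<beta>) ^ n \<le> exp (real N * ln (x + 1)) * exp (- (x * \<beta>))"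
        by (simp add: mult_left_mono)
      also have "\<dots> = exp (real N * ln (x + 1) + - (x * \<beta>))" by (simp only: exp_add)
      also have "\<dots> \<le> exp (- ln x)" using e by simp
      also have "\<dots> = 1 / x" using x0 by (simp add: exp_minus divide_inverse)
      finally show ?thesis .
    qed
    have rate: "4 * sqrt (\<tau> + 2 * \<beta>) + \<tau> \<le> C * x powr (- 1 / (8 * d))"
    proof -
      have s\<epsilon>: "sqrt \<epsilon> = x powr (- 1 / (8 * d))"
        unfolding \<epsilon>_def using x0 by (simp add: powr_half_sqrt[symmetric] powr_powr)
      have "\<tau> + 2 * \<beta> \<le> (2 * a + 1) * \<epsilon>" using q4 by (simp add: \<tau>_def \<beta>_def algebra_simps)
      then have "sqrt (\<tau> + 2 * \<beta>) \<le> sqrt (2 * a + 1) * sqrt \<epsilon>"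
        by (simp add: real_sqrt_mult[symmetric])
      moreover have "\<epsilon> \<le> sqrt \<epsilon>"
      proof -
        have "\<epsilon> * \<epsilon> \<le> \<epsilon>" using \<epsilon>0 \<epsilon>1 by (simp add: mult_left_le)
        then have "sqrt (\<epsilon> * \<epsilon>) \<le> sqrt \<epsilon>" by (rule real_sqrt_le_mono)
        then show ?thesis using \<epsilon>0 by simp
      qed
      then have "\<tau> \<le> 2 * a * sqrt \<epsilon>" using a by (simp add: \<tau>_def)
      ultimately show ?thesis unfolding C_def s\<epsilon>[symmetric] by (simp add: distrib_right)
    qed
    obtain E where E: "E \<in> sets (PiM {..<n} (\<lambda>_. density lborel (\<lambda>y. ennreal (mix_dens \<sigma> \<mu> y))))"
      "measure (PiM {..<n} (\<lambda>_. density lborel (\<lambda>y. ennreal (mix_dens \<sigma> \<mu> y)))) E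
      \<ge> 1 - (n * (exp (B\<^sup>2 / (4 * \<sigma>\<^sup>2)) * sqrt 2 ^ DIM('a) * exp (- R\<^sup>2 / (8 * \<sigma>\<^sup>2)))
         + (real n + 1) ^ N * (1 - \<beta>) ^ n)"
      and E': "\<And>\<omega> \<nu>. \<omega> \<in> E \<Longrightarrow> npmle \<sigma> n \<omega> \<nu> \<Longrightarrow> (AE \<theta> in \<nu>. norm \<theta> \<le> R) \<and>
       (\<integral>\<^sup>+y. ennreal \<bar>mix_dens \<sigma> \<mu> y - mix_dens \<sigma> \<nu> y\<bar> \<partial>lborel) \<le> ennreal (4 * sqrt (\<tau> + 2 * \<beta>) + \<tau>)"
      using npmle_l1_event[OF \<sigma> \<mu> supp n1 less_imp_le[OF R0] \<epsilon>0 \<beta> \<tau> \<tau>N[unfolded N_def]]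
      unfolding N_def[symmetric] by blast
    \<comment> \<open>The tail and the union bound each contribute at most 1 / x, which fits within
      the allowance 5 / n.\<close>
    have "1 - 5 / real n \<le> 1 - (1 / x + 1 / x)" using x0 by (simp add: x_def divide_right_mono)
    then have p: "measure (PiM {..<n} (\<lambda>_. density lborel (\<lambda>y. ennreal (mix_dens \<sigma> \<mu> y)))) E \<ge> 1 - 5 / real n"
      using E(2) tail union by linarith
    have "ennreal (4 * sqrt (\<tau> + 2 * \<beta>) + \<tau>) \<le> ennreal (C * real n powr (- 1 / (8 * d)))"
      using rate by (intro ennreal_leI) (simp add: x_def)
    then show ?thesis
      using lx RB E(1) p E' unfolding R_def x_def by (meson order_trans)
  qed
  show ?thesis
    using C N0 main unfolding d_def by blast
qed

text \<open>The bandwidth h = (\<kappa> ln x)^(-1/2) is as small as the polynomial rate x^(-c)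
  permits: \<kappa> is chosen so that the exponential cost of deconvolution is at most x^(c/2). The
  other half of the rate beats every power of ln x coming from the radius and from 1 / h, and the
  smoothing error \<open>h powr k\<close> is what determines the final rate.\<close>

lemma wasserstein_pow_log_rate:
  fixes k \<sigma> C1 :: real
  assumes k: "k > 0" and \<sigma>: "\<sigma> > 0" and C1: "C1 > 0"
  shows "\<exists>C>0. \<forall>(x::real) (\<mu> :: 'a::euclidean_space measure) \<nu>.
    0 < x \<and> 1 \<le> ln x \<and> borel_prob \<mu> \<and> borel_prob \<nu> \<and>
    (AE \<theta> in \<mu>. norm \<theta> \<le> \<sigma> * sqrt (24 * ln x)) \<and> (AE \<theta> in \<nu>. norm \<theta> \<le> \<sigma> * sqrt (24 * ln x)) \<and>
    (\<integral>\<^sup>+y. ennreal \<bar>mix_dens \<sigma> \<mu> y - mix_dens \<sigma> \<nu> y\<bar> \<partial>lborel)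
         \<le> ennreal (C1 * x powr (- 1 / (8 * real DIM('a)))) \<longrightarrow>
    wasserstein_pow k \<mu> \<nu> \<le> ennreal (C * (1 / ln x) powr (k / 2))"
proof -
  define d where "d = real DIM('a)"
  have d: "d \<ge> 1" unfolding d_def using DIM_positive[where 'a='a] by linarith
  obtain P :: nat and I J :: real where I: "I > 0" and J: "J \<ge> 0"
    and ker: "\<forall>h>0. \<exists>(K :: 'a \<Rightarrow> real) \<psi>.
     K \<in> borel_measurable borel \<and> \<psi> \<in> borel_measurable borel \<and>
     (\<forall>x. 0 \<le> K x \<and> K x \<le> (1 / (h * I)) ^ DIM('a)) \<and>
     (\<integral>\<^sup>+x. ennreal (K x) \<partial>lborel) = 1 \<and>
     (\<integral>\<^sup>+x. ennreal (norm x powr k * K x) \<partial>lborel) \<le> ennreal (J * h powr k) \<and>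
     (\<forall>x. \<bar>\<psi> x\<bar> \<le> (exp ((\<sigma> * real P / h)\<^sup>2 / 2) / (h * I)) ^ DIM('a)) \<and>
     (\<forall>x \<theta>. (\<integral>y. gauss_dens \<sigma> (y - \<theta>) * \<psi> (x - y) \<partial>lborel) = K (x - \<theta>))"
    using deconvolution_kernel[OF less_imp_le[OF k] \<sigma>, where 'a='a]
    by (elim exE conjE) (rule that; assumption)
  define c where "c = 1 / (8 * d)"
  have c: "c > 0" using d by (simp add: c_def)
  \<comment> \<open>The added 1 keeps the denominator positive even for \<open>P = 0\<close>, which
    the kernel lemma does not exclude.\<close>
  define \<kappa> where "\<kappa> = c / (d * (\<sigma> * P)\<^sup>2 + 1)"
  have \<kappa>: "\<kappa> > 0" using c d unfolding \<kappa>_def by (intro divide_pos_pos add_nonneg_pos) auto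
  have \<kappa>c: "d * (\<sigma> * P)\<^sup>2 * \<kappa> \<le> c"
  proof -
    have "d * (\<sigma> * P)\<^sup>2 * \<kappa> \<le> (d * (\<sigma> * P)\<^sup>2 + 1) * \<kappa>" using \<kappa> by (intro mult_right_mono) auto
    also have "\<dots> = c" using d unfolding \<kappa>_def by (simp add: add_nonneg_pos less_imp_neq[symmetric])
    finally show ?thesis .
  qed
  \<comment> \<open>Chosen so that a (k + d) = c / 2: then ln x \<le> x^a / a bounds (ln x)^(k + d)
    by a constant times x^(c/2), the half of the rate left over by the deconvolution.\<close>
  define a where "a = c / (2 * (k + d))"
  have a: "a > 0" using c k d by (simp add: a_def)
  define s where "s = \<sigma> * sqrt 24"
  have s: "s > 0" using \<sigma> by (simp add: s_def)
  define D where "D = (2 * s) powr k * (4 * s) powr d * (\<kappa> powr (d / 2) / I powr d) * C1"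
  have D: "D > 0" using s \<kappa> I C1 by (simp add: D_def)
  define C where "C = 3 * 2 powr k * J * \<kappa> powr (- k / 2) + D / a powr (k + d)"
  have C: "C > 0" using D a J by (simp add: C_def add_nonneg_pos)
  have "wasserstein_pow k \<mu> \<nu> \<le> ennreal (C * (1 / ln x) powr (k / 2))"
    if x0: "0 < x" and l: "1 \<le> ln x" and \<mu>: "borel_prob \<mu>" and \<nu>: "borel_prob \<nu>"
      and supp: "AE \<theta> in \<mu>. norm \<theta> \<le> \<sigma> * sqrt (24 * ln x)" "AE \<theta> in \<nu>. norm \<theta> \<le> \<sigma> * sqrt (24 * ln x)"
      and L: "(\<integral>\<^sup>+y. ennreal \<bar>mix_dens \<sigma> \<mu> y - mix_dens \<sigma> \<nu> y\<bar> \<partial>lborel) \<le> ennreal (C1 * x powr (- c))"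
    for x :: real and \<mu> \<nu> :: "'a measure"
  proof -
    define l where "l = ln x"
    have l1: "l \<ge> 1" using l by (simp add: l_def)
    then have l0: "l > 0" by simp
    have x1: "x > 1" using l0 x0 by (simp add: l_def)
    define R where "R = s * l powr (1 / 2)"
    have R: "R > 0" using s l0 by (simp add: R_def)
    have Req: "\<sigma> * sqrt (24 * ln x) = R"
      using l0 by (simp add: R_def s_def l_def real_sqrt_mult powr_half_sqrt)
    \<comment> \<open>Thus 1 / h^2 = \<kappa> l, so that the deconvolution factor, exponential in 1
      / h^2, is a power of x.\<close>
    define h where "h = (\<kappa> * l) powr (- 1 / 2)"
    have h: "h > 0" using \<kappa> l0 by (simp add: h_def)
    obtain K \<psi> :: "'a \<Rightarrow> real" where K[measurable]: "K \<in> borel_measurable borel"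
      and \<psi>[measurable]: "\<psi> \<in> borel_measurable borel"
      and Kb': "\<forall>x. 0 \<le> K x \<and> K x \<le> (1 / (h * I)) ^ DIM('a)"
      and K1: "(\<integral>\<^sup>+x. ennreal (K x) \<partial>lborel) = 1"
      and Km: "(\<integral>\<^sup>+x. ennreal (norm x powr k * K x) \<partial>lborel) \<le> ennreal (J * h powr k)"
      and \<psi>b': "\<forall>x. \<bar>\<psi> x\<bar> \<le> (exp ((\<sigma> * real P / h)\<^sup>2 / 2) / (h * I)) ^ DIM('a)"
      and conv': "\<forall>x \<theta>. (\<integral>y. gauss_dens \<sigma> (y - \<theta>) * \<psi> (x - y) \<partial>lborel) = K (x - \<theta>)"
      using ker[rule_format, OF h] by (elim exE conjE) (rule that; assumption)
    have K0: "0 \<le> K x" and Kb: "K x \<le> (1 / (h * I)) ^ DIM('a)" for x using Kb' by auto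
    note \<psi>b = spec[OF \<psi>b'] and conv = conv'[rule_format]
    define \<Psi> where "\<Psi> = (exp ((\<sigma> * real P / h)\<^sup>2 / 2) / (h * I)) ^ DIM('a)"
    have \<Psi>: "\<Psi> \<le> x powr (c / 2) * ((\<kappa> * l) powr (d / 2) / I powr d)"
    proof -
      have h2: "1 / h\<^sup>2 = \<kappa> * l"
      proof -
        have "h\<^sup>2 = (\<kappa> * l) powr (- 1)"
          using h unfolding h_def power2_eq_square by (simp only: powr_add[symmetric]) simp
        then show ?thesis using \<kappa> l0 by (simp add: powr_minus_divide)
      qed
      have "(\<sigma> * real P / h)\<^sup>2 / 2 = (\<sigma> * P)\<^sup>2 / 2 * (1 / h\<^sup>2)" by (simp add: power_divide)
      also have "\<dots> = (\<sigma> * P)\<^sup>2 * \<kappa> * l / 2" unfolding h2 by simp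
      finally have e: "(\<sigma> * real P / h)\<^sup>2 / 2 = (\<sigma> * P)\<^sup>2 * \<kappa> * l / 2" .
      have "exp ((\<sigma> * real P / h)\<^sup>2 / 2) ^ DIM('a) = exp (d * (\<sigma> * P)\<^sup>2 * \<kappa> / 2 * l)"
        unfolding e exp_of_nat_mult[symmetric] d_def by (simp add: mult_ac)
      also have "\<dots> \<le> exp (c / 2 * l)" using \<kappa>c l0 by simp
      also have "\<dots> = x powr (c / 2)" using x1 by (simp add: powr_def l_def)
      finally have 1: "exp ((\<sigma> * real P / h)\<^sup>2 / 2) ^ DIM('a) \<le> x powr (c / 2)" .
      have 2: "(h * I) ^ DIM('a) = (\<kappa> * l) powr (- (d / 2)) * I powr d"
      proof -
        have "(h * I) ^ DIM('a) = (h * I) powr d" using h I by (simp add: d_def powr_realpow)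
        also have "\<dots> = h powr d * I powr d" by (simp add: powr_mult)
        also have "h powr d = (\<kappa> * l) powr (- (d / 2))" unfolding h_def powr_powr by simp
        finally show ?thesis .
      qed
      have "\<Psi> = exp ((\<sigma> * real P / h)\<^sup>2 / 2) ^ DIM('a) / (h * I) ^ DIM('a)"
        by (simp add: \<Psi>_def power_divide)
      also have "\<dots> \<le> x powr (c / 2) / (h * I) ^ DIM('a)"
        using 1 h I by (intro divide_right_mono) auto
      also have "\<dots> = x powr (c / 2) * ((\<kappa> * l) powr (d / 2) / I powr d)"
        unfolding 2 by (simp add: powr_minus field_simps)
      finally show ?thesis .
    qed
    let ?L = "C1 * x powr (- c)"
    have L0: "?L \<ge> 0" using C1 by simp
    have W: "wasserstein_pow k \<mu> \<nu> \<le> ennreal (2 * (2 powr k * (J * h powr k)) +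
       (2 * R) powr k * ((4 * R) ^ DIM('a) * (\<Psi> * ?L) + J * h powr k / R powr k))"
    proof (rule wasserstein_pow_smoothing[OF \<mu> \<nu> R k _ _ K K0 Kb K1 Km])
      show "0 \<le> J * h powr k" using J by simp
      show "\<bar>(\<integral>\<theta>. K (z - \<theta>) \<partial>\<mu>) - (\<integral>\<theta>. K (z - \<theta>) \<partial>\<nu>)\<bar> \<le> \<Psi> * ?L" for z
        unfolding \<Psi>_def by (rule kernel_mixture_diff_le[OF \<sigma> \<mu> \<nu> \<psi> \<psi>b conv L L0])
    qed (use supp in \<open>auto simp: Req\<close>)
    have hk: "h powr k = \<kappa> powr (- k / 2) * l powr (- k / 2)"
    proof -
      have "h powr k = (\<kappa> * l) powr (- k / 2)" unfolding h_def powr_powr by simp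
      then show ?thesis by (simp add: powr_mult)
    qed
    \<comment> \<open>The maximal cost at radius R cancels the R in the tail mass, so the growing
      radius leaves no trace and both terms are multiples of \<open>h powr k\<close>.\<close>
    have B1: "2 * (2 powr k * (J * h powr k)) + (2 * R) powr k * (J * h powr k / R powr k)
        = (3 * 2 powr k * J * \<kappa> powr (- k / 2)) * l powr (- k / 2)"
    proof -
      have "(2 * R) powr k * (J * h powr k / R powr k) = 2 powr k * (J * h powr k)"
        using R by (simp add: powr_mult)
      then show ?thesis by (simp add: hk)
    qed
    have B2: "(2 * R) powr k * ((4 * R) ^ DIM('a) * (\<Psi> * ?L)) \<le> (D / a powr (k + d)) * l powr (- k / 2)"
    proof -
      have r1: "(2 * R) powr k = (2 * s) powr k * l powr (k / 2)"
        using powr_mult[of "2 * s" "l powr (1 / 2)" k] by (simp add: R_def powr_powr mult.assoc)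
      have r2: "(4 * R) ^ DIM('a) = (4 * s) powr d * l powr (d / 2)"
      proof -
        have "(4 * R) ^ DIM('a) = (4 * R) powr d" using R by (simp add: d_def powr_realpow)
        then show ?thesis
          using powr_mult[of "4 * s" "l powr (1 / 2)" d] by (simp add: R_def powr_powr mult.assoc)
      qed
      have "\<Psi> * ?L \<le> x powr (c / 2) * ((\<kappa> * l) powr (d / 2) / I powr d) * ?L"
        using \<Psi> L0 by (rule mult_right_mono)
      also have "\<dots> = (x powr (c / 2) * x powr (- c)) * (l powr (d / 2) * (\<kappa> powr (d / 2) / I powr d * C1))"
        by (simp add: powr_mult)
      also have "x powr (c / 2) * x powr (- c) = x powr (- (c / 2))"
        by (simp add: powr_add[symmetric])
      finally have "(2 * R) powr k * ((4 * R) ^ DIM('a) * (\<Psi> * ?L)) \<le>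
         (2 * R) powr k * ((4 * R) ^ DIM('a) * (x powr (- (c / 2)) * (l powr (d / 2) * (\<kappa> powr (d / 2) / I powr d * C1))))"
        using R by (intro mult_left_mono) auto
      also have "\<dots> = D * ((l powr (k / 2) * (l powr (d / 2) * l powr (d / 2))) * x powr (- (c / 2)))"
        unfolding r1 r2 D_def by simp
      \<comment> \<open>The three powers come from the maximal cost, the volume of the cube and the
        prefactor of \<psi>. Splitting off the target l^(-k/2) leaves l^(k + d), to be absorbed by
        the remaining power of x.\<close>
      also have "l powr (k / 2) * (l powr (d / 2) * l powr (d / 2)) = l powr (k + d) * l powr (- k / 2)"
        unfolding powr_add[symmetric] by simp
      finally have *: "(2 * R) powr k * ((4 * R) ^ DIM('a) * (\<Psi> * ?L)) \<le>
        D * (l powr (k + d) * l powr (- k / 2) * x powr (- (c / 2)))" .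
      have "l \<le> x powr a / a" unfolding l_def using x1 a by (intro ln_powr_bound) auto
      then have "l powr (k + d) \<le> (x powr a / a) powr (k + d)" using l0 k d by (intro powr_mono2) auto
      also have "\<dots> = (x powr a) powr (k + d) / a powr (k + d)"
        using a by (simp add: powr_divide)
      also have "(x powr a) powr (k + d) = x powr (c / 2)"
      proof -
        have "a * (k + d) = c / 2" using k d unfolding a_def by (simp add: divide_eq_eq algebra_simps)
        then show ?thesis by (simp only: powr_powr)
      qed
      finally have lk: "l powr (k + d) \<le> x powr (c / 2) / a powr (k + d)" .
      have "l powr (k + d) * l powr (- k / 2) * x powr (- (c / 2)) \<le>
         x powr (c / 2) / a powr (k + d) * l powr (- k / 2) * x powr (- (c / 2))"
        using lk by (intro mult_right_mono) auto
      also have "\<dots> = (x powr (c / 2) * x powr (- (c / 2))) * (l powr (- k / 2) / a powr (k + d))" by simp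
      also have "x powr (c / 2) * x powr (- (c / 2)) = 1" using x1 by (simp add: powr_add[symmetric])
      finally have "D * (l powr (k + d) * l powr (- k / 2) * x powr (- (c / 2))) \<le> D * (l powr (- k / 2) / a powr (k + d))"
        using D by (intro mult_left_mono) auto
      then show ?thesis using * by simp
    qed
    have "2 * (2 powr k * (J * h powr k)) + (2 * R) powr k * ((4 * R) ^ DIM('a) * (\<Psi> * ?L) + J * h powr k / R powr k)
       \<le> C * l powr (- k / 2)"
      using B1 B2 unfolding C_def distrib_left distrib_right by linarith
    also have "l powr (- k / 2) = (1 / ln x) powr (k / 2)"
      using l0 by (simp add: l_def powr_divide powr_minus_divide)
    finally show ?thesis using W by (meson ennreal_leI order_trans)
  qed
  then show ?thesis using C unfolding c_def d_def by (intro exI[of _ C]) auto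
qed

theorem theorem5:
  fixes \<sigma> B :: real
  assumes "\<sigma> > 0" and "B > 0"
  shows "\<exists>C0>0. \<forall>s k :: real. s > k \<and> k \<ge> 1 \<longrightarrow>
    (\<exists>C>0. \<forall>(n::nat) (\<theta>::nat \<Rightarrow> 'a::euclidean_space).
       n \<ge> 1 \<and> (\<forall>i<n. norm (\<theta> i) \<le> B) \<and> real n \<ge> C0 * (ln (real n)) ^ (DIM('a) + 1) \<longrightarrow>
       (\<exists>A \<in> sets (sample_space \<sigma> n \<theta>).
          measure (sample_space \<sigma> n \<theta>) A \<ge> 1 - 5 / real n \<and>
          (\<forall>\<omega>\<in>A. \<forall>\<nu>. npmle \<sigma> n \<omega> \<nu> \<longrightarrow>
             wasserstein_pow k (emp_measure n \<theta>) \<nu> \<le> ennreal (C * (1 / ln (real n)) powr (k / 2)))))"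
proof -
  note \<sigma> = assms(1)
  obtain C1 N0 where C1: "C1 > 0" and N0: "N0 > 0"
    and rate: "\<And>(n::nat) (\<mu> :: 'a measure). real n \<ge> N0 \<Longrightarrow> borel_prob \<mu> \<Longrightarrow> (AE \<theta> in \<mu>. norm \<theta> \<le> B) \<Longrightarrow>
    1 \<le> ln (real n) \<and> B \<le> \<sigma> * sqrt (24 * ln (real n)) \<and>
    (\<exists>A\<in>sets (PiM {..<n} (\<lambda>_. density lborel (\<lambda>y. ennreal (mix_dens \<sigma> \<mu> y)))).
      measure (PiM {..<n} (\<lambda>_. density lborel (\<lambda>y. ennreal (mix_dens \<sigma> \<mu> y)))) A \<ge> 1 - 5 / real n \<and>
      (\<forall>\<omega>\<in>A. \<forall>\<nu>. npmle \<sigma> n \<omega> \<nu> \<longrightarrow> (AE \<theta> in \<nu>. norm \<theta> \<le> \<sigma> * sqrt (24 * ln (real n))) \<and>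
       (\<integral>\<^sup>+y. ennreal \<bar>mix_dens \<sigma> \<mu> y - mix_dens \<sigma> \<nu> y\<bar> \<partial>lborel)
         \<le> ennreal (C1 * real n powr (- 1 / (8 * real DIM('a))))))"
  proof -
    from npmle_l1_rate[OF assms, where 'a='a] show thesis
      by (elim exE conjE) (rule that; blast)
  qed
  show ?thesis
  \<comment> \<open>\<open>N0\<close> can serve as \<open>C0\<close>: as soon as ln n \<ge> 1, the
    sample size condition implies n \<ge> N0.\<close>
  proof (rule exI[of _ N0], rule conjI[OF N0], intro allI impI, elim conjE)
    fix s k :: real
    assume k: "1 \<le> k"
    obtain C where C: "C > 0" and W: "\<And>(x::real) (\<mu> :: 'a measure) \<nu>.
      0 < x \<Longrightarrow> 1 \<le> ln x \<Longrightarrow> borel_prob \<mu> \<Longrightarrow> borel_prob \<nu> \<Longrightarrow>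
      (AE \<theta> in \<mu>. norm \<theta> \<le> \<sigma> * sqrt (24 * ln x)) \<Longrightarrow> (AE \<theta> in \<nu>. norm \<theta> \<le> \<sigma> * sqrt (24 * ln x)) \<Longrightarrow>
      (\<integral>\<^sup>+y. ennreal \<bar>mix_dens \<sigma> \<mu> y - mix_dens \<sigma> \<nu> y\<bar> \<partial>lborel)
           \<le> ennreal (C1 * x powr (- 1 / (8 * real DIM('a)))) \<Longrightarrow>
      wasserstein_pow k \<mu> \<nu> \<le> ennreal (C * (1 / ln x) powr (k / 2))"
    proof -
      have "0 < k" using k by simp
      from wasserstein_pow_log_rate[OF this \<sigma> C1, where 'a='a] show thesis
        by (elim exE conjE) (rule that; blast)
    qed
    show "\<exists>C>0. \<forall>(n::nat) (\<theta>::nat \<Rightarrow> 'a).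
       n \<ge> 1 \<and> (\<forall>i<n. norm (\<theta> i) \<le> B) \<and> real n \<ge> N0 * (ln (real n)) ^ (DIM('a) + 1) \<longrightarrow>
       (\<exists>A \<in> sets (sample_space \<sigma> n \<theta>).
          measure (sample_space \<sigma> n \<theta>) A \<ge> 1 - 5 / real n \<and>
          (\<forall>\<omega>\<in>A. \<forall>\<nu>. npmle \<sigma> n \<omega> \<nu> \<longrightarrow>
             wasserstein_pow k (emp_measure n \<theta>) \<nu> \<le> ennreal (C * (1 / ln (real n)) powr (k / 2))))"
    proof (rule exI[of _ C], rule conjI[OF C], intro allI impI, elim conjE)
      fix n :: nat and \<theta> :: "nat \<Rightarrow> 'a"
      assume n: "1 \<le> n" and \<theta>: "\<forall>i<n. norm (\<theta> i) \<le> B"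
        and nN: "N0 * (ln (real n)) ^ (DIM('a) + 1) \<le> real n"
      show "\<exists>A \<in> sets (sample_space \<sigma> n \<theta>).
          measure (sample_space \<sigma> n \<theta>) A \<ge> 1 - 5 / real n \<and>
          (\<forall>\<omega>\<in>A. \<forall>\<nu>. npmle \<sigma> n \<omega> \<nu> \<longrightarrow>
             wasserstein_pow k (emp_measure n \<theta>) \<nu> \<le> ennreal (C * (1 / ln (real n)) powr (k / 2)))"
      proof (cases "n \<le> 5")
        case True
        \<comment> \<open>The empty event suffices here. This also covers n = 1, where ln n = 0 and
          division by zero makes the right-hand side of the transport bound 0.\<close>
        then have "1 - 5 / real n \<le> 0" using n by (simp add: field_simps)
        then show ?thesis by (intro bexI[of _ "{}"]) auto
      next
        case False
        have "exp 1 \<le> real n" using False exp_le by (simp add: order_trans[OF exp_le])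
        then have "1 \<le> ln (real n)" using n by (subst ln_ge_iff) auto
        then have "N0 * 1 \<le> N0 * (ln (real n)) ^ (DIM('a) + 1)"
          using N0 by (intro mult_left_mono one_le_power) auto
        then have nN0: "real n \<ge> N0" using nN by linarith
        let ?\<mu> = "emp_measure n \<theta>"
        have \<mu>: "borel_prob ?\<mu>" "AE x in ?\<mu>. norm x \<le> B"
          using emp_measure_props[OF n, of \<theta> B] \<theta> by auto
        from rate[OF nN0 \<mu>] obtain A where l: "1 \<le> ln (real n)" "B \<le> \<sigma> * sqrt (24 * ln (real n))"
          and A: "A \<in> sets (sample_space \<sigma> n \<theta>)" "measure (sample_space \<sigma> n \<theta>) A \<ge> 1 - 5 / real n"
          and A': "\<And>\<omega> \<nu>. \<omega> \<in> A \<Longrightarrow> npmle \<sigma> n \<omega> \<nu> \<Longrightarrow> (AE \<theta> in \<nu>. norm \<theta> \<le> \<sigma> * sqrt (24 * ln (real n))) \<and>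
            (\<integral>\<^sup>+y. ennreal \<bar>mix_dens \<sigma> ?\<mu> y - mix_dens \<sigma> \<nu> y\<bar> \<partial>lborel)
              \<le> ennreal (C1 * real n powr (- 1 / (8 * real DIM('a))))"
          unfolding sample_space_def by blast
        have \<mu>R: "AE x in ?\<mu>. norm x \<le> \<sigma> * sqrt (24 * ln (real n))"
          using \<mu>(2) by eventually_elim (use l(2) in linarith)
        have "wasserstein_pow k ?\<mu> \<nu> \<le> ennreal (C * (1 / ln (real n)) powr (k / 2))"
          if "\<omega> \<in> A" "npmle \<sigma> n \<omega> \<nu>" for \<omega> \<nu>
          using W[OF _ l(1) \<mu>(1) _ \<mu>R, of \<nu>] A'[OF that] that(2) n by (simp add: npmle_def)
        then show ?thesis using A by blast
      qed
    qed
  qed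
qed

end
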